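(* The universal enveloping algebra functor $\mathcal{U}:\mathbf{PostLie}\to\mathbf{D\text{-}bialgebra}$ and the primitive elements functor $\operatorname{Prim}:\mathbf{D\text{-}bialgebra}\to\mathbf{PostLie}$ are adjoint functors ($\mathcal{U}$ being the left adjoint and $\operatorname{Prim}$ the right adjoint).
   Context: $\mathbb{K}$ is a field of characteristic zero. Sweedler notation: $\Delta(X)=X_{(1)}\otimes X_{(2)}$. A post-Lie algebra is a Lie algebra $(\mathfrak{g},[-,-])$ with a bilinear product $\triangleright$ such that $z\triangleright[x,y]=[z\triangleright x,y]+[x,z\triangleright y]$ and $[x,y]\triangleright z=\mathrm{a}(x,y,z)-\mathrm{a}(y,x,z)$, where $\mathrm{a}(x,y,z)=x\triangleright(y\triangleright z)-(x\triangleright y)\triangleright z$. $\mathbf{PostLie}$ is the category of post-Lie algebras and linear maps preserving $[-,-]$ and $\triangleright$. A $D$-bialgebra is a bialgebra $(D,\cdot,1,\Delta,\epsilon)$ with a non-associative product $\triangleright:D\otimes D\to D$ and an exhaustive increasing filtration $\mathbb{K}\cdot1=D^0\subset D^1\subset D^2\subset\cdots$ with $D^i\cdot D^j\subset D^{i+j}$, such that: (D1) $1\triangleright X=X$ and $X\triangleright1=\epsilon(X)1$ for all $X\in D$; (D2) $D_1:=\ker(\epsilon)\cap D^1$ equals $\operatorname{Prim}(D)=\{x\in D:\Delta x=x\otimes1+1\otimes x\}$ and generates $(D,\cdot)$; (D3) $\Delta(X\triangleright Y)=(X_{(1)}\triangleright Y_{(1)})\otimes(X_{(2)}\triangleright Y_{(2)})$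 for all $X,Y\in D$; (D4) $X\triangleright(Y\cdot Z)=(X_{(1)}\triangleright Y)\cdot(X_{(2)}\triangleright Z)$ for all $X,Y,Z\in D$; (D5) $(x\cdot X)\triangleright y=x\triangleright(X\triangleright y)-(x\triangleright X)\triangleright y$ for all $x,y\in D_1$, $X\in D$; (D6) $D_1$ is closed under the commutator of $\cdot$. Morphisms in $\mathbf{D\text{-}bialgebra}$ are morphisms of bialgebras commuting with $\triangleright$. The functor $\operatorname{Prim}$ sends $D$ to $\operatorname{Prim}(D)$, a post-Lie algebra for the commutator of $\cdot$ and the restriction of $\triangleright$, and acts on morphisms by restriction. The functor $\mathcal{U}$ sends a post-Lie algebra $(\mathfrak{g},[-,-],\triangleright)$ to the universal enveloping algebra $\mathcal{U}(\mathfrak{g})$ of $(\mathfrak{g},[-,-])$, with its standard bialgebra structure and filtration and the following product $\triangleright$. Let $T_0=\mathrm{id}_{\mathfrak g}$, $T_1(x;y)=x\triangleright y$ and, for $n\ge2$, $$T_n(x_1,\dots,x_n;y)=T_1(x_1;T_{n-1}(x_2,\dots,x_n;y))-\sum_{k=2}^nT_{n-1}(x_2,\dots,T_1(x_1;x_k),\dots,x_n;y).$$ These maps induce a well-defined map $T:\mathcal{U}(\mathfrak{g})\otimes\mathfrak{g}\to\mathfrak{g}$, $T(x_1\cdots x_n;y)=T_n(x_1,\dots,x_n;y)$, and one sets $X\triangleright y=T(X;y)$ for $y\in\mathfrak{g}$, $X\triangleright1=\epsilon(X)1$, and $X\triangleright(y_1\cdots y_n)=(X_{(1)}\triangleright y_1)\cdots(X_{(n)}\triangleright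 y_n)$. This makes $\mathcal{U}(\mathfrak{g})$ a $D$-bialgebra. *)

theory Defs
  imports "HOL-Library.Poly_Mapping" "HOL-Algebra.QuotRing" "HOL-Algebra.Algebraic_Closure_Type"
begin

text \<open>
  The base field is an arbitrary type of class \<^class>\<open>field_char_0\<close>, viewed as a ring record so
  that vector spaces are the modules of \<^theory>\<open>HOL-Algebra.Module\<close>. All algebraic structures have
  explicit carriers. The record of modules inherits the fields \<open>mult\<close> and \<open>one\<close> from rings; for
  plain vector spaces and for post-Lie algebras these two fields carry no information.
\<close>

abbreviation base_field :: "'k::field_char_0 ring"
  where "base_field \<equiv> ring_of_type_algebra"


section \<open>Linear algebra\<close>

definition linear_map ::
  "('k::field_char_0, 'a, 'm) module_scheme \<Rightarrow> ('k, 'b, 'n) module_scheme \<Rightarrow> ('a \<Rightarrow> 'b) \<Rightarrow> bool"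
  where "linear_map V W f \<longleftrightarrow>
    f \<in> carrier V \<rightarrow> carrier W \<and>
    (\<forall>x\<in>carrier V. \<forall>y\<in>carrier V. f (x \<oplus>\<^bsub>V\<^esub> y) = f x \<oplus>\<^bsub>W\<^esub> f y) \<and>
    (\<forall>c. \<forall>x\<in>carrier V. f (c \<odot>\<^bsub>V\<^esub> x) = c \<odot>\<^bsub>W\<^esub> f x)"

definition bilinear_op :: "('k::field_char_0, 'a, 'm) module_scheme \<Rightarrow> ('a \<Rightarrow> 'a \<Rightarrow> 'a) \<Rightarrow> bool"
  where "bilinear_op V b \<longleftrightarrow>
    (\<forall>x\<in>carrier V. linear_map V V (b x)) \<and> (\<forall>y\<in>carrier V. linear_map V V (\<lambda>x. b x y))"

definition submodule_span :: "('k::field_char_0, 'a, 'm) module_scheme \<Rightarrow> 'a set \<Rightarrow> 'a set"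
  where "submodule_span V S = \<Inter>{N. submodule N (base_field :: 'k ring) V \<and> S \<subseteq> N}"

text \<open>Quotient of a module by a submodule, or of an algebra by a two-sided ideal.\<close>

definition quotient_module ::
  "('k::field_char_0, 'a, 'm) module_scheme \<Rightarrow> 'a set \<Rightarrow> ('k, 'a set) module"
  where "quotient_module V N =
    \<lparr>carrier = carrier (V Quot N), monoid.mult = monoid.mult (V Quot N), one = one (V Quot N),
     ring.zero = ring.zero (V Quot N), add = add (V Quot N),
     module.smult = (\<lambda>c A. \<Union>a\<in>A. N +>\<^bsub>V\<^esub> (c \<odot>\<^bsub>V\<^esub> a))\<rparr>"

definition free_module :: "'x set \<Rightarrow> ('k::field_char_0, 'x \<Rightarrow>\<^sub>0 'k) module"
  where "free_module S =
    \<lparr>carrier = {f. Poly_Mapping.keys f \<subseteq> S}, monoid.mult = undefined, one = undefined,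
     ring.zero = 0, add = (+),
     module.smult = (\<lambda>c. Poly_Mapping.map ((*) c))\<rparr>"

definition linear_extension ::
  "('k::field_char_0, 'b, 'm) module_scheme \<Rightarrow> ('x \<Rightarrow> 'b) \<Rightarrow> ('x \<Rightarrow>\<^sub>0 'k) \<Rightarrow> 'b"
  where "linear_extension V b f =
    (\<Oplus>\<^bsub>V\<^esub>x\<in>Poly_Mapping.keys f. Poly_Mapping.lookup f x \<odot>\<^bsub>V\<^esub> b x)"

text \<open>The map induced by \<^const>\<open>linear_extension\<close> on a quotient of a free module; it does not depend
  on the chosen representative when the linear extension vanishes on the submodule divided out.\<close>

definition induced_map ::
  "('k::field_char_0, 'b, 'm) module_scheme \<Rightarrow> ('x \<Rightarrow> 'b) \<Rightarrow> ('x \<Rightarrow>\<^sub>0 'k) set \<Rightarrow> 'b"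
  where "induced_map V b u = linear_extension V b (SOME f. f \<in> u)"


section \<open>Tensor products\<close>

type_synonym ('k, 'a, 'b) tensor = "('a \<times> 'b \<Rightarrow>\<^sub>0 'k) set"

definition tensor_relations ::
  "('k::field_char_0, 'a, 'm) module_scheme \<Rightarrow> ('k, 'b, 'n) module_scheme \<Rightarrow> ('a \<times> 'b \<Rightarrow>\<^sub>0 'k) set"
  where "tensor_relations V W =
    {Poly_Mapping.single (x \<oplus>\<^bsub>V\<^esub> x', y) 1 - Poly_Mapping.single (x, y) 1
       - Poly_Mapping.single (x', y) 1 | x x' y.
       x \<in> carrier V \<and> x' \<in> carrier V \<and> y \<in> carrier W} \<union>
    {Poly_Mapping.single (x, y \<oplus>\<^bsub>W\<^esub> y') 1 - Poly_Mapping.single (x, y) 1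
       - Poly_Mapping.single (x, y') 1 | x y y'.
       x \<in> carrier V \<and> y \<in> carrier W \<and> y' \<in> carrier W} \<union>
    {Poly_Mapping.single (c \<odot>\<^bsub>V\<^esub> x, y) 1 - Poly_Mapping.single (x, y) c | c x y.
       x \<in> carrier V \<and> y \<in> carrier W} \<union>
    {Poly_Mapping.single (x, c \<odot>\<^bsub>W\<^esub> y) 1 - Poly_Mapping.single (x, y) c | c x y.
       x \<in> carrier V \<and> y \<in> carrier W}"

definition tensor_kernel ::
  "('k::field_char_0, 'a, 'm) module_scheme \<Rightarrow> ('k, 'b, 'n) module_scheme \<Rightarrow> ('a \<times> 'b \<Rightarrow>\<^sub>0 'k) set"
  where "tensor_kernel V W =
    submodule_span (free_module (carrier V \<times> carrier W)) (tensor_relations V W)"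

definition tensor ::
  "('k::field_char_0, 'a, 'm) module_scheme \<Rightarrow> ('k, 'b, 'n) module_scheme
    \<Rightarrow> ('k, ('k, 'a, 'b) tensor) module"
  where "tensor V W =
    quotient_module (free_module (carrier V \<times> carrier W)) (tensor_kernel V W)"

definition pure_tensor ::
  "('k::field_char_0, 'a, 'm) module_scheme \<Rightarrow> ('k, 'b, 'n) module_scheme
    \<Rightarrow> 'a \<Rightarrow> 'b \<Rightarrow> ('k, 'a, 'b) tensor"
  where "pure_tensor V W x y =
    tensor_kernel V W +>\<^bsub>free_module (carrier V \<times> carrier W)\<^esub> Poly_Mapping.single (x, y) 1"

text \<open>For a bilinear \<open>b\<close> with values in \<open>Z\<close>, the linear map \<open>x \<otimes> y \<mapsto> b x y\<close>. In Sweedler notation,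
  \<open>tensor_lift Z b (\<Delta> u)\<close> is \<open>b u\<^sub>(\<^sub>1\<^sub>) u\<^sub>(\<^sub>2\<^sub>)\<close>.\<close>

definition tensor_lift ::
  "('k::field_char_0, 'c, 'm) module_scheme \<Rightarrow> ('a \<Rightarrow> 'b \<Rightarrow> 'c) \<Rightarrow> ('k, 'a, 'b) tensor \<Rightarrow> 'c"
  where "tensor_lift Z b t = induced_map Z (\<lambda>(x, y). b x y) t"

text \<open>The bilinear operation \<open>(x \<otimes> y, x' \<otimes> y') \<mapsto> m x x' \<otimes> m y y'\<close> on the tensor square.\<close>

definition tensor_op ::
  "('k::field_char_0, 'a, 'm) module_scheme \<Rightarrow> ('a \<Rightarrow> 'a \<Rightarrow> 'a)
    \<Rightarrow> ('k, 'a, 'a) tensor \<Rightarrow> ('k, 'a, 'a) tensor \<Rightarrow> ('k, 'a, 'a) tensor"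
  where "tensor_op V m s t =
    tensor_lift (tensor V V)
      (\<lambda>x y. tensor_lift (tensor V V) (\<lambda>x' y'. pure_tensor V V (m x x') (m y y')) t) s"


section \<open>Post-Lie algebras\<close>

record ('k, 'a) tri_module = "('k, 'a) module" +
  tri :: "'a \<Rightarrow> 'a \<Rightarrow> 'a"  (infixl \<open>\<triangleright>\<index>\<close> 70)

record ('k, 'a) post_lie = "('k, 'a) tri_module" +
  bracket :: "'a \<Rightarrow> 'a \<Rightarrow> 'a"

definition tri_assoc :: "('k::field_char_0, 'a, 'm) tri_module_scheme \<Rightarrow> 'a \<Rightarrow> 'a \<Rightarrow> 'a \<Rightarrow> 'a"
  where "tri_assoc V x y z =
    x \<triangleright>\<^bsub>V\<^esub> (y \<triangleright>\<^bsub>V\<^esub> z) \<ominus>\<^bsub>V\<^esub> (x \<triangleright>\<^bsub>V\<^esub> y) \<triangleright>\<^bsub>V\<^esub> z"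

locale post_lie_algebra = module "base_field :: 'k ring" \<gg>
  for \<gg> :: "('k::field_char_0, 'g) post_lie" (structure) +
  assumes bracket_bilinear: "bilinear_op \<gg> (bracket \<gg>)"
    and bracket_alternating: "x \<in> carrier \<gg> \<Longrightarrow> bracket \<gg> x x = \<zero>"
    and jacobi: "\<lbrakk>x \<in> carrier \<gg>; y \<in> carrier \<gg>; z \<in> carrier \<gg>\<rbrakk> \<Longrightarrow>
      bracket \<gg> x (bracket \<gg> y z) \<oplus> bracket \<gg> y (bracket \<gg> z x) \<oplus> bracket \<gg> z (bracket \<gg> x y) = \<zero>"
    and tri_bilinear: "bilinear_op \<gg> (tri \<gg>)"
    and tri_bracket: "\<lbrakk>x \<in> carrier \<gg>; y \<in> carrier \<gg>; z \<in> carrier \<gg>\<rbrakk> \<Longrightarrow>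
      z \<triangleright> bracket \<gg> x y = bracket \<gg> (z \<triangleright> x) y \<oplus> bracket \<gg> x (z \<triangleright> y)"
    and bracket_tri: "\<lbrakk>x \<in> carrier \<gg>; y \<in> carrier \<gg>; z \<in> carrier \<gg>\<rbrakk> \<Longrightarrow>
      bracket \<gg> x y \<triangleright> z = tri_assoc \<gg> x y z \<ominus> tri_assoc \<gg> y x z"

text \<open>Morphisms are extensional functions, so that equality of morphisms is equality on the carrier;
  they are composed with \<^const>\<open>compose\<close>.\<close>

definition post_lie_hom ::
  "('k::field_char_0, 'g) post_lie \<Rightarrow> ('k, 'h) post_lie \<Rightarrow> ('g \<Rightarrow> 'h) set"
  where "post_lie_hom \<gg> \<hh> =
    {f \<in> extensional (carrier \<gg>). linear_map \<gg> \<hh> f \<and>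
       (\<forall>x\<in>carrier \<gg>. \<forall>y\<in>carrier \<gg>. f (bracket \<gg> x y) = bracket \<hh> (f x) (f y)) \<and>
       (\<forall>x\<in>carrier \<gg>. \<forall>y\<in>carrier \<gg>. f (x \<triangleright>\<^bsub>\<gg>\<^esub> y) = f x \<triangleright>\<^bsub>\<hh>\<^esub> f y)}"


section \<open>D-bialgebras\<close>

record (overloaded) ('k::zero, 'a) D_bialg = "('k, 'a) tri_module" +
  comult :: "'a \<Rightarrow> ('k, 'a, 'a) tensor"
  counit :: "'a \<Rightarrow> 'k"
  filt :: "nat \<Rightarrow> 'a set"

locale bialgebra = module "base_field :: 'k ring" D + ring D
  for D :: "('k::field_char_0, 'a) D_bialg" (structure) +
  assumes smult_mult: "\<lbrakk>x \<in> carrier D; y \<in> carrier D\<rbrakk> \<Longrightarrow> (c \<odot> x) \<otimes> y = c \<odot> (x \<otimes> y)"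
    and mult_smult: "\<lbrakk>x \<in> carrier D; y \<in> carrier D\<rbrakk> \<Longrightarrow> x \<otimes> (c \<odot> y) = c \<odot> (x \<otimes> y)"
    and comult_linear: "linear_map D (tensor D D) (comult D)"
    and counit_add: "\<lbrakk>x \<in> carrier D; y \<in> carrier D\<rbrakk> \<Longrightarrow>
      counit D (x \<oplus> y) = counit D x + counit D y"
    and counit_smult: "x \<in> carrier D \<Longrightarrow> counit D (c \<odot> x) = c * counit D x"
    and coassoc: "x \<in> carrier D \<Longrightarrow>
      tensor_lift (tensor D (tensor D D))
        (\<lambda>a b. tensor_lift (tensor D (tensor D D))
          (\<lambda>a\<^sub>1 a\<^sub>2. pure_tensor D (tensor D D) a\<^sub>1 (pure_tensor D D a\<^sub>2 b)) (comult D a))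
        (comult D x) =
      tensor_lift (tensor D (tensor D D))
        (\<lambda>a b. pure_tensor D (tensor D D) a (comult D b)) (comult D x)"
    and counit_left: "x \<in> carrier D \<Longrightarrow> tensor_lift D (\<lambda>a b. counit D a \<odot> b) (comult D x) = x"
    and counit_right: "x \<in> carrier D \<Longrightarrow> tensor_lift D (\<lambda>a b. counit D b \<odot> a) (comult D x) = x"
    and comult_one: "comult D \<one> = pure_tensor D D \<one> \<one>"
    and comult_mult: "\<lbrakk>x \<in> carrier D; y \<in> carrier D\<rbrakk> \<Longrightarrow>
      comult D (x \<otimes> y) = tensor_op D (monoid.mult D) (comult D x) (comult D y)"
    and counit_one: "counit D \<one> = 1"
    and counit_mult: "\<lbrakk>x \<in> carrier D; y \<in> carrier D\<rbrakk> \<Longrightarrow>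
      counit D (x \<otimes> y) = counit D x * counit D y"

definition primitives :: "('k::field_char_0, 'a) D_bialg \<Rightarrow> 'a set"
  where "primitives D = {x \<in> carrier D.
    comult D x = pure_tensor D D x \<one>\<^bsub>D\<^esub> \<oplus>\<^bsub>tensor D D\<^esub> pure_tensor D D \<one>\<^bsub>D\<^esub> x}"

definition filt_one_ker :: "('k::field_char_0, 'a) D_bialg \<Rightarrow> 'a set"
  where "filt_one_ker D = {x \<in> carrier D. counit D x = 0} \<inter> filt D 1"

locale D_bialgebra = bialgebra D for D :: "('k::field_char_0, 'a) D_bialg" (structure) +
  assumes tri_bilinear: "bilinear_op D (tri D)"
    and filt_submodule: "submodule (filt D n) (base_field :: 'k ring) D"
    and filt_zero: "filt D 0 = {c \<odot> \<one> | c. True}"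
    and filt_increasing: "filt D n \<subseteq> filt D (Suc n)"
    and filt_exhaustive: "(\<Union>n. filt D n) = carrier D"
    and filt_mult: "\<lbrakk>x \<in> filt D i; y \<in> filt D j\<rbrakk> \<Longrightarrow> x \<otimes> y \<in> filt D (i + j)"
    and D1_left: "x \<in> carrier D \<Longrightarrow> \<one> \<triangleright> x = x"
    and D1_right: "x \<in> carrier D \<Longrightarrow> x \<triangleright> \<one> = counit D x \<odot> \<one>"
    and D2_primitives: "filt_one_ker D = primitives D"
    and D2_generates: "\<lbrakk>subring S D; \<And>c x. x \<in> S \<Longrightarrow> c \<odot> x \<in> S; filt_one_ker D \<subseteq> S\<rbrakk> \<Longrightarrow>
      S = carrier D"
    and D3: "\<lbrakk>x \<in> carrier D; y \<in> carrier D\<rbrakk> \<Longrightarrow>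
      comult D (x \<triangleright> y) = tensor_op D (tri D) (comult D x) (comult D y)"
    and D4: "\<lbrakk>x \<in> carrier D; y \<in> carrier D; z \<in> carrier D\<rbrakk> \<Longrightarrow>
      x \<triangleright> (y \<otimes> z) = tensor_lift D (\<lambda>a b. (a \<triangleright> y) \<otimes> (b \<triangleright> z)) (comult D x)"
    and D5: "\<lbrakk>x \<in> filt_one_ker D; y \<in> filt_one_ker D; z \<in> carrier D\<rbrakk> \<Longrightarrow>
      (x \<otimes> z) \<triangleright> y = x \<triangleright> (z \<triangleright> y) \<ominus> (x \<triangleright> z) \<triangleright> y"
    and D6: "\<lbrakk>x \<in> filt_one_ker D; y \<in> filt_one_ker D\<rbrakk> \<Longrightarrow>
      (x \<otimes> y) \<ominus> (y \<otimes> x) \<in> filt_one_ker D"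

text \<open>Morphisms are not required to respect the filtrations.\<close>

definition D_bialgebra_hom ::
  "('k::field_char_0, 'a) D_bialg \<Rightarrow> ('k, 'b) D_bialg \<Rightarrow> ('a \<Rightarrow> 'b) set"
  where "D_bialgebra_hom D E =
    {f \<in> extensional (carrier D). linear_map D E f \<and>
       f \<one>\<^bsub>D\<^esub> = \<one>\<^bsub>E\<^esub> \<and>
       (\<forall>x\<in>carrier D. \<forall>y\<in>carrier D. f (x \<otimes>\<^bsub>D\<^esub> y) = f x \<otimes>\<^bsub>E\<^esub> f y) \<and>
       (\<forall>x\<in>carrier D. counit E (f x) = counit D x) \<and>
       (\<forall>x\<in>carrier D. comult E (f x) =
          tensor_lift (tensor E E) (\<lambda>a b. pure_tensor E E (f a) (f b)) (comult D x)) \<and>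
       (\<forall>x\<in>carrier D. \<forall>y\<in>carrier D. f (x \<triangleright>\<^bsub>D\<^esub> y) = f x \<triangleright>\<^bsub>E\<^esub> f y)}"


section \<open>The functor of primitive elements\<close>

definition Prim :: "('k::field_char_0, 'a) D_bialg \<Rightarrow> ('k, 'a) post_lie"
  where "Prim D =
    \<lparr>carrier = primitives D, monoid.mult = monoid.mult D, one = one D,
     ring.zero = ring.zero D, add = add D, module.smult = module.smult D, tri = tri D, bracket = (\<lambda>x y. (x \<otimes>\<^bsub>D\<^esub> y) \<ominus>\<^bsub>D\<^esub> (y \<otimes>\<^bsub>D\<^esub> x))\<rparr>"

definition Prim_map :: "('k::field_char_0, 'a) D_bialg \<Rightarrow> ('a \<Rightarrow> 'b) \<Rightarrow> 'a \<Rightarrow> 'b"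
  where "Prim_map D f = restrict f (primitives D)"


section \<open>The functor of universal enveloping algebras\<close>

text \<open>The free algebra has the words over \<open>S\<close> as basis.\<close>

definition free_algebra :: "'x set \<Rightarrow> ('k::field_char_0, 'x list \<Rightarrow>\<^sub>0 'k) module"
  where "free_algebra S =
    \<lparr>carrier = {f. Poly_Mapping.keys f \<subseteq> lists S},
     monoid.mult = (\<lambda>f h. \<Sum>u\<in>Poly_Mapping.keys f. \<Sum>v\<in>Poly_Mapping.keys h.
       Poly_Mapping.single (u @ v) (Poly_Mapping.lookup f u * Poly_Mapping.lookup h v)),
     one = Poly_Mapping.single [] 1, ring.zero = 0, add = (+),
     module.smult = (\<lambda>c. Poly_Mapping.map ((*) c))\<rparr>"

type_synonym ('k, 'g) uea = "('g list \<Rightarrow>\<^sub>0 'k) set"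

text \<open>The first two families of relations present the tensor algebra of the vector space \<open>\<gg>\<close> as a
  quotient of the free algebra on the set \<open>\<gg>\<close>; the third one imposes \<open>x y - y x = [x, y]\<close>.\<close>

definition uea_relations :: "('k::field_char_0, 'g) post_lie \<Rightarrow> ('g list \<Rightarrow>\<^sub>0 'k) set"
  where "uea_relations \<gg> =
    {Poly_Mapping.single [x \<oplus>\<^bsub>\<gg>\<^esub> y] 1 - Poly_Mapping.single [x] 1 - Poly_Mapping.single [y] 1 | x y.
       x \<in> carrier \<gg> \<and> y \<in> carrier \<gg>} \<union>
    {Poly_Mapping.single [c \<odot>\<^bsub>\<gg>\<^esub> x] 1 - Poly_Mapping.single [x] c | c x. x \<in> carrier \<gg>} \<union>
    {Poly_Mapping.single [x, y] 1 - Poly_Mapping.single [y, x] 1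
       - Poly_Mapping.single [bracket \<gg> x y] 1 | x y. x \<in> carrier \<gg> \<and> y \<in> carrier \<gg>}"

definition uea_ideal :: "('k::field_char_0, 'g) post_lie \<Rightarrow> ('g list \<Rightarrow>\<^sub>0 'k) set"
  where "uea_ideal \<gg> =
    genideal (free_algebra (carrier \<gg>) :: ('k, 'g list \<Rightarrow>\<^sub>0 'k) module) (uea_relations \<gg>)"

definition uea_algebra :: "('k::field_char_0, 'g) post_lie \<Rightarrow> ('k, ('k, 'g) uea) module"
  where "uea_algebra \<gg> = quotient_module (free_algebra (carrier \<gg>)) (uea_ideal \<gg>)"

text \<open>\<open>uea_word \<gg> [x\<^sub>1, \<dots>, x\<^sub>n]\<close> is the product \<open>x\<^sub>1 \<cdots> x\<^sub>n\<close> in \<open>\<U>(\<gg>)\<close>.\<close>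

definition uea_word :: "('k::field_char_0, 'g) post_lie \<Rightarrow> 'g list \<Rightarrow> ('k, 'g) uea"
  where "uea_word \<gg> w = uea_ideal \<gg> +>\<^bsub>free_algebra (carrier \<gg>)\<^esub> Poly_Mapping.single w 1"

text \<open>The coproduct is the algebra morphism that makes the elements of \<open>\<gg>\<close> primitive.\<close>

definition uea_comult ::
  "('k::field_char_0, 'g) post_lie \<Rightarrow> ('k, 'g) uea \<Rightarrow> ('k, ('k, 'g) uea, ('k, 'g) uea) tensor"
  where "uea_comult \<gg> u =
    (let U = uea_algebra \<gg>; U2 = tensor U U;
         \<delta> = (\<lambda>x. pure_tensor U U (uea_word \<gg> [x]) \<one>\<^bsub>U\<^esub> \<oplus>\<^bsub>U2\<^esub> pure_tensor U U \<one>\<^bsub>U\<^esub> (uea_word \<gg> [x]))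
     in induced_map U2
          (\<lambda>w. foldr (\<lambda>x t. tensor_op U (monoid.mult U) (\<delta> x) t) w (pure_tensor U U \<one>\<^bsub>U\<^esub> \<one>\<^bsub>U\<^esub>)) u)"

text \<open>The counit is the coefficient of the empty word.\<close>

definition uea_counit :: "('k::field_char_0, 'g) post_lie \<Rightarrow> ('k, 'g) uea \<Rightarrow> 'k"
  where "uea_counit \<gg> u = Poly_Mapping.lookup (SOME f. f \<in> u) []"

fun T_word :: "('k::field_char_0, 'g) post_lie \<Rightarrow> 'g list \<Rightarrow> 'g \<Rightarrow> 'g"
  where
    "T_word \<gg> [] y = y"
  | "T_word \<gg> (x # xs) y = (x \<triangleright>\<^bsub>\<gg>\<^esub> T_word \<gg> xs y)
       \<ominus>\<^bsub>\<gg>\<^esub> (\<Oplus>\<^bsub>\<gg>\<^esub>k\<in>{..<length xs}. T_word \<gg> (xs[k := x \<triangleright>\<^bsub>\<gg>\<^esub> (xs ! k)]) y)"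

definition uea_T :: "('k::field_char_0, 'g) post_lie \<Rightarrow> ('k, 'g) uea \<Rightarrow> 'g \<Rightarrow> 'g"
  where "uea_T \<gg> u y = induced_map \<gg> (\<lambda>w. T_word \<gg> w y) u"

text \<open>\<open>uea_tri_word \<gg> u [y\<^sub>1, \<dots>, y\<^sub>n]\<close> is \<open>u \<triangleright> (y\<^sub>1 \<cdots> y\<^sub>n)\<close>, the iterated coproduct of \<open>u\<close> being
  computed by splitting off one tensor factor at a time.\<close>

fun uea_tri_word :: "('k::field_char_0, 'g) post_lie \<Rightarrow> ('k, 'g) uea \<Rightarrow> 'g list \<Rightarrow> ('k, 'g) uea"
  where
    "uea_tri_word \<gg> u [] = uea_counit \<gg> u \<odot>\<^bsub>uea_algebra \<gg>\<^esub> \<one>\<^bsub>uea_algebra \<gg>\<^esub>"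
  | "uea_tri_word \<gg> u [y] = uea_word \<gg> [uea_T \<gg> u y]"
  | "uea_tri_word \<gg> u (y # z # ys) =
       tensor_lift (uea_algebra \<gg>)
         (\<lambda>a b. uea_word \<gg> [uea_T \<gg> a y] \<otimes>\<^bsub>uea_algebra \<gg>\<^esub> uea_tri_word \<gg> b (z # ys))
         (uea_comult \<gg> u)"

definition uea_tri ::
  "('k::field_char_0, 'g) post_lie \<Rightarrow> ('k, 'g) uea \<Rightarrow> ('k, 'g) uea \<Rightarrow> ('k, 'g) uea"
  where "uea_tri \<gg> u v = induced_map (uea_algebra \<gg>) (uea_tri_word \<gg> u) v"

text \<open>The \<open>n\<close>-th piece of the filtration is spanned by the products of at most \<open>n\<close> elements of \<open>\<gg>\<close>.\<close>

definition uea_filt :: "('k::field_char_0, 'g) post_lie \<Rightarrow> nat \<Rightarrow> ('k, 'g) uea set"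
  where "uea_filt \<gg> n =
    submodule_span (uea_algebra \<gg>) {uea_word \<gg> w | w. w \<in> lists (carrier \<gg>) \<and> length w \<le> n}"

definition UEA :: "('k::field_char_0, 'g) post_lie \<Rightarrow> ('k, ('k, 'g) uea) D_bialg"
  where "UEA \<gg> =
    \<lparr>carrier = carrier (uea_algebra \<gg>), monoid.mult = monoid.mult (uea_algebra \<gg>),
     one = one (uea_algebra \<gg>),
     ring.zero = ring.zero (uea_algebra \<gg>), add = add (uea_algebra \<gg>), module.smult = module.smult (uea_algebra \<gg>),
     tri = uea_tri \<gg>, comult = uea_comult \<gg>, counit = uea_counit \<gg>, filt = uea_filt \<gg>\<rparr>"

definition UEA_map ::
  "('k::field_char_0, 'g) post_lie \<Rightarrow> ('k, 'h) post_lie \<Rightarrow> ('g \<Rightarrow> 'h) \<Rightarrow> ('k, 'g) uea \<Rightarrow> ('k, 'h) uea"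
  where "UEA_map \<gg> \<hh> \<phi> =
    (\<lambda>u\<in>carrier (UEA \<gg>). induced_map (UEA \<hh>) (\<lambda>w. uea_word \<hh> (map \<phi> w)) u)"


section \<open>The comparison of morphisms\<close>

text \<open>The component at \<open>(\<gg>, D)\<close> of the adjunction bijection, \<open>f \<mapsto> Prim(f) \<circ> \<eta>\<close>, where \<open>\<eta>\<close> is the
  canonical map from \<open>\<gg>\<close> to \<open>\<U>(\<gg>)\<close>. It is a polymorphic constant because the carriers of the objects
  live in varying types, over which a bound variable could not range.\<close>

definition UEA_unit :: "('k::field_char_0, 'g) post_lie \<Rightarrow> 'g \<Rightarrow> ('k, 'g) uea"
  where "UEA_unit \<gg> = (\<lambda>x\<in>carrier \<gg>. uea_word \<gg> [x])"

definition transpose_hom ::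
  "('k::field_char_0, 'g) post_lie \<Rightarrow> (('k, 'g) uea \<Rightarrow> 'a) \<Rightarrow> 'g \<Rightarrow> 'a"
  where "transpose_hom \<gg> f = compose (carrier \<gg>) (Prim_map (UEA \<gg>) f) (UEA_unit \<gg>)"

end

theory Submission
  imports Defs
begin

text \<open>
  On words in \<open>\<gg>\<close> the coproduct of \<open>\<U>(\<gg>)\<close> is the sum over all ways to distribute the letters over
  two subwords, and a primitive element acts by derivations. Hence the axioms (D3), (D4), (D5) for
  \<open>\<U>(\<gg>)\<close> become identities between such sums, proved by induction on the length of words from
  coassociativity, cocommutativity and the recursion defining \<open>T\<close>; the product \<open>\<triangleright>\<close> is well defined in
  its second argument because \<open>T(X; [x, y]) = [T(X\<^sub>(\<^sub>1\<^sub>); x), T(X\<^sub>(\<^sub>2\<^sub>); y)]\<close>. The primitive elements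
  of \<open>\<U>(\<gg>)\<close> are the image of \<open>\<gg>\<close>: multiplication after comultiplication doubles a primitive element,
  but is \<open>2\<^sup>n\<close> times the identity on the \<open>n\<close>-th graded piece of the filtration. Since \<open>\<U>(\<gg>)\<close> is generated by
  \<open>\<gg>\<close>, a morphism \<open>\<U>(\<gg>) \<rightarrow> D\<close> is determined by its restriction to \<open>\<gg>\<close>; conversely (D4) and (D5) for \<open>D\<close>
  force the algebra morphism extending \<open>\<gg> \<rightarrow> Prim(D)\<close> to preserve \<open>\<triangleright>\<close>.
\<close>

section \<open>Vector spaces\<close>

text \<open>Elements of U(g) and of tensor products are cosets, and maps out of them are evaluated
  at a representative picked by \<open>SOME\<close>. Such a map can be computed on words only once
  the underlying function is known to respect the relations at every position of a word, so the
  well-definedness of T and of \<triangleright> has to precede every axiom on \<triangleright>. For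
  T this is the axiom \<open>bracket_tri\<close> when the bracket stands at the front of the word,
  and the axiom \<open>tri_bracket\<close> when a letter in front acts on it. Sweedler sums are not
  handled as tensors: the summand is a continuation F passed to \<open>unshuffle\<close> or
  \<open>derive_word\<close>, so the coalgebra laws and the Leibniz rule become equations between
  iterated sums in any target space. The recursion for T alters letters of the tail, hence
  inductions run on word length and congruence rules remember lengths. The factor 2^n counts the
  ways to split n letters; putting the letters back in order costs only shorter words.\<close>

locale vspace = abelian_group V for V :: "('k::field_char_0, 'a, 'm) module_scheme" (structure) +
  assumes smult_closed [simp, intro]: "x \<in> carrier V \<Longrightarrow> c \<odot> x \<in> carrier V"
    and smult_l_distr: "x \<in> carrier V \<Longrightarrow> (a + b) \<odot> x = a \<odot> x \<oplus> b \<odot> x"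
    and smult_r_distr: "\<lbrakk>x \<in> carrier V; y \<in> carrier V\<rbrakk> \<Longrightarrow> a \<odot> (x \<oplus> y) = a \<odot> x \<oplus> a \<odot> y"
    and smult_smult: "x \<in> carrier V \<Longrightarrow> a \<odot> (b \<odot> x) = (a * b) \<odot> x"
    and smult_one [simp]: "x \<in> carrier V \<Longrightarrow> 1 \<odot> x = x"

lemma base_field_simps [simp]:
  "carrier base_field = UNIV" "\<zero>\<^bsub>base_field\<^esub> = 0" "\<one>\<^bsub>base_field\<^esub> = 1"
  "a \<oplus>\<^bsub>base_field\<^esub> b = a + b" "a \<otimes>\<^bsub>base_field\<^esub> b = a * b"
  by (simp_all add: ring_of_type_algebra_def)

text \<open>\<open>vspace\<close> restates the module axioms with scalars of the type
  \<open>'k\<close> itself instead of the record \<open>base_field\<close>, so that the simplifier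
  sees ordinary field arithmetic and no carrier conditions on scalars.\<close>

lemma vspace_iff_module:
  fixes V :: "('k::field_char_0, 'a, 'm) module_scheme"
  shows "vspace V \<longleftrightarrow> module (base_field :: 'k ring) V"
proof
  assume "vspace V"
  then interpret vspace V .
  show "module (base_field :: 'k ring) V"
    by (rule moduleI)
      (simp_all add: cring_from_type_algebra abelian_group_axioms smult_l_distr smult_r_distr smult_smult)
next
  assume "module (base_field :: 'k ring) V"
  then interpret module "base_field :: 'k ring" V .
  show "vspace V"
    using smult_l_distr smult_r_distr smult_assoc1 smult_one
    by unfold_locales simp_all
qed

context vspace
begin

lemma module_axioms: "module (base_field :: 'k ring) V"
  using vspace_iff_module vspace_axioms by blast

lemma smult_zero_left [simp]: "x \<in> carrier V \<Longrightarrow> 0 \<odot> x = \<zero>"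
  using module.smult_l_null[OF module_axioms] by simp

lemma smult_zero_right [simp]: "c \<odot> \<zero> = \<zero>"
  using module.smult_r_null[OF module_axioms] by simp

lemma smult_minus_one: "x \<in> carrier V \<Longrightarrow> (-1) \<odot> x = \<ominus> x"
  using smult_l_distr[of x "-1" 1] by (simp add: minus_equality)

lemma smult_minus: "x \<in> carrier V \<Longrightarrow> (- c) \<odot> x = \<ominus> (c \<odot> x)"
  using smult_smult[of x "-1" c] by (simp add: smult_minus_one)

lemma smult_a_inv: "x \<in> carrier V \<Longrightarrow> c \<odot> (\<ominus> x) = \<ominus> (c \<odot> x)"
  using smult_smult[of x "c" "-1"] by (simp add: smult_minus_one smult_minus)

lemma smult_left_diff: "x \<in> carrier V \<Longrightarrow> (a - b) \<odot> x = a \<odot> x \<ominus> b \<odot> x"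
  using smult_l_distr[of x a "- b"] by (simp add: smult_minus a_minus_def)

lemma smult_right_diff:
  "\<lbrakk>x \<in> carrier V; y \<in> carrier V\<rbrakk> \<Longrightarrow> a \<odot> (x \<ominus> y) = a \<odot> x \<ominus> a \<odot> y"
  by (simp add: a_minus_def smult_r_distr smult_a_inv)

lemma minus_eq_zeroD:
  assumes "x \<in> carrier V" "y \<in> carrier V" "x \<ominus> y = \<zero>" shows "x = y"
  using assms by (metis a_minus_def add.inv_closed add.inv_equality minus_minus)

lemma diff_eq_iff:
  "\<lbrakk>x \<in> carrier V; y \<in> carrier V; z \<in> carrier V\<rbrakk> \<Longrightarrow> x \<ominus> y = z \<longleftrightarrow> x = z \<oplus> y"
  unfolding a_minus_def using add.inv_solve_right[of z x y] by auto

lemma eq_diff_iff: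
  "\<lbrakk>x \<in> carrier V; y \<in> carrier V; z \<in> carrier V\<rbrakk> \<Longrightarrow> z = x \<ominus> y \<longleftrightarrow> z \<oplus> y = x"
  using diff_eq_iff[of x y z] by auto

text \<open>Minus signs are pulled outwards and then, by the two equivalences above, across the
  equality sign. An identity between signed sums is thereby reduced to one without signs, which
  associativity and commutativity decide; \<open>diff_simps\<close> is used for this
  throughout.\<close>

lemma minus_normalize:
  "\<lbrakk>x \<in> carrier V; y \<in> carrier V; z \<in> carrier V\<rbrakk> \<Longrightarrow> x \<oplus> (y \<ominus> z) = (x \<oplus> y) \<ominus> z"
  "\<lbrakk>x \<in> carrier V; y \<in> carrier V; z \<in> carrier V\<rbrakk> \<Longrightarrow> (x \<ominus> y) \<oplus> z = (x \<oplus> z) \<ominus> y"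
  "\<lbrakk>x \<in> carrier V; y \<in> carrier V; z \<in> carrier V\<rbrakk> \<Longrightarrow> (x \<ominus> y) \<ominus> z = x \<ominus> (y \<oplus> z)"
  "\<lbrakk>x \<in> carrier V; y \<in> carrier V; z \<in> carrier V\<rbrakk> \<Longrightarrow> x \<ominus> (y \<ominus> z) = (x \<oplus> z) \<ominus> y"
  "\<lbrakk>x \<in> carrier V; y \<in> carrier V\<rbrakk> \<Longrightarrow> \<ominus> (x \<ominus> y) = y \<ominus> x"
  by (simp_all add: a_minus_def minus_add a_ac)

lemmas diff_simps = minus_normalize diff_eq_iff eq_diff_iff

lemma submoduleI:
  assumes "N \<subseteq> carrier V" "\<zero> \<in> N" "\<And>x y. \<lbrakk>x \<in> N; y \<in> N\<rbrakk> \<Longrightarrow> x \<oplus> y \<in> N"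
    "\<And>c x. x \<in> N \<Longrightarrow> c \<odot> x \<in> N"
  shows "submodule N (base_field :: 'k ring) V"
proof (rule module.submoduleI[OF module_axioms])
  fix a assume "a \<in> N"
  with assms(1) assms(4)[of a "-1"] show "\<ominus> a \<in> N" by (auto simp: smult_minus_one subset_eq)
qed (use assms in auto)

lemma submoduleD:
  assumes "submodule N (base_field :: 'k ring) V"
  shows "N \<subseteq> carrier V" "\<zero> \<in> N" "\<lbrakk>x \<in> N; y \<in> N\<rbrakk> \<Longrightarrow> x \<oplus> y \<in> N" "x \<in> N \<Longrightarrow> c \<odot> x \<in> N"
    "\<lbrakk>x \<in> N; y \<in> N\<rbrakk> \<Longrightarrow> x \<ominus> y \<in> N" "x \<in> N \<Longrightarrow> \<ominus> x \<in> N"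
proof -
  note E = module.submoduleE[OF module_axioms assms]
  show "N \<subseteq> carrier V" by (fact E(1))
  show add: "\<lbrakk>x \<in> N; y \<in> N\<rbrakk> \<Longrightarrow> x \<oplus> y \<in> N" for x y by (fact E(5))
  show "x \<in> N \<Longrightarrow> c \<odot> x \<in> N" using E(4)[of c x] by simp
  show inv: "x \<in> N \<Longrightarrow> \<ominus> x \<in> N" for x by (fact E(3))
  show "\<lbrakk>x \<in> N; y \<in> N\<rbrakk> \<Longrightarrow> x \<ominus> y \<in> N" using add inv by (simp add: a_minus_def)
  obtain a where "a \<in> N" using E(2) by auto
  then show "\<zero> \<in> N" using add[OF _ inv] E(1) r_neg by (metis subsetD)
qed

lemma abelian_subgroup_if_submodule:
  assumes "submodule N (base_field :: 'k ring) V" shows "abelian_subgroup N V"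
  by (rule abelian_subgroupI3)
    (simp_all add: additive_subgroupI submodule.axioms(1)[OF assms] abelian_group_axioms)

lemma submodule_span_submodule:
  assumes "S \<subseteq> carrier V" shows "submodule (submodule_span V S) (base_field :: 'k ring) V"
proof -
  have "submodule (carrier V) (base_field :: 'k ring) V"
    by (rule submoduleI) auto
  then show ?thesis
    unfolding submodule_span_def using assms submoduleD(2,3,4)
    by (intro submoduleI) (force | meson InterE InterI mem_Collect_eq)+
qed

end

lemma submodule_span_superset: "S \<subseteq> submodule_span V S"
  by (auto simp: submodule_span_def)

lemma submodule_span_minimal:
  fixes V :: "('k::field_char_0, 'a, 'm) module_scheme"
  assumes "submodule N (base_field :: 'k ring) V" "S \<subseteq> N" shows "submodule_span V S \<subseteq> N"
  using assms by (auto simp: submodule_span_def)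


section \<open>Linear and bilinear maps\<close>

lemma linear_mapI:
  assumes "\<And>x. x \<in> carrier V \<Longrightarrow> f x \<in> carrier W"
    "\<And>x y. \<lbrakk>x \<in> carrier V; y \<in> carrier V\<rbrakk> \<Longrightarrow> f (x \<oplus>\<^bsub>V\<^esub> y) = f x \<oplus>\<^bsub>W\<^esub> f y"
    "\<And>c x. x \<in> carrier V \<Longrightarrow> f (c \<odot>\<^bsub>V\<^esub> x) = c \<odot>\<^bsub>W\<^esub> f x"
  shows "linear_map V W f"
  using assms by (auto simp: linear_map_def)

lemma linear_mapD:
  assumes "linear_map V W f"
  shows "x \<in> carrier V \<Longrightarrow> f x \<in> carrier W"
    "\<lbrakk>x \<in> carrier V; y \<in> carrier V\<rbrakk> \<Longrightarrow> f (x \<oplus>\<^bsub>V\<^esub> y) = f x \<oplus>\<^bsub>W\<^esub> f y"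
    "x \<in> carrier V \<Longrightarrow> f (c \<odot>\<^bsub>V\<^esub> x) = c \<odot>\<^bsub>W\<^esub> f x"
  using assms by (auto simp: linear_map_def)

text \<open>Agreement on the carrier suffices because the carrier of V is closed under the
  operations at whose results g is evaluated; this is what the assumption on V provides.\<close>

lemma linear_map_cong:
  assumes "vspace V" "linear_map V W f" "\<And>x. x \<in> carrier V \<Longrightarrow> g x = f x"
  shows "linear_map V W g"
proof -
  interpret vspace V by fact
  show ?thesis using assms(2,3) by (simp add: linear_map_def Pi_iff)
qed

lemma linear_map_compose:
  "\<lbrakk>linear_map V W f; linear_map W Z g\<rbrakk> \<Longrightarrow> linear_map V Z (\<lambda>x. g (f x))"
  by (auto simp: linear_map_def Pi_iff)

lemma linear_map_id: "linear_map V V (\<lambda>x. x)"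
  by (simp add: linear_map_def)

lemma linear_map_add:
  assumes "vspace W" "linear_map V W f" "linear_map V W g"
  shows "linear_map V W (\<lambda>x. f x \<oplus>\<^bsub>W\<^esub> g x)"
proof -
  interpret W: vspace W by fact
  show ?thesis
    by (rule linear_mapI)
      (auto simp: linear_mapD[OF assms(2)] linear_mapD[OF assms(3)] W.smult_r_distr W.a_ac)
qed

lemma linear_map_smult:
  assumes "vspace W" "linear_map V W f"
  shows "linear_map V W (\<lambda>x. c \<odot>\<^bsub>W\<^esub> f x)"
proof -
  interpret W: vspace W by fact
  show ?thesis
    by (rule linear_mapI)
      (auto simp: linear_mapD[OF assms(2)] W.smult_r_distr W.smult_smult mult.commute)
qed

lemma linear_map_zero_fun: "vspace W \<Longrightarrow> linear_map V W (\<lambda>x. \<zero>\<^bsub>W\<^esub>)"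
proof -
  assume "vspace W" then interpret W: vspace W .
  show ?thesis by (rule linear_mapI) auto
qed

lemma linear_map_uminus:
  assumes "vspace W" "linear_map V W f" shows "linear_map V W (\<lambda>x. \<ominus>\<^bsub>W\<^esub> f x)"
proof -
  interpret W: vspace W by fact
  show ?thesis
    by (rule linear_mapI)
      (auto simp: linear_mapD[OF assms(2)] W.minus_add W.smult_a_inv)
qed

lemma linear_map_diff:
  "\<lbrakk>vspace W; linear_map V W f; linear_map V W g\<rbrakk> \<Longrightarrow> linear_map V W (\<lambda>x. f x \<ominus>\<^bsub>W\<^esub> g x)"
  unfolding a_minus_def by (intro linear_map_add linear_map_uminus)

locale linear = V: vspace V + W: vspace W
  for V :: "('k::field_char_0, 'a, 'm) module_scheme" and W :: "('k, 'b, 'n) module_scheme" +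
  fixes f
  assumes linear: "linear_map V W f"
begin

lemma closed [simp]: "x \<in> carrier V \<Longrightarrow> f x \<in> carrier W"
  and add [simp]: "\<lbrakk>x \<in> carrier V; y \<in> carrier V\<rbrakk> \<Longrightarrow> f (x \<oplus>\<^bsub>V\<^esub> y) = f x \<oplus>\<^bsub>W\<^esub> f y"
  and scale [simp]: "x \<in> carrier V \<Longrightarrow> f (c \<odot>\<^bsub>V\<^esub> x) = c \<odot>\<^bsub>W\<^esub> f x"
  using linear_mapD[OF linear] by blast+

lemma zero [simp]: "f \<zero>\<^bsub>V\<^esub> = \<zero>\<^bsub>W\<^esub>"
  using scale[of "\<zero>\<^bsub>V\<^esub>" 0] by simp

lemma a_inv [simp]: "x \<in> carrier V \<Longrightarrow> f (\<ominus>\<^bsub>V\<^esub> x) = \<ominus>\<^bsub>W\<^esub> f x"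
  using scale[of x "-1"] by (simp add: V.smult_minus_one W.smult_minus_one)

lemma diff [simp]: "\<lbrakk>x \<in> carrier V; y \<in> carrier V\<rbrakk> \<Longrightarrow> f (x \<ominus>\<^bsub>V\<^esub> y) = f x \<ominus>\<^bsub>W\<^esub> f y"
  by (simp add: a_minus_def)

lemma kernel_submodule: "submodule {x \<in> carrier V. f x = \<zero>\<^bsub>W\<^esub>} (base_field :: 'k ring) V"
  by (rule V.submoduleI) auto

end

lemma linear_map_zeroD:
  "\<lbrakk>vspace V; vspace W; linear_map V W f\<rbrakk> \<Longrightarrow> f \<zero>\<^bsub>V\<^esub> = \<zero>\<^bsub>W\<^esub>"
  by (simp add: linear.zero linear.intro linear_axioms_def)

lemma linear_map_diffD:
  "\<lbrakk>vspace V; vspace W; linear_map V W f; x \<in> carrier V; y \<in> carrier V\<rbrakk>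
    \<Longrightarrow> f (x \<ominus>\<^bsub>V\<^esub> y) = f x \<ominus>\<^bsub>W\<^esub> f y"
  by (simp add: linear.diff linear.intro linear_axioms_def)

definition bilinear_map ::
  "('k::field_char_0, 'a, 'm) module_scheme \<Rightarrow> ('k, 'b, 'n) module_scheme
    \<Rightarrow> ('k, 'c, 'o) module_scheme \<Rightarrow> ('a \<Rightarrow> 'b \<Rightarrow> 'c) \<Rightarrow> bool"
  where "bilinear_map V W Z b \<longleftrightarrow>
    (\<forall>x\<in>carrier V. linear_map W Z (b x)) \<and> (\<forall>y\<in>carrier W. linear_map V Z (\<lambda>x. b x y))"

lemma bilinear_op_iff: "bilinear_op V b \<longleftrightarrow> bilinear_map V V V b"
  by (simp add: bilinear_op_def bilinear_map_def)

lemma bilinear_mapI: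
  assumes "\<And>x. x \<in> carrier V \<Longrightarrow> linear_map W Z (b x)"
    "\<And>y. y \<in> carrier W \<Longrightarrow> linear_map V Z (\<lambda>x. b x y)"
  shows "bilinear_map V W Z b"
  using assms by (auto simp: bilinear_map_def)

lemma bilinear_mapD:
  assumes "bilinear_map V W Z b"
  shows "x \<in> carrier V \<Longrightarrow> linear_map W Z (b x)"
    "y \<in> carrier W \<Longrightarrow> linear_map V Z (\<lambda>x. b x y)"
  using assms by (auto simp: bilinear_map_def)

lemma bilinear_map_compose:
  assumes "bilinear_map V W Z b" "linear_map V' V f" "linear_map W' W g"
  shows "bilinear_map V' W' Z (\<lambda>x y. b (f x) (g y))"
proof (rule bilinear_mapI)
  note b = bilinear_mapD[OF assms(1)]
  show "linear_map W' Z (\<lambda>y. b (f x) (g y))" if "x \<in> carrier V'" for x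
    using linear_map_compose[OF assms(3) b(1)] linear_mapD(1)[OF assms(2) that] .
  show "linear_map V' Z (\<lambda>x. b (f x) (g y))" if "y \<in> carrier W'" for y
    using linear_map_compose[OF assms(2) b(2)] linear_mapD(1)[OF assms(3) that] .
qed

lemma bilinear_map_linear:
  "\<lbrakk>bilinear_map V W Z b; linear_map Z Z' f\<rbrakk> \<Longrightarrow> bilinear_map V W Z' (\<lambda>x y. f (b x y))"
  by (auto simp: bilinear_map_def intro: linear_map_compose)

lemma bilinear_map_swap: "bilinear_map V W Z b \<Longrightarrow> bilinear_map W V Z (\<lambda>x y. b y x)"
  by (auto simp: bilinear_map_def)


section \<open>Free modules and quotients\<close>

lemma lookup_map_times [simp]:
  "Poly_Mapping.lookup (Poly_Mapping.map ((*) (c::'k::mult_zero)) f) x = c * Poly_Mapping.lookup f x"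
  by (simp add: Poly_Mapping.map.rep_eq when_def)

lemma keys_map_times_subset:
  "Poly_Mapping.keys (Poly_Mapping.map ((*) (c::'k::mult_zero)) f) \<subseteq> Poly_Mapping.keys f"
  by (auto simp: in_keys_iff)

lemma map_times_single [simp]:
  "Poly_Mapping.map ((*) (c::'k::mult_zero)) (Poly_Mapping.single x d) = Poly_Mapping.single x (c * d)"
  by (rule poly_mapping_eqI) (simp add: lookup_single when_def)

lemma free_module_simps:
  "carrier (free_module S) = {f. Poly_Mapping.keys f \<subseteq> S}" "\<zero>\<^bsub>free_module S\<^esub> = 0"
  "f \<oplus>\<^bsub>free_module S\<^esub> h = f + h" "c \<odot>\<^bsub>free_module S\<^esub> f = Poly_Mapping.map ((*) c) f"
  by (simp_all add: free_module_def)

lemma vspace_free_module: "vspace (free_module S :: ('k::field_char_0, 'x \<Rightarrow>\<^sub>0 'k) module)"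
proof -
  have "abelian_group (free_module S :: ('k, 'x \<Rightarrow>\<^sub>0 'k) module)"
  proof (rule abelian_groupI, unfold free_module_simps)
    fix f g :: "'x \<Rightarrow>\<^sub>0 'k"
    assume "f \<in> {f. Poly_Mapping.keys f \<subseteq> S}" "g \<in> {f. Poly_Mapping.keys f \<subseteq> S}"
    then show "f + g \<in> {f. Poly_Mapping.keys f \<subseteq> S}"
      using keys_add[of f g] by auto
  next
    fix f :: "'x \<Rightarrow>\<^sub>0 'k"
    assume "f \<in> {f. Poly_Mapping.keys f \<subseteq> S}"
    then show "\<exists>g\<in>{f. Poly_Mapping.keys f \<subseteq> S}. g + f = 0"
      by (intro bexI[of _ "- f"]) (auto simp: in_keys_iff)
  qed (auto simp: add.assoc add.commute)
  then show ?thesis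
    by (intro vspace.intro vspace_axioms.intro)
      (auto simp: free_module_simps lookup_add algebra_simps in_keys_iff subset_eq intro!: poly_mapping_eqI)
qed

lemma sum_single_lookup:
  "(\<Sum>k\<in>Poly_Mapping.keys f. Poly_Mapping.single k (Poly_Mapping.lookup f k)) = f"
proof (rule poly_mapping_eqI)
  fix x
  have "Poly_Mapping.lookup (\<Sum>k\<in>Poly_Mapping.keys f. Poly_Mapping.single k (Poly_Mapping.lookup f k)) x =
      (\<Sum>k\<in>Poly_Mapping.keys f. if k = x then Poly_Mapping.lookup f k else 0)"
    by (simp add: lookup_sum lookup_single when_def)
  then show "Poly_Mapping.lookup (\<Sum>k\<in>Poly_Mapping.keys f. Poly_Mapping.single k (Poly_Mapping.lookup f k)) x =
      Poly_Mapping.lookup f x"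
    by (simp add: in_keys_iff)
qed

lemma free_module_induct [consumes 1, case_names zero add single]:
  assumes "f \<in> carrier (free_module S)"
    and "P 0"
    and "\<And>f h. \<lbrakk>f \<in> carrier (free_module S); h \<in> carrier (free_module S); P f; P h\<rbrakk> \<Longrightarrow> P (f + h)"
    and single: "\<And>x c. x \<in> S \<Longrightarrow> P (Poly_Mapping.single x c)"
  shows "P (f :: 'x \<Rightarrow>\<^sub>0 'k::field_char_0)"
proof -
  interpret vspace "free_module S :: ('k, 'x \<Rightarrow>\<^sub>0 'k) module" by (rule vspace_free_module)
  have "(\<Sum>k\<in>A. Poly_Mapping.single k (Poly_Mapping.lookup f k)) \<in> carrier (free_module S) \<and>
      P (\<Sum>k\<in>A. Poly_Mapping.single k (Poly_Mapping.lookup f k))" if "finite A" "A \<subseteq> S" for A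
    using that
  proof (induction rule: finite_induct)
    case (insert k A)
    have k: "Poly_Mapping.single k (Poly_Mapping.lookup f k) \<in> carrier (free_module S)"
      using insert.prems by (auto simp: free_module_simps)
    show ?case
      using insert k assms(3)[OF k] a_closed[OF k] single[of k] by (auto simp: free_module_simps(3))
  qed (use assms(2) in \<open>auto simp: free_module_simps\<close>)
  from this[of "Poly_Mapping.keys f"] assms(1) show ?thesis
    by (simp add: free_module_simps sum_single_lookup)
qed

context vspace
begin

text \<open>The defining sum runs over the support of f, which changes under addition and scaling.
  Padding it with zero terms to a common finite set makes linearity a termwise computation.\<close>

lemma linear_extension_superset:
  assumes "finite A" "Poly_Mapping.keys f \<subseteq> A" "b \<in> A \<rightarrow> carrier V"
  shows "linear_extension V b f = (\<Oplus>x\<in>A. Poly_Mapping.lookup f x \<odot> b x)"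
  unfolding linear_extension_def
  using assms
  by (intro add.finprod_mono_neutral_cong_left) (auto simp: in_keys_iff Pi_iff)

lemma linear_extension_single:
  "b x \<in> carrier V \<Longrightarrow> linear_extension V b (Poly_Mapping.single x c) = c \<odot> b x"
  by (subst linear_extension_superset[of "{x}"]) auto

lemma linear_extension_linear:
  assumes b: "b \<in> S \<rightarrow> carrier V"
  shows "linear_map (free_module S) V (linear_extension V b)"
proof (rule linear_mapI, unfold free_module_simps mem_Collect_eq)
  fix f h :: "'b \<Rightarrow>\<^sub>0 'k" assume f: "Poly_Mapping.keys f \<subseteq> S" and h: "Poly_Mapping.keys h \<subseteq> S"
  let ?A = "Poly_Mapping.keys f \<union> Poly_Mapping.keys h"
  have bA: "b \<in> ?A \<rightarrow> carrier V" using f h b by auto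
  then have "(\<Oplus>x\<in>?A. Poly_Mapping.lookup (f + h) x \<odot> b x) =
      (\<Oplus>x\<in>?A. Poly_Mapping.lookup f x \<odot> b x \<oplus> Poly_Mapping.lookup h x \<odot> b x)"
    by (intro add.finprod_cong') (auto simp: lookup_add smult_l_distr Pi_iff)
  also have "\<dots> = (\<Oplus>x\<in>?A. Poly_Mapping.lookup f x \<odot> b x) \<oplus> (\<Oplus>x\<in>?A. Poly_Mapping.lookup h x \<odot> b x)"
    using bA by (intro add.finprod_multf) (auto simp: Pi_iff)
  finally show "linear_extension V b (f + h) = linear_extension V b f \<oplus> linear_extension V b h"
    using bA by (simp add: linear_extension_superset[of ?A] keys_add)
next
  fix f :: "'b \<Rightarrow>\<^sub>0 'k" and c assume f: "Poly_Mapping.keys f \<subseteq> S"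
  have bA: "b \<in> Poly_Mapping.keys f \<rightarrow> carrier V" using f b by auto
  show "linear_extension V b f \<in> carrier V"
    unfolding linear_extension_def using bA by (intro finsum_closed) auto
  have "linear_extension V b (Poly_Mapping.map ((*) c) f) =
      (\<Oplus>x\<in>Poly_Mapping.keys f. c \<odot> (Poly_Mapping.lookup f x \<odot> b x))"
    using bA by (subst linear_extension_superset[OF _ keys_map_times_subset])
      (auto simp: smult_smult Pi_iff intro!: add.finprod_cong')
  also have "\<dots> = c \<odot> linear_extension V b f"
    unfolding linear_extension_def using bA
    by (subst module.finsum_smult_ldistr[OF module_axioms]) (auto simp: Pi_iff)
  finally show "linear_extension V b (Poly_Mapping.map ((*) c) f) = c \<odot> linear_extension V b f" .
qed

end

text \<open>For fixed f the value is a linear combination with fixed coefficients, so linearity in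
  the parameter y is inherited term by term. Applied to the representative chosen for a coset, it
  gives linearity of an induced map in its other argument without any appeal to the
  relations.\<close>

lemma linear_map_linear_extension_param:
  assumes W: "vspace W" "vspace Z" and b: "\<And>x. x \<in> Poly_Mapping.keys f \<Longrightarrow> linear_map W Z (\<lambda>y. B y x)"
  shows "linear_map W Z (\<lambda>y. linear_extension Z (B y) f)"
proof -
  interpret W: vspace W by fact
  interpret Z: vspace Z by fact
  have "linear_map W Z (\<lambda>y. \<Oplus>\<^bsub>Z\<^esub>x\<in>A. Poly_Mapping.lookup f x \<odot>\<^bsub>Z\<^esub> B y x)"
    if "finite A" "A \<subseteq> Poly_Mapping.keys f" for A
    using that
  proof (induction rule: finite_induct)
    case (insert x A)
    have lin: "linear_map W Z (\<lambda>y. B y z)" if "z \<in> insert x A" for z using that insert b by auto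
    have "linear_map W Z (\<lambda>y. Poly_Mapping.lookup f x \<odot>\<^bsub>Z\<^esub> B y x \<oplus>\<^bsub>Z\<^esub>
      (\<Oplus>\<^bsub>Z\<^esub>x\<in>A. Poly_Mapping.lookup f x \<odot>\<^bsub>Z\<^esub> B y x))"
      using insert by (intro linear_map_add linear_map_smult W lin) auto
    then show ?case
      by (rule linear_map_cong[OF W(1)])
        (use insert linear_mapD(1)[OF lin] in \<open>auto simp: Pi_iff\<close>)
  qed (simp add: linear_map_zero_fun W)
  from this[of "Poly_Mapping.keys f"] show ?thesis by (simp add: linear_extension_def)
qed

locale quotient = vspace V for V :: "('k::field_char_0, 'a, 'm) module_scheme" (structure) +
  fixes N
  assumes submodule: "submodule N (base_field :: 'k ring) V"
begin

sublocale abelian_subgroup N V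
  by (rule abelian_subgroup_if_submodule[OF submodule])

lemma coset_eq_iff:
  assumes "x \<in> carrier V" "y \<in> carrier V"
  shows "N +> x = N +> y \<longleftrightarrow> x \<ominus> y \<in> N"
proof -
  have "x \<ominus> y \<in> N \<longleftrightarrow> x \<in> N +> y"
    using a_rcos_module[of y x] assms by (simp add: a_minus_def)
  then show ?thesis
    using a_repr_independence' a_rcos_self assms by metis
qed

lemma quotient_simps:
  "carrier (quotient_module V N) = (\<lambda>x. N +> x) ` carrier V"
  "\<zero>\<^bsub>quotient_module V N\<^esub> = N +> \<zero>"
  "\<lbrakk>x \<in> carrier V; y \<in> carrier V\<rbrakk> \<Longrightarrow>
    (N +> x) \<oplus>\<^bsub>quotient_module V N\<^esub> (N +> y) = N +> (x \<oplus> y)"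
  by (auto simp: quotient_module_def FactRing_simps a_rcos_sum a_subset)

lemma quotient_smult:
  assumes x: "x \<in> carrier V"
  shows "c \<odot>\<^bsub>quotient_module V N\<^esub> (N +> x) = N +> (c \<odot> x)"
proof -
  \<comment> \<open>All members of the union that defines the scalar product agree. Adding N there
    matters for c = 0: the pointwise multiple of a coset would be the singleton of zero instead of
    N.\<close>
  have "N +> (c \<odot> a) = N +> (c \<odot> x)" if a: "a \<in> N +> x" for a
  proof -
    have aV: "a \<in> carrier V" using a x a_elemrcos_carrier by blast
    have "a \<ominus> x \<in> N"
      using a a_rcos_module[OF x aV] by (simp add: a_minus_def)
    then have "c \<odot> a \<ominus> c \<odot> x \<in> N"
      using submoduleD(4)[OF submodule, of "a \<ominus> x" c] aV x by (simp add: smult_right_diff)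
    then show ?thesis using aV x by (simp add: coset_eq_iff)
  qed
  moreover have "x \<in> N +> x" using x by (rule a_rcos_self)
  ultimately have "(\<Union>a\<in>N +> x. N +> (c \<odot> a)) = N +> (c \<odot> x)"
    by (intro UN_constant_eq) blast+
  then show ?thesis by (simp add: quotient_module_def)
qed

lemma vspace_quotient: "vspace (quotient_module V N)"
proof -
  let ?Q = "quotient_module V N"
  note [simp] = quotient_simps quotient_smult
  have "abelian_group ?Q"
  proof (rule abelian_groupI)
    fix x assume "x \<in> carrier ?Q"
    then obtain a where a: "a \<in> carrier V" "x = N +> a" by auto
    then show "\<exists>y\<in>carrier ?Q. y \<oplus>\<^bsub>?Q\<^esub> x = \<zero>\<^bsub>?Q\<^esub>"
      by (intro bexI[of _ "N +> (\<ominus> a)"]) (auto simp: l_neg)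
  qed (auto simp: a_ac)
  then show ?thesis
    by (intro vspace.intro vspace_axioms.intro)
      (auto simp: smult_l_distr smult_r_distr smult_smult)
qed

lemma some_in_coset:
  assumes "x \<in> carrier V"
  shows "(SOME f. f \<in> N +> x) \<in> carrier V" "(SOME f. f \<in> N +> x) \<ominus> x \<in> N"
proof -
  have *: "(SOME f. f \<in> N +> x) \<in> N +> x"
    using a_rcos_self[OF assms] by (rule someI)
  then show **: "(SOME f. f \<in> N +> x) \<in> carrier V"
    using a_elemrcos_carrier assms by blast
  show "(SOME f. f \<in> N +> x) \<ominus> x \<in> N"
    using * a_rcos_module[OF assms **] by (simp add: a_minus_def)
qed

text \<open>The chosen representative differs from x by an element of N, where L vanishes. So the
  arbitrary choice in \<open>induced_map\<close> is invisible as soon as L kills N.\<close>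

lemma linear_some_coset:
  assumes "vspace W" "linear_map V W L" "\<And>n. n \<in> N \<Longrightarrow> L n = \<zero>\<^bsub>W\<^esub>" "x \<in> carrier V"
  shows "L (SOME f. f \<in> N +> x) = L x"
proof -
  interpret W: vspace W by fact
  interpret L: linear V W L by (intro linear.intro linear_axioms.intro vspace_axioms assms)
  note * = some_in_coset[OF assms(4)]
  from * assms(3)[OF *(2)] have "L (SOME f. f \<in> N +> x) \<ominus>\<^bsub>W\<^esub> L x = \<zero>\<^bsub>W\<^esub>"
    using assms(4) by (metis L.diff)
  with * assms(4) show ?thesis by (metis L.closed W.minus_eq_zeroD)
qed

lemma linear_map_some_coset:
  assumes "vspace W" "linear_map V W L" "\<And>n. n \<in> N \<Longrightarrow> L n = \<zero>\<^bsub>W\<^esub>"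
  shows "linear_map (quotient_module V N) W (\<lambda>u. L (SOME f. f \<in> u))"
proof (rule linear_mapI)
  note s = linear_some_coset[OF assms]
  note L = linear_mapD[OF assms(2)]
  fix x y c assume "x \<in> carrier (quotient_module V N)"
  then obtain a where a: "a \<in> carrier V" "x = N +> a" by (auto simp: quotient_simps)
  then show "L (SOME f. f \<in> x) \<in> carrier W" using s L by simp
  show "L (SOME f. f \<in> c \<odot>\<^bsub>quotient_module V N\<^esub> x) = c \<odot>\<^bsub>W\<^esub> L (SOME f. f \<in> x)"
    using a s L by (simp add: quotient_smult)
  assume "y \<in> carrier (quotient_module V N)"
  then obtain b where "b \<in> carrier V" "y = N +> b" by (auto simp: quotient_simps)
  then show "L (SOME f. f \<in> x \<oplus>\<^bsub>quotient_module V N\<^esub> y) =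
      L (SOME f. f \<in> x) \<oplus>\<^bsub>W\<^esub> L (SOME f. f \<in> y)"
    using a s L by (simp add: quotient_simps)
qed

end

section \<open>Tensor products\<close>

lemma free_module_minus:
  assumes "f \<in> carrier (free_module S)" "h \<in> carrier (free_module S)"
  shows "f \<ominus>\<^bsub>free_module S\<^esub> h = f - (h :: 'x \<Rightarrow>\<^sub>0 'k::field_char_0)"
proof -
  interpret vspace "free_module S :: ('k, 'x \<Rightarrow>\<^sub>0 'k) module" by (rule vspace_free_module)
  have "- h \<in> carrier (free_module S)" using assms by (auto simp: free_module_simps in_keys_iff)
  then have "\<ominus>\<^bsub>free_module S\<^esub> h = - h"
    using assms by (intro minus_equality) (auto simp: free_module_simps)
  then show ?thesis by (simp add: a_minus_def free_module_simps)
qed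

locale tensor_product = V: vspace V + W: vspace W
  for V :: "('k::field_char_0, 'a, 'm) module_scheme" and W :: "('k, 'b, 'n) module_scheme"
begin

abbreviation "pairs \<equiv> (free_module (carrier V \<times> carrier W) :: ('k, 'a \<times> 'b \<Rightarrow>\<^sub>0 'k) module)"

lemma relations_closed: "tensor_relations V W \<subseteq> carrier pairs"
  unfolding tensor_relations_def free_module_simps
  by (auto simp: in_keys_iff lookup_minus lookup_single when_def split: if_splits)

lemma quotient_kernel: "quotient pairs (tensor_kernel V W)"
  unfolding tensor_kernel_def
  by (intro quotient.intro quotient_axioms.intro vspace_free_module
      vspace.submodule_span_submodule relations_closed)

lemma vspace_tensor: "vspace (tensor V W)"
  unfolding tensor_def by (rule quotient.vspace_quotient[OF quotient_kernel])

lemma single_closed: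
  "\<lbrakk>x \<in> carrier V; y \<in> carrier W\<rbrakk> \<Longrightarrow> Poly_Mapping.single (x, y) c \<in> carrier pairs"
  by (auto simp: free_module_simps)

lemma pure_closed: "\<lbrakk>x \<in> carrier V; y \<in> carrier W\<rbrakk> \<Longrightarrow> pure_tensor V W x y \<in> carrier (tensor V W)"
  unfolding tensor_def pure_tensor_def
  using quotient.quotient_simps(1)[OF quotient_kernel] single_closed by blast

lemma relation_mem: "r \<in> tensor_relations V W \<Longrightarrow> r \<in> tensor_kernel V W"
  unfolding tensor_kernel_def by (rule subsetD[OF submodule_span_superset])

lemma single_smult:
  "Poly_Mapping.single (x, y) c = c \<odot>\<^bsub>pairs\<^esub> Poly_Mapping.single (x, y) 1"
  by (simp add: free_module_simps)

lemma pure_bilinear: "bilinear_map V W (tensor V W) (pure_tensor V W)"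
proof -
  interpret F: vspace pairs by (rule vspace_free_module)
  note q = quotient.quotient_simps(3)[OF quotient_kernel] quotient.quotient_smult[OF quotient_kernel]
  note e = quotient.coset_eq_iff[OF quotient_kernel]
  note add = F.a_closed[unfolded free_module_simps(3)]
  \<comment> \<open>One helper for both families of additivity relations, and below one for both
    families of scaling relations: a listed relation lies in the kernel, hence its two sides have
    the same coset.\<close>
  have *: "tensor_kernel V W +>\<^bsub>pairs\<^esub> Poly_Mapping.single (x, y) c
      = tensor_kernel V W +>\<^bsub>pairs\<^esub> (Poly_Mapping.single p 1 + Poly_Mapping.single q 1)"
    if "Poly_Mapping.single (x, y) c - Poly_Mapping.single p 1 - Poly_Mapping.single q 1
        \<in> tensor_relations V W" "x \<in> carrier V" "y \<in> carrier W"
      "p \<in> carrier V \<times> carrier W" "q \<in> carrier V \<times> carrier W" for x y p q c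
    using that relation_mem[OF that(1)]
    by (subst e) (auto simp: single_closed add free_module_minus diff_diff_eq)
  have **: "tensor_kernel V W +>\<^bsub>pairs\<^esub> Poly_Mapping.single (x, y) 1
      = tensor_kernel V W +>\<^bsub>pairs\<^esub> (Poly_Mapping.single p c)"
    if "Poly_Mapping.single (x, y) 1 - Poly_Mapping.single p c
        \<in> tensor_relations V W" "x \<in> carrier V" "y \<in> carrier W"
      "p \<in> carrier V \<times> carrier W" for x y p c
    using that relation_mem[OF that(1)]
    by (subst e) (auto simp: single_closed free_module_minus)
  show ?thesis
  proof (intro bilinear_mapI linear_mapI pure_closed)
    fix x y y' assume "x \<in> carrier V" "y \<in> carrier W" "y' \<in> carrier W"
    then show "pure_tensor V W x (y \<oplus>\<^bsub>W\<^esub> y') =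
        pure_tensor V W x y \<oplus>\<^bsub>tensor V W\<^esub> pure_tensor V W x y'"
      unfolding tensor_def pure_tensor_def
      by (simp add: q single_closed, unfold free_module_simps(3), intro *)
        (auto simp: tensor_relations_def)
  next
    fix x x' y assume "x \<in> carrier V" "x' \<in> carrier V" "y \<in> carrier W"
    then show "pure_tensor V W (x \<oplus>\<^bsub>V\<^esub> x') y =
        pure_tensor V W x y \<oplus>\<^bsub>tensor V W\<^esub> pure_tensor V W x' y"
      unfolding tensor_def pure_tensor_def
      by (simp add: q single_closed, unfold free_module_simps(3), intro *)
        (auto simp: tensor_relations_def)
  next
    fix c x y assume "x \<in> carrier V" "y \<in> carrier W"
    then show "pure_tensor V W (c \<odot>\<^bsub>V\<^esub> x) y = c \<odot>\<^bsub>tensor V W\<^esub> pure_tensor V W x y"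
      unfolding tensor_def pure_tensor_def
      by (simp add: q single_closed flip: single_smult, intro **) (auto simp: tensor_relations_def)
  next
    fix c x y assume "x \<in> carrier V" "y \<in> carrier W"
    then show "pure_tensor V W x (c \<odot>\<^bsub>W\<^esub> y) = c \<odot>\<^bsub>tensor V W\<^esub> pure_tensor V W x y"
      unfolding tensor_def pure_tensor_def
      by (simp add: q single_closed flip: single_smult, intro **) (auto simp: tensor_relations_def)
  qed
qed

lemma pure_smult_left:
  "\<lbrakk>x \<in> carrier V; y \<in> carrier W\<rbrakk> \<Longrightarrow> pure_tensor V W (c \<odot>\<^bsub>V\<^esub> x) y = c \<odot>\<^bsub>tensor V W\<^esub> pure_tensor V W x y"
  using linear_mapD(3)[OF bilinear_mapD(2)[OF pure_bilinear]] by blast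

lemma pure_zero_left: "y \<in> carrier W \<Longrightarrow> pure_tensor V W \<zero>\<^bsub>V\<^esub> y = \<zero>\<^bsub>tensor V W\<^esub>"
  by (rule linear_map_zeroD[OF V.vspace_axioms vspace_tensor bilinear_mapD(2)[OF pure_bilinear]])

lemma pure_zero_right: "x \<in> carrier V \<Longrightarrow> pure_tensor V W x \<zero>\<^bsub>W\<^esub> = \<zero>\<^bsub>tensor V W\<^esub>"
  by (rule linear_map_zeroD[OF W.vspace_axioms vspace_tensor bilinear_mapD(1)[OF pure_bilinear]])

text \<open>Sums of pure tensors exhaust the tensor product, so scalar multiples and zero get no
  case of their own: a coefficient is absorbed in the left factor, and zero is the pure tensor of
  two zeros.\<close>

lemma tensor_induct [consumes 1, case_names pure add]:
  assumes "t \<in> carrier (tensor V W)"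
    and pure: "\<And>x y. \<lbrakk>x \<in> carrier V; y \<in> carrier W\<rbrakk> \<Longrightarrow> P (pure_tensor V W x y)"
    and add: "\<And>s t. \<lbrakk>s \<in> carrier (tensor V W); t \<in> carrier (tensor V W); P s; P t\<rbrakk>
      \<Longrightarrow> P (s \<oplus>\<^bsub>tensor V W\<^esub> t)"
  shows "P t"
proof -
  interpret Q: quotient pairs "tensor_kernel V W" by (rule quotient_kernel)
  obtain f where f: "f \<in> carrier pairs" "t = tensor_kernel V W +>\<^bsub>pairs\<^esub> f"
    using assms(1) by (auto simp: tensor_def Q.quotient_simps)
  have "P (tensor_kernel V W +>\<^bsub>pairs\<^esub> f)" using f(1)
  proof (induction rule: free_module_induct)
    case zero
    have "tensor_kernel V W +>\<^bsub>pairs\<^esub> 0 = \<zero>\<^bsub>tensor V W\<^esub>"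
      by (simp add: tensor_def Q.quotient_simps free_module_simps(2))
    then show ?case using pure[of "\<zero>\<^bsub>V\<^esub>" "\<zero>\<^bsub>W\<^esub>"] by (simp add: pure_zero_left)
  next
    case (add f h)
    then show ?case
      using assms(3)[of "tensor_kernel V W +>\<^bsub>pairs\<^esub> f" "tensor_kernel V W +>\<^bsub>pairs\<^esub> h"]
      by (simp add: tensor_def Q.quotient_simps) (simp add: free_module_simps)
  next
    case (single p c)
    then obtain x y where p: "p = (x, y)" "x \<in> carrier V" "y \<in> carrier W" by auto
    then have "tensor_kernel V W +>\<^bsub>pairs\<^esub> Poly_Mapping.single p c = pure_tensor V W (c \<odot>\<^bsub>V\<^esub> x) y"
      by (subst pure_smult_left)
        (simp_all add: pure_tensor_def tensor_def Q.quotient_smult single_closed flip: single_smult)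
    then show ?case using pure p by simp
  qed
  with f show ?thesis by simp
qed

text \<open>The kernel of the linear extension is a submodule, and by bilinearity of b the relations
  lie in it; hence so does the submodule they span.\<close>

lemma tensor_lift_vanishes:
  assumes Z: "vspace Z" and b: "bilinear_map V W Z b" and n: "n \<in> tensor_kernel V W"
  shows "linear_extension Z (\<lambda>(x, y). b x y) n = \<zero>\<^bsub>Z\<^esub>"
proof -
  interpret Z: vspace Z by fact
  let ?L = "linear_extension Z (\<lambda>(x, y). b x y)"
  note bD = linear_mapD[OF bilinear_mapD(1)[OF b]] linear_mapD[OF bilinear_mapD(2)[OF b]]
  interpret L: linear pairs Z ?L
    by (intro linear.intro linear_axioms.intro vspace_free_module Z Z.linear_extension_linear)
      (auto simp: bD)
  have L: "?L (f - h) = ?L f \<ominus>\<^bsub>Z\<^esub> ?L h" if "f \<in> carrier pairs" "h \<in> carrier pairs" for f h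
    using L.diff[of f h] that by (simp add: free_module_minus)
  have cl: "f - h \<in> carrier pairs" if "f \<in> carrier pairs" "h \<in> carrier pairs" for f h
    using L.V.minus_closed[of f h] that by (simp add: free_module_minus)
  have s: "?L (Poly_Mapping.single (x, y) c) = c \<odot>\<^bsub>Z\<^esub> b x y"
    if "x \<in> carrier V" "y \<in> carrier W" for x y c
    using that by (subst Z.linear_extension_single) (auto simp: bD)
  have "tensor_relations V W \<subseteq> {f \<in> carrier pairs. ?L f = \<zero>\<^bsub>Z\<^esub>}"
    using relations_closed
    by (auto simp: tensor_relations_def L s cl single_closed bD Z.diff_simps)
  then show ?thesis
    using n submodule_span_minimal[OF L.kernel_submodule] by (auto simp: tensor_kernel_def)
qed

lemma linear_extension_pairs:
  assumes Z: "vspace Z" and b: "bilinear_map V W Z b"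
  shows "linear_map pairs Z (linear_extension Z (\<lambda>(x, y). b x y))"
  using linear_mapD[OF bilinear_mapD(1)[OF b]]
  by (intro vspace.linear_extension_linear Z) auto

lemma tensor_lift_linear:
  assumes Z: "vspace Z" and b: "bilinear_map V W Z b"
  shows "linear_map (tensor V W) Z (tensor_lift Z b)"
  unfolding tensor_def tensor_lift_def induced_map_def
  by (intro quotient.linear_map_some_coset quotient_kernel Z tensor_lift_vanishes b
      linear_extension_pairs)

lemma tensor_lift_pure:
  assumes Z: "vspace Z" and b: "bilinear_map V W Z b" and xy: "x \<in> carrier V" "y \<in> carrier W"
  shows "tensor_lift Z b (pure_tensor V W x y) = b x y"
proof -
  interpret Z: vspace Z by fact
  have c: "b x y \<in> carrier Z" using linear_mapD(1)[OF bilinear_mapD(1)[OF b]] xy by blast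
  have "tensor_lift Z b (pure_tensor V W x y) =
      linear_extension Z (\<lambda>(x, y). b x y) (Poly_Mapping.single (x, y) 1)"
    unfolding tensor_lift_def induced_map_def pure_tensor_def
    using xy
    by (intro quotient.linear_some_coset[OF quotient_kernel Z] tensor_lift_vanishes Z b
        linear_extension_pairs single_closed)
  then show ?thesis using c by (simp add: Z.linear_extension_single)
qed

lemma tensor_ext:
  assumes "vspace Z" "linear_map (tensor V W) Z f" "linear_map (tensor V W) Z h"
    "\<And>x y. \<lbrakk>x \<in> carrier V; y \<in> carrier W\<rbrakk> \<Longrightarrow> f (pure_tensor V W x y) = h (pure_tensor V W x y)"
    "t \<in> carrier (tensor V W)"
  shows "f t = h t"
  using assms(5)
  by (induction rule: tensor_induct) (simp_all add: assms(4) linear_mapD[OF assms(2)] linear_mapD[OF assms(3)])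

lemma tensor_rep_keys:
  assumes "t \<in> carrier (tensor V W)"
  shows "Poly_Mapping.keys (SOME f. f \<in> t) \<subseteq> carrier V \<times> carrier W"
proof -
  interpret Q: quotient pairs "tensor_kernel V W" by (rule quotient_kernel)
  from assms obtain f where "f \<in> carrier pairs" "t = tensor_kernel V W +>\<^bsub>pairs\<^esub> f"
    by (auto simp: tensor_def Q.quotient_simps)
  then show ?thesis using Q.some_in_coset(1)[of f] by (simp add: free_module_simps)
qed

text \<open>A fixed tensor t has a fixed chosen representative, supported on the two carriers, so
  the value is a fixed linear combination of the \<open>B u x y\<close>. This is needed for
  \<open>tensor_op\<close>, where one lift sits inside another.\<close>

lemma tensor_lift_param:
  assumes "vspace U" "vspace Z" "t \<in> carrier (tensor V W)"
    "\<And>x y. \<lbrakk>x \<in> carrier V; y \<in> carrier W\<rbrakk> \<Longrightarrow> linear_map U Z (\<lambda>u. B u x y)"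
  shows "linear_map U Z (\<lambda>u. tensor_lift Z (B u) t)"
  unfolding tensor_lift_def induced_map_def
  using tensor_rep_keys[OF assms(3)] assms(1,2,4)
  by (intro linear_map_linear_extension_param) auto

end

lemma tensor_productI: "\<lbrakk>vspace V; vspace W\<rbrakk> \<Longrightarrow> tensor_product V W"
  by (rule tensor_product.intro)

lemma tensor_op_bilinear:
  assumes V: "vspace V" and m: "bilinear_map V V V m"
  shows "bilinear_map (tensor V V) (tensor V V) (tensor V V) (tensor_op V m)"
    and "\<lbrakk>x \<in> carrier V; y \<in> carrier V; x' \<in> carrier V; y' \<in> carrier V\<rbrakk> \<Longrightarrow>
      tensor_op V m (pure_tensor V V x y) (pure_tensor V V x' y') = pure_tensor V V (m x x') (m y y')"
proof -
  interpret T: tensor_product V V by (rule tensor_productI[OF V V])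
  note VT = T.vspace_tensor
  have b: "bilinear_map V V (tensor V V) (\<lambda>x' y'. pure_tensor V V (m x x') (m y y'))"
    if "x \<in> carrier V" "y \<in> carrier V" for x y
    by (intro bilinear_map_compose[OF T.pure_bilinear] bilinear_mapD(1)[OF m] that)
  have b': "bilinear_map V V (tensor V V)
      (\<lambda>x y. tensor_lift (tensor V V) (\<lambda>x' y'. pure_tensor V V (m x x') (m y y')) t)"
    if t: "t \<in> carrier (tensor V V)" for t
  proof (rule bilinear_mapI)
    fix x assume x: "x \<in> carrier V"
    show "linear_map V (tensor V V)
        (\<lambda>y. tensor_lift (tensor V V) (\<lambda>x' y'. pure_tensor V V (m x x') (m y y')) t)"
      by (intro T.tensor_lift_param V VT t
          linear_map_compose[OF bilinear_mapD(2)[OF m] bilinear_mapD(1)[OF T.pure_bilinear]]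
          linear_mapD(1)[OF bilinear_mapD(1)[OF m]] x)
    show "linear_map V (tensor V V)
        (\<lambda>y. tensor_lift (tensor V V) (\<lambda>x' y'. pure_tensor V V (m y x') (m x y')) t)"
      by (intro T.tensor_lift_param V VT t
          linear_map_compose[OF bilinear_mapD(2)[OF m] bilinear_mapD(2)[OF T.pure_bilinear]]
          linear_mapD(1)[OF bilinear_mapD(1)[OF m]] x)
  qed
  show "bilinear_map (tensor V V) (tensor V V) (tensor V V) (tensor_op V m)"
    unfolding tensor_op_def
    by (intro bilinear_mapI T.tensor_lift_param T.tensor_lift_linear VT b b')
  show "tensor_op V m (pure_tensor V V x y) (pure_tensor V V x' y') = pure_tensor V V (m x x') (m y y')"
    if "x \<in> carrier V" "y \<in> carrier V" "x' \<in> carrier V" "y' \<in> carrier V"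
    unfolding tensor_op_def using that
    by (simp add: T.tensor_lift_pure[OF VT b'] T.tensor_lift_pure[OF VT b] T.pure_closed)
qed


section \<open>Sums over unshuffles and derivations on words\<close>

declare in_listsD [rule del] in_listsI [rule del]

text \<open>\<open>unshuffle V [x\<^sub>1, \<dots>, x\<^sub>n] F\<close> is the sum of \<open>F u v\<close> over the \<open>2\<^sup>n\<close> ways to distribute the
  letters over two subwords \<open>u\<close> and \<open>v\<close>.\<close>

fun unshuffle :: "('k::field_char_0, 'a, 'm) module_scheme \<Rightarrow> 'x list \<Rightarrow> ('x list \<Rightarrow> 'x list \<Rightarrow> 'a) \<Rightarrow> 'a"
  where
    "unshuffle V [] F = F [] []"
  | "unshuffle V (x # w) F = unshuffle V w (\<lambda>u v. F (x # u) v) \<oplus>\<^bsub>V\<^esub> unshuffle V w (\<lambda>u v. F u (x # v))"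

text \<open>The derivation of the free algebra on words that extends d, in continuation form: F is
  evaluated at each monomial of the derivative, and the derivative is never formed as an element of
  the free algebra.\<close>

fun derive_word :: "('k::field_char_0, 'a, 'm) module_scheme \<Rightarrow> ('x \<Rightarrow> 'x) \<Rightarrow> 'x list \<Rightarrow> ('x list \<Rightarrow> 'a) \<Rightarrow> 'a"
  where
    "derive_word V d [] F = \<zero>\<^bsub>V\<^esub>"
  | "derive_word V d (x # w) F = F (d x # w) \<oplus>\<^bsub>V\<^esub> derive_word V d w (\<lambda>v. F (x # v))"

lemma unshuffle_cong:
  assumes "w \<in> lists S"
    "\<And>u v. \<lbrakk>u \<in> lists S; v \<in> lists S; length u + length v = length w\<rbrakk> \<Longrightarrow> F u v = G u v"
  shows "unshuffle V w F = unshuffle V w G"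
  using assms
proof (induction w arbitrary: F G rule: list.induct)
  case (Cons x w)
  have "unshuffle V w (\<lambda>u v. F (x # u) v) = unshuffle V w (\<lambda>u v. G (x # u) v)"
    using Cons.prems(1) by (intro Cons.IH Cons.prems(2)) simp_all
  moreover have "unshuffle V w (\<lambda>u v. F u (x # v)) = unshuffle V w (\<lambda>u v. G u (x # v))"
    using Cons.prems(1) by (intro Cons.IH Cons.prems(2)) simp_all
  ultimately show ?case by simp
qed simp

text \<open>Replacing letters keeps the length. Recording this lets the hypothesis of an induction
  on word length be used under the sum.\<close>

lemma derive_word_cong:
  assumes "w \<in> lists S" "d \<in> S \<rightarrow> S"
    "\<And>u. \<lbrakk>u \<in> lists S; length u = length w\<rbrakk> \<Longrightarrow> F u = G u"
  shows "derive_word V d w F = derive_word V d w G"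
  using assms
proof (induction w arbitrary: F G rule: list.induct)
  case (Cons x w)
  have "derive_word V d w (\<lambda>u. F (x # u)) = derive_word V d w (\<lambda>u. G (x # u))"
    using Cons.prems(1,2) by (intro Cons.IH Cons.prems(3)) simp_all
  moreover have "F (d x # w) = G (d x # w)"
    using Cons.prems(1,2) by (intro Cons.prems(3)) (auto simp: Pi_iff)
  ultimately show ?case by simp
qed simp

context vspace
begin

lemma unshuffle_closed:
  assumes "w \<in> lists S" "\<And>u v. \<lbrakk>u \<in> lists S; v \<in> lists S\<rbrakk> \<Longrightarrow> F u v \<in> carrier V"
  shows "unshuffle V w F \<in> carrier V"
  using assms by (induction w arbitrary: F rule: list.induct) auto

lemma unshuffle_add:
  assumes "w \<in> lists S" "\<And>u v. \<lbrakk>u \<in> lists S; v \<in> lists S\<rbrakk> \<Longrightarrow> F u v \<in> carrier V"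
    "\<And>u v. \<lbrakk>u \<in> lists S; v \<in> lists S\<rbrakk> \<Longrightarrow> G u v \<in> carrier V"
  shows "unshuffle V w (\<lambda>u v. F u v \<oplus> G u v) = unshuffle V w F \<oplus> unshuffle V w G"
  using assms
proof (induction w arbitrary: F G rule: list.induct)
  case (Cons x w)
  then show ?case by (auto simp: unshuffle_closed[where S = S] a_ac)
qed simp

lemma unshuffle_swap:
  assumes "w \<in> lists S" "\<And>u v. \<lbrakk>u \<in> lists S; v \<in> lists S\<rbrakk> \<Longrightarrow> F u v \<in> carrier V"
  shows "unshuffle V w (\<lambda>u v. F v u) = unshuffle V w F"
  using assms
proof (induction w arbitrary: F rule: list.induct)
  case (Cons x w)
  have "unshuffle V w (\<lambda>u v. F (x # v) u) = unshuffle V w (\<lambda>u v. F (x # u) v)"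
    "unshuffle V w (\<lambda>u v. F v (x # u)) = unshuffle V w (\<lambda>u v. F u (x # v))"
    using Cons.prems Cons.IH[of "\<lambda>u v. F (x # u) v"] Cons.IH[of "\<lambda>u v. F u (x # v)"] by simp_all
  moreover have "unshuffle V w (\<lambda>u v. F (x # u) v) \<in> carrier V"
    "unshuffle V w (\<lambda>u v. F u (x # v)) \<in> carrier V"
    using Cons.prems by (simp_all add: unshuffle_closed[where S = S])
  ultimately show ?case by (simp add: a_comm)
qed simp

text \<open>Each letter goes to one of three subwords; the two sides differ only in the order of the
  two binary decisions. With \<open>unshuffle_swap\<close> for cocommutativity and the counit laws
  below, this is the coalgebra structure on which the later computations with words rest.\<close>

lemma unshuffle_coassoc:
  assumes "w \<in> lists S"
    "\<And>a b c. \<lbrakk>a \<in> lists S; b \<in> lists S; c \<in> lists S\<rbrakk> \<Longrightarrow> F a b c \<in> carrier V"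
  shows "unshuffle V w (\<lambda>u c. unshuffle V u (\<lambda>a b. F a b c)) =
    unshuffle V w (\<lambda>a v. unshuffle V v (\<lambda>b c. F a b c))"
  using assms
proof (induction w arbitrary: F rule: list.induct)
  case (Cons x w)
  show ?case
    using Cons.prems Cons.IH[of "\<lambda>a b c. F (x # a) b c"] Cons.IH[of "\<lambda>a b c. F a (x # b) c"]
      Cons.IH[of "\<lambda>a b c. F a b (x # c)"]
    by (simp add: unshuffle_closed[where S = S] unshuffle_add[where S = S] a_assoc)
qed simp

lemma unshuffle_zero: "unshuffle V w (\<lambda>u v. \<zero>) = \<zero>"
  by (induction w) auto

lemma unshuffle_counit_left:
  assumes "w \<in> lists S" "\<And>v. v \<in> lists S \<Longrightarrow> F v \<in> carrier V"
  shows "unshuffle V w (\<lambda>u v. if u = [] then F v else \<zero>) = F w"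
  using assms
proof (induction w arbitrary: F rule: list.induct)
  case (Cons x w)
  show ?case using Cons.prems Cons.IH[of "\<lambda>v. F (x # v)"] by (simp add: unshuffle_zero)
qed simp

lemma unshuffle_counit_right:
  assumes "w \<in> lists S" "\<And>v. v \<in> lists S \<Longrightarrow> F v \<in> carrier V"
  shows "unshuffle V w (\<lambda>u v. if v = [] then F u else \<zero>) = F w"
  using assms
proof (induction w arbitrary: F rule: list.induct)
  case (Cons x w)
  show ?case using Cons.prems Cons.IH[of "\<lambda>v. F (x # v)"] by (simp add: unshuffle_zero)
qed simp

lemma unshuffle_exchange:
  assumes "w \<in> lists S" "w' \<in> lists S'"
    "\<And>u v u' v'. \<lbrakk>u \<in> lists S; v \<in> lists S; u' \<in> lists S'; v' \<in> lists S'\<rbrakk> \<Longrightarrow> F u v u' v' \<in> carrier V"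
  shows "unshuffle V w (\<lambda>u v. unshuffle V w' (\<lambda>u' v'. F u v u' v')) =
    unshuffle V w' (\<lambda>u' v'. unshuffle V w (\<lambda>u v. F u v u' v'))"
  using assms
proof (induction w arbitrary: F rule: list.induct)
  case (Cons x w)
  have "unshuffle V w' (\<lambda>u' v'. unshuffle V w (\<lambda>u v. F (x # u) v u' v') \<oplus>
      unshuffle V w (\<lambda>u v. F u (x # v) u' v')) =
    unshuffle V w' (\<lambda>u' v'. unshuffle V w (\<lambda>u v. F (x # u) v u' v')) \<oplus>
      unshuffle V w' (\<lambda>u' v'. unshuffle V w (\<lambda>u v. F u (x # v) u' v'))"
    using Cons.prems by (intro unshuffle_add[where S = S'] unshuffle_closed[where S = S]) auto
  then show ?case
    using Cons.prems Cons.IH[of "\<lambda>u v. F (x # u) v"] Cons.IH[of "\<lambda>u v. F u (x # v)"] by simp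
qed simp

text \<open>The letters of the two factors are distributed independently, which is multiplicativity
  of the coproduct.\<close>

lemma unshuffle_append:
  assumes "w \<in> lists S" "w' \<in> lists S"
    "\<And>u v. \<lbrakk>u \<in> lists S; v \<in> lists S\<rbrakk> \<Longrightarrow> F u v \<in> carrier V"
  shows "unshuffle V (w @ w') F =
    unshuffle V w (\<lambda>u v. unshuffle V w' (\<lambda>u' v'. F (u @ u') (v @ v')))"
  using assms by (induction w arbitrary: F rule: list.induct) auto

lemma derive_word_closed:
  assumes "w \<in> lists S" "d \<in> S \<rightarrow> S" "\<And>u. u \<in> lists S \<Longrightarrow> F u \<in> carrier V"
  shows "derive_word V d w F \<in> carrier V"
  using assms
proof (induction w arbitrary: F rule: list.induct)
  case (Cons x w)
  show ?case using Cons.IH[of "\<lambda>u. F (x # u)"] Cons.prems Cons.prems(3)[of "d x # w"] by (auto simp: Pi_iff)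
qed simp

lemma derive_word_add:
  assumes "w \<in> lists S" "d \<in> S \<rightarrow> S" "\<And>u. u \<in> lists S \<Longrightarrow> F u \<in> carrier V"
    "\<And>u. u \<in> lists S \<Longrightarrow> G u \<in> carrier V"
  shows "derive_word V d w (\<lambda>u. F u \<oplus> G u) = derive_word V d w F \<oplus> derive_word V d w G"
  using assms
proof (induction w arbitrary: F G rule: list.induct)
  case (Cons x w)
  have [simp]: "d x \<in> S" "x \<in> S" "w \<in> lists S" using Cons.prems by auto
  show ?case
    using Cons.prems Cons.IH[of "\<lambda>u. F (x # u)" "\<lambda>u. G (x # u)"]
    by (simp add: derive_word_closed[where S = S] a_ac)
qed simp

text \<open>The letter that is changed ends up in exactly one of the two subwords: an induced
  derivation is also a coderivation.\<close>

lemma derive_word_unshuffle: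
  assumes "w \<in> lists S" "d \<in> S \<rightarrow> S"
    "\<And>u v. \<lbrakk>u \<in> lists S; v \<in> lists S\<rbrakk> \<Longrightarrow> F u v \<in> carrier V"
  shows "derive_word V d w (\<lambda>w'. unshuffle V w' F) =
    unshuffle V w (\<lambda>u v. derive_word V d u (\<lambda>u'. F u' v) \<oplus> derive_word V d v (\<lambda>v'. F u v'))"
  using assms
proof (induction w arbitrary: F rule: list.induct)
  case (Cons x w)
  have [simp]: "d x \<in> S" "x \<in> S" "w \<in> lists S" using Cons.prems by auto
  note [simp] = derive_word_closed[where S = S] Cons.prems
  have cl: "\<And>u v. \<lbrakk>u \<in> lists S; v \<in> lists S\<rbrakk> \<Longrightarrow> F (x # u) v \<in> carrier V"
    "\<And>u v. \<lbrakk>u \<in> lists S; v \<in> lists S\<rbrakk> \<Longrightarrow> F u (x # v) \<in> carrier V"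
    "\<And>u v. \<lbrakk>u \<in> lists S; v \<in> lists S\<rbrakk> \<Longrightarrow> F (d x # u) v \<in> carrier V"
    "\<And>u v. \<lbrakk>u \<in> lists S; v \<in> lists S\<rbrakk> \<Longrightarrow> F u (d x # v) \<in> carrier V"
    by auto
  show ?case
    using Cons.IH[of "\<lambda>u v. F (x # u) v"] Cons.IH[of "\<lambda>u v. F u (x # v)"] cl
    by (simp add: unshuffle_closed[where S = S] unshuffle_add[where S = S]
        derive_word_add[where S = S] a_ac)
qed simp

lemma derive_word_append:
  assumes "w \<in> lists S" "w' \<in> lists S" "d \<in> S \<rightarrow> S" "\<And>u. u \<in> lists S \<Longrightarrow> F u \<in> carrier V"
  shows "derive_word V d (w @ w') F =
    derive_word V d w (\<lambda>u. F (u @ w')) \<oplus> derive_word V d w' (\<lambda>u. F (w @ u))"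
  using assms
proof (induction w arbitrary: F rule: list.induct)
  case Nil then show ?case by (simp add: derive_word_closed[where S = S])
next
  case (Cons x w)
  have [simp]: "d x \<in> S" "x \<in> S" "w \<in> lists S" using Cons.prems by auto
  show ?case
    using Cons.prems Cons.IH[of "\<lambda>u. F (x # u)"]
    by (simp add: derive_word_closed[where S = S] a_assoc)
qed

text \<open>Bridges the definition of \<open>T_word\<close>, which updates a list at an index, and
  the structural recursion of \<open>derive_word\<close>, which is what inductions can use.\<close>

lemma derive_word_conv_finsum:
  assumes "w \<in> lists S" "d \<in> S \<rightarrow> S" "\<And>u. u \<in> lists S \<Longrightarrow> F u \<in> carrier V"
  shows "(\<Oplus>k\<in>{..<length w}. F (w[k := d (w ! k)])) = derive_word V d w F"
  using assms
proof (induction w arbitrary: F rule: list.induct)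
  case (Cons x w)
  have S: "d x \<in> S" "x \<in> S" "w \<in> lists S" "\<And>k. k < length w \<Longrightarrow> d (w ! k) \<in> S"
    using Cons.prems by (auto simp: in_lists_conv_set Pi_iff)
  have upd: "w[k := d (w ! k)] \<in> lists S" if "k < length w" for k
    using S(3) S(4)[OF that] set_update_subset_insert[of w k "d (w ! k)"]
    by (auto simp: in_lists_conv_set)
  have fin: "F ((x # w)[k := d ((x # w) ! k)]) \<in> carrier V" if "k < length (x # w)" for k
    using that S upd Cons.prems(3) by (cases k) auto
  have "(\<Oplus>k\<in>{..<length (x # w)}. F ((x # w)[k := d ((x # w) ! k)])) =
      (\<Oplus>k\<in>insert 0 (Suc ` {..<length w}). F ((x # w)[k := d ((x # w) ! k)]))"
    by (simp add: lessThan_Suc_eq_insert_0)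
  also have "\<dots> = F (d x # w) \<oplus> (\<Oplus>k\<in>Suc ` {..<length w}. F ((x # w)[k := d ((x # w) ! k)]))"
    using fin fin[of 0] by (subst finsum_insert) (auto simp: image_iff)
  also have "(\<Oplus>k\<in>Suc ` {..<length w}. F ((x # w)[k := d ((x # w) ! k)])) =
      (\<Oplus>k\<in>{..<length w}. F (x # w[k := d (w ! k)]))"
    using fin fin[of "Suc _"] by (subst add.finprod_reindex) (auto simp: Pi_iff)
  finally show ?case
    using Cons.IH[of "\<lambda>u. F (x # u)"] Cons.prems S by simp
qed simp

end

context linear
begin

lemma unshuffle:
  assumes "w \<in> lists S" "\<And>u v. \<lbrakk>u \<in> lists S; v \<in> lists S\<rbrakk> \<Longrightarrow> F u v \<in> carrier V"
  shows "f (unshuffle V w F) = unshuffle W w (\<lambda>u v. f (F u v))"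
  using assms by (induction w arbitrary: F rule: list.induct) (auto simp: V.unshuffle_closed[where S = S])

lemma derive_word:
  assumes "w \<in> lists S" "d \<in> S \<rightarrow> S" "\<And>u. u \<in> lists S \<Longrightarrow> F u \<in> carrier V"
  shows "f (derive_word V d w F) = derive_word W d w (\<lambda>u. f (F u))"
  using assms
proof (induction w arbitrary: F rule: list.induct)
  case (Cons x w)
  have [simp]: "d x \<in> S" "x \<in> S" "w \<in> lists S" using Cons.prems by auto
  show ?case
    using Cons.prems Cons.IH[of "\<lambda>u. F (x # u)"] by (simp add: V.derive_word_closed[where S = S])
qed simp

end

section \<open>The free algebra\<close>

lemma free_algebra_simps:
  "carrier (free_algebra S) = {f. Poly_Mapping.keys f \<subseteq> lists S}" "\<zero>\<^bsub>free_algebra S\<^esub> = 0"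
  "f \<oplus>\<^bsub>free_algebra S\<^esub> h = f + h" "c \<odot>\<^bsub>free_algebra S\<^esub> f = Poly_Mapping.map ((*) c) f"
  "\<one>\<^bsub>free_algebra S\<^esub> = Poly_Mapping.single [] 1"
  by (simp_all add: free_algebra_def)

text \<open>Being a vector space depends on four fields only. This transfers it between records that
  differ in the others, such as \<open>free_module\<close> and \<open>free_algebra\<close>, or
  \<open>uea_algebra\<close> and \<open>UEA\<close>.\<close>

lemma vspace_cong:
  assumes "carrier V = carrier W" "add V = add W" "\<zero>\<^bsub>V\<^esub> = \<zero>\<^bsub>W\<^esub>"
    "module.smult V = module.smult W"
  shows "vspace V \<longleftrightarrow> vspace W"
proof -
  have *: "vspace W" if V: "vspace V"
    and eq: "carrier V = carrier W" "add V = add W" "\<zero>\<^bsub>V\<^esub> = \<zero>\<^bsub>W\<^esub>" "module.smult V = module.smult W"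
    for V :: "('k::field_char_0, 'a, 'm) module_scheme" and W :: "('k, 'a, 'n) module_scheme"
  proof -
    interpret vspace V by fact
    have "abelian_group W"
    proof (rule abelian_groupI, unfold eq[symmetric])
      fix x assume "x \<in> carrier V"
      then show "\<exists>y\<in>carrier V. y \<oplus>\<^bsub>V\<^esub> x = \<zero>\<^bsub>V\<^esub>"
        by (intro bexI[of _ "\<ominus>\<^bsub>V\<^esub> x"]) (simp_all add: l_neg)
    qed (simp_all add: a_ac)
    then show ?thesis
      by (intro vspace.intro vspace_axioms.intro)
        (simp_all add: eq[symmetric] smult_l_distr smult_r_distr smult_smult)
  qed
  show ?thesis using *[of V W] *[of W V] assms by auto
qed

lemma vspace_free_algebra: "vspace (free_algebra S)"
  using vspace_free_module[of "lists S"]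
  by (subst vspace_cong[of _ "free_module (lists S)"]) (auto simp: free_algebra_def free_module_def)

lemma free_algebra_carrier_conv: "carrier (free_algebra S) = carrier (free_module (lists S))"
  by (simp add: free_algebra_simps free_module_simps)

lemma linear_map_free_algebra_iff:
  "linear_map (free_algebra S) V f \<longleftrightarrow> linear_map (free_module (lists S)) V f"
  by (simp add: linear_map_def free_algebra_simps free_module_simps)

lemmas free_algebra_induct [consumes 1, case_names zero add single] =
  free_module_induct[of _ "lists S" for S, folded free_algebra_carrier_conv]

text \<open>The convolution sum is extended to finite sets that do not depend on the supports, after
  which distributivity holds term by term.\<close>

lemma free_algebra_mult_superset:
  assumes "finite A" "finite B" "Poly_Mapping.keys f \<subseteq> A" "Poly_Mapping.keys h \<subseteq> B"
  shows "f \<otimes>\<^bsub>free_algebra S\<^esub> h = (\<Sum>u\<in>A. \<Sum>v\<in>B.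
    Poly_Mapping.single (u @ v) (Poly_Mapping.lookup f u * Poly_Mapping.lookup h v))"
proof -
  have "f \<otimes>\<^bsub>free_algebra S\<^esub> h = (\<Sum>u\<in>Poly_Mapping.keys f. \<Sum>v\<in>B.
    Poly_Mapping.single (u @ v) (Poly_Mapping.lookup f u * Poly_Mapping.lookup h v))"
    unfolding free_algebra_def using assms
    by (simp, intro sum.cong sum.mono_neutral_left) (auto simp: in_keys_iff)
  also have "\<dots> = (\<Sum>u\<in>A. \<Sum>v\<in>B.
    Poly_Mapping.single (u @ v) (Poly_Mapping.lookup f u * Poly_Mapping.lookup h v))"
    using assms by (intro sum.mono_neutral_left) (auto simp: in_keys_iff)
  finally show ?thesis .
qed

lemma free_algebra_mult_add_left:
  "(f + f') \<otimes>\<^bsub>free_algebra S\<^esub> h = f \<otimes>\<^bsub>free_algebra S\<^esub> h + f' \<otimes>\<^bsub>free_algebra S\<^esub> h"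
  by (subst (1 2 3) free_algebra_mult_superset[where
        A = "Poly_Mapping.keys f \<union> Poly_Mapping.keys f'" and B = "Poly_Mapping.keys h"])
    (auto simp: keys_add lookup_add distrib_right single_add sum.distrib)

lemma free_algebra_mult_add_right:
  "f \<otimes>\<^bsub>free_algebra S\<^esub> (h + h') = f \<otimes>\<^bsub>free_algebra S\<^esub> h + f \<otimes>\<^bsub>free_algebra S\<^esub> h'"
  by (subst (1 2 3) free_algebra_mult_superset[where
        A = "Poly_Mapping.keys f" and B = "Poly_Mapping.keys h \<union> Poly_Mapping.keys h'"])
    (auto simp: keys_add lookup_add distrib_left single_add sum.distrib)

lemma free_algebra_mult_zero [simp]:
  "0 \<otimes>\<^bsub>free_algebra S\<^esub> h = 0" "f \<otimes>\<^bsub>free_algebra S\<^esub> 0 = 0"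
  by (simp_all add: free_algebra_def)

lemma free_algebra_mult_single [simp]:
  "Poly_Mapping.single u a \<otimes>\<^bsub>free_algebra S\<^esub> Poly_Mapping.single v b = Poly_Mapping.single (u @ v) (a * b)"
  by (subst free_algebra_mult_superset[where A = "{u}" and B = "{v}"]) auto

lemma free_algebra_mult_closed:
  assumes "f \<in> carrier (free_algebra S)" "h \<in> carrier (free_algebra S)"
  shows "f \<otimes>\<^bsub>free_algebra S\<^esub> h \<in> carrier (free_algebra S)"
proof -
  interpret vspace "free_algebra S" by (rule vspace_free_algebra)
  note a_closed' = a_closed[unfolded free_algebra_simps(3)]
  note zero_closed' = zero_closed[unfolded free_algebra_simps(2)]
  show ?thesis
    using assms(1)
  proof (induction rule: free_algebra_induct)
    case (single u c)
    show ?case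
      using assms(2)
    proof (induction rule: free_algebra_induct)
      case (single v d)
      with \<open>u \<in> lists S\<close> show ?case by (auto simp: free_algebra_simps)
    qed (simp_all add: free_algebra_mult_add_right a_closed' zero_closed')
  qed (simp_all add: free_algebra_mult_add_left a_closed' zero_closed')
qed

lemma free_algebra_mult_assoc:
  assumes "f \<in> carrier (free_algebra S)" "h \<in> carrier (free_algebra S)" "k \<in> carrier (free_algebra S)"
  shows "(f \<otimes>\<^bsub>free_algebra S\<^esub> h) \<otimes>\<^bsub>free_algebra S\<^esub> k =
    f \<otimes>\<^bsub>free_algebra S\<^esub> (h \<otimes>\<^bsub>free_algebra S\<^esub> k)"
  using assms(1)
proof (induction rule: free_algebra_induct)
  case (single u c)
  show ?case
    using assms(2)
  proof (induction rule: free_algebra_induct)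
    case (single v d)
    show ?case
      using assms(3)
      by (induction rule: free_algebra_induct) (simp_all add: free_algebra_mult_add_right mult.assoc)
  qed (simp_all add: free_algebra_mult_add_right free_algebra_mult_add_left)
qed (simp_all add: free_algebra_mult_add_left)

lemma free_algebra_mult_one:
  assumes "f \<in> carrier (free_algebra S)"
  shows "Poly_Mapping.single [] 1 \<otimes>\<^bsub>free_algebra S\<^esub> f = f"
    and "f \<otimes>\<^bsub>free_algebra S\<^esub> Poly_Mapping.single [] 1 = f"
  using assms
  by (induction rule: free_algebra_induct)
    (simp_all add: free_algebra_mult_add_left free_algebra_mult_add_right)

lemma ring_free_algebra: "ring (free_algebra S)"
proof (rule ringI)
  show "abelian_group (free_algebra S)"
    using vspace_free_algebra by (rule vspace.axioms(1))
  show "Group.monoid (free_algebra S)"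
    by (rule monoidI)
      (simp_all add: free_algebra_simps(5) free_algebra_mult_closed free_algebra_mult_assoc
        free_algebra_mult_one, simp add: free_algebra_simps)
qed (simp_all add: free_algebra_simps(3) free_algebra_mult_add_left free_algebra_mult_add_right)

lemma map_times_add:
  "Poly_Mapping.map ((*) (c::'k::comm_semiring_0)) (f + h) = Poly_Mapping.map ((*) c) f + Poly_Mapping.map ((*) c) h"
  by (rule poly_mapping_eqI) (simp add: lookup_add distrib_left)

lemma map_times_zero [simp]: "Poly_Mapping.map ((*) (c::'k::mult_zero)) 0 = 0"
  by (rule poly_mapping_eqI) simp

text \<open>Scalars are multiples of the empty word, which is central. So an ideal of the ring is a
  subspace, and multiplication in the quotient is bilinear over the field.\<close>

lemma free_algebra_smult_conv:
  assumes "f \<in> carrier (free_algebra S)"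
  shows "Poly_Mapping.single [] c \<otimes>\<^bsub>free_algebra S\<^esub> f = Poly_Mapping.map ((*) c) f"
    and "f \<otimes>\<^bsub>free_algebra S\<^esub> Poly_Mapping.single [] c = Poly_Mapping.map ((*) c) f"
  using assms
  by (induction rule: free_algebra_induct)
    (simp_all add: free_algebra_mult_add_left free_algebra_mult_add_right map_times_add mult.commute)

lemma lookup_Nil_free_algebra_mult:
  assumes "f \<in> carrier (free_algebra S)" "h \<in> carrier (free_algebra S)"
  shows "Poly_Mapping.lookup (f \<otimes>\<^bsub>free_algebra S\<^esub> h) [] = Poly_Mapping.lookup f [] * Poly_Mapping.lookup h []"
  using assms(1)
proof (induction rule: free_algebra_induct)
  case (single u c)
  show ?case
    using assms(2)
    by (induction rule: free_algebra_induct)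
      (auto simp: free_algebra_mult_add_right lookup_add distrib_left lookup_single when_def)
qed (simp_all add: free_algebra_mult_add_left lookup_add distrib_right)


section \<open>The enveloping algebra\<close>

lemma linear_extension_cong_module:
  assumes "carrier V = carrier W" "add V = add W" "\<zero>\<^bsub>V\<^esub> = \<zero>\<^bsub>W\<^esub>" "module.smult V = module.smult W"
  shows "linear_extension V = linear_extension W"
  by (intro ext) (simp add: linear_extension_def finsum_def finprod_def assms)

lemma tensor_cong:
  assumes "carrier V = carrier W" "add V = add W" "module.smult V = module.smult W"
  shows "tensor V V = tensor W W" "pure_tensor V V = pure_tensor W W" "tensor_op V = tensor_op W"
proof -
  have "tensor_relations V V = tensor_relations W W"
    using assms by (simp add: tensor_relations_def)
  then have "tensor_kernel V V = tensor_kernel W W"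
    using assms by (simp add: tensor_kernel_def)
  then show "tensor V V = tensor W W" "pure_tensor V V = pure_tensor W W"
    using assms by (auto simp: tensor_def pure_tensor_def fun_eq_iff)
  then show "tensor_op V = tensor_op W"
    by (auto simp: tensor_op_def fun_eq_iff)
qed

lemma UEA_simps:
  "carrier (UEA \<gg>) = carrier (uea_algebra \<gg>)" "monoid.mult (UEA \<gg>) = monoid.mult (uea_algebra \<gg>)"
  "\<one>\<^bsub>UEA \<gg>\<^esub> = \<one>\<^bsub>uea_algebra \<gg>\<^esub>" "\<zero>\<^bsub>UEA \<gg>\<^esub> = \<zero>\<^bsub>uea_algebra \<gg>\<^esub>"
  "add (UEA \<gg>) = add (uea_algebra \<gg>)" "module.smult (UEA \<gg>) = module.smult (uea_algebra \<gg>)"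
  "tri (UEA \<gg>) = uea_tri \<gg>" "comult (UEA \<gg>) = uea_comult \<gg>" "counit (UEA \<gg>) = uea_counit \<gg>"
  "filt (UEA \<gg>) = uea_filt \<gg>"
  by (simp_all add: UEA_def)

text \<open>The coproduct and \<triangleright> are defined over the bare algebra, because the full
  record contains them as fields. Tensor constructions see only fields on which both records agree,
  so everything can be moved to \<open>UEA\<close>.\<close>

lemma uea_algebra_to_UEA:
  "linear_extension (uea_algebra \<gg>) = linear_extension (UEA \<gg>)"
  "tensor (uea_algebra \<gg>) (uea_algebra \<gg>) = tensor (UEA \<gg>) (UEA \<gg>)"
  "pure_tensor (uea_algebra \<gg>) (uea_algebra \<gg>) = pure_tensor (UEA \<gg>) (UEA \<gg>)"
  "tensor_op (uea_algebra \<gg>) = tensor_op (UEA \<gg>)"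
  by (intro linear_extension_cong_module tensor_cong; simp add: UEA_simps)+

text \<open>The functions on words whose linear extension to the free algebra descends to \<open>\<U>(\<gg>)\<close>.\<close>

definition uea_compatible ::
  "('k::field_char_0, 'g) post_lie \<Rightarrow> ('k, 'a, 'm) module_scheme \<Rightarrow> ('g list \<Rightarrow> 'a) \<Rightarrow> bool"
  where "uea_compatible \<gg> V h \<longleftrightarrow>
    (\<forall>w\<in>lists (carrier \<gg>). h w \<in> carrier V) \<and>
    (\<forall>p\<in>lists (carrier \<gg>). \<forall>q\<in>lists (carrier \<gg>). \<forall>x\<in>carrier \<gg>.
      (\<forall>y\<in>carrier \<gg>. h (p @ (x \<oplus>\<^bsub>\<gg>\<^esub> y) # q) = h (p @ x # q) \<oplus>\<^bsub>V\<^esub> h (p @ y # q)) \<and>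
      (\<forall>c. h (p @ (c \<odot>\<^bsub>\<gg>\<^esub> x) # q) = c \<odot>\<^bsub>V\<^esub> h (p @ x # q)) \<and>
      (\<forall>y\<in>carrier \<gg>. h (p @ x # y # q) = h (p @ y # x # q) \<oplus>\<^bsub>V\<^esub> h (p @ bracket \<gg> x y # q)))"

lemma uea_compatibleD:
  assumes "uea_compatible \<gg> V h"
  shows "w \<in> lists (carrier \<gg>) \<Longrightarrow> h w \<in> carrier V"
    and "\<lbrakk>p \<in> lists (carrier \<gg>); q \<in> lists (carrier \<gg>); x \<in> carrier \<gg>; y \<in> carrier \<gg>\<rbrakk> \<Longrightarrow>
      h (p @ (x \<oplus>\<^bsub>\<gg>\<^esub> y) # q) = h (p @ x # q) \<oplus>\<^bsub>V\<^esub> h (p @ y # q)"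
    and "\<lbrakk>p \<in> lists (carrier \<gg>); q \<in> lists (carrier \<gg>); x \<in> carrier \<gg>\<rbrakk> \<Longrightarrow>
      h (p @ (c \<odot>\<^bsub>\<gg>\<^esub> x) # q) = c \<odot>\<^bsub>V\<^esub> h (p @ x # q)"
    and "\<lbrakk>p \<in> lists (carrier \<gg>); q \<in> lists (carrier \<gg>); x \<in> carrier \<gg>; y \<in> carrier \<gg>\<rbrakk> \<Longrightarrow>
      h (p @ x # y # q) = h (p @ y # x # q) \<oplus>\<^bsub>V\<^esub> h (p @ bracket \<gg> x y # q)"
  using assms unfolding uea_compatible_def by blast+

context post_lie_algebra
begin

sublocale g: vspace \<gg>
  using module_axioms by (simp add: vspace_iff_module)

abbreviation "S \<equiv> carrier \<gg>"
abbreviation "F \<equiv> free_algebra (carrier \<gg>) :: ('k, 'g list \<Rightarrow>\<^sub>0 'k) module"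
abbreviation "U \<equiv> UEA \<gg>"
abbreviation "word \<equiv> uea_word \<gg>"

sublocale F: vspace F by (rule vspace_free_algebra)
sublocale F: ring F by (rule ring_free_algebra)

lemma bracket_linear: "x \<in> S \<Longrightarrow> linear_map \<gg> \<gg> (bracket \<gg> x)" "y \<in> S \<Longrightarrow> linear_map \<gg> \<gg> (\<lambda>x. bracket \<gg> x y)"
  using bracket_bilinear by (simp_all add: bilinear_op_def)

lemma tri_linear: "x \<in> S \<Longrightarrow> linear_map \<gg> \<gg> (tri \<gg> x)" "y \<in> S \<Longrightarrow> linear_map \<gg> \<gg> (\<lambda>x. x \<triangleright> y)"
  using tri_bilinear by (simp_all add: bilinear_op_def)

lemma bracket_closed [simp]: "\<lbrakk>x \<in> S; y \<in> S\<rbrakk> \<Longrightarrow> bracket \<gg> x y \<in> S"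
  using linear_mapD(1)[OF bracket_linear(1)] .

lemma tri_closed [simp]: "\<lbrakk>x \<in> S; y \<in> S\<rbrakk> \<Longrightarrow> x \<triangleright> y \<in> S"
  using linear_mapD(1)[OF tri_linear(1)] .

lemma single_closed [simp]: "w \<in> lists S \<Longrightarrow> Poly_Mapping.single w c \<in> carrier F"
  by (auto simp: free_algebra_simps)

lemma F_minus: "\<lbrakk>f \<in> carrier F; h \<in> carrier F\<rbrakk> \<Longrightarrow> f - h = f \<ominus>\<^bsub>F\<^esub> h"
proof -
  assume fh: "f \<in> carrier F" "h \<in> carrier F"
  have "- h \<in> carrier F" using fh by (auto simp: free_algebra_simps in_keys_iff)
  then have "\<ominus>\<^bsub>F\<^esub> h = - h"
    using fh by (intro F.minus_equality) (auto simp: free_algebra_simps)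
  then show ?thesis by (simp add: a_minus_def free_algebra_simps)
qed

lemma relations_closed: "uea_relations \<gg> \<subseteq> carrier F"
  by (auto simp: uea_relations_def F_minus)

lemma ideal_uea: "ideal (uea_ideal \<gg>) F"
  unfolding uea_ideal_def by (rule F.genideal_ideal[OF relations_closed])

sublocale I: ideal "uea_ideal \<gg>" F by (rule ideal_uea)

lemma submodule_ideal:
  assumes "ideal J F" shows "submodule J (base_field :: 'k ring) F"
proof -
  interpret J: ideal J F by fact
  show ?thesis
  proof (rule F.submoduleI)
    fix c f assume "f \<in> J"
    then show "c \<odot>\<^bsub>F\<^esub> f \<in> J"
      using J.I_l_closed[of f "Poly_Mapping.single [] c"] J.a_Hcarr[of f]
      by (simp add: free_algebra_smult_conv free_algebra_simps(4))
  qed (use J.a_subset in auto)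
qed

sublocale Q: quotient F "uea_ideal \<gg>"
  by (intro quotient.intro quotient_axioms.intro vspace_free_algebra submodule_ideal ideal_uea)

lemma vspace_uea_algebra: "vspace (uea_algebra \<gg>)"
  unfolding uea_algebra_def by (rule Q.vspace_quotient)

sublocale U: vspace U
  using vspace_uea_algebra by (subst vspace_cong[of _ "uea_algebra \<gg>"]) (auto simp: UEA_simps)

abbreviation coset ("\<pi>") where "coset f \<equiv> uea_ideal \<gg> +>\<^bsub>F\<^esub> f"

lemma U_simps:
  "carrier U = \<pi> ` carrier F" "\<one>\<^bsub>U\<^esub> = \<pi> (Poly_Mapping.single [] 1)"
  "\<lbrakk>f \<in> carrier F; h \<in> carrier F\<rbrakk> \<Longrightarrow> \<pi> f \<oplus>\<^bsub>U\<^esub> \<pi> h = \<pi> (f + h)"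
  "\<lbrakk>f \<in> carrier F; h \<in> carrier F\<rbrakk> \<Longrightarrow> \<pi> f \<otimes>\<^bsub>U\<^esub> \<pi> h = \<pi> (f \<otimes>\<^bsub>F\<^esub> h)"
  "f \<in> carrier F \<Longrightarrow> c \<odot>\<^bsub>U\<^esub> \<pi> f = \<pi> (Poly_Mapping.map ((*) c) f)"
  using Q.quotient_simps Q.quotient_smult[of f c] I.rcoset_mult_add[of f h]
  by (simp_all add: UEA_simps uea_algebra_def free_algebra_simps(3,4))
    (simp_all add: quotient_module_def FactRing_def free_algebra_simps(5))

sublocale U: ring U
proof -
  interpret FI: ring "F Quot uea_ideal \<gg>" by (rule I.quotient_is_ring)
  have eq: "carrier U = carrier (F Quot uea_ideal \<gg>)" "add U = add (F Quot uea_ideal \<gg>)"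
    "monoid.mult U = monoid.mult (F Quot uea_ideal \<gg>)" "\<one>\<^bsub>U\<^esub> = \<one>\<^bsub>F Quot uea_ideal \<gg>\<^esub>"
    by (simp_all add: UEA_simps uea_algebra_def quotient_module_def)
  show "ring U"
  proof (rule ringI)
    show "abelian_group U" by (rule U.abelian_group_axioms)
    show "Group.monoid U" by (rule monoidI) (simp_all only: eq FI.m_closed FI.one_closed FI.m_assoc FI.l_one FI.r_one)
  qed (simp_all only: eq FI.l_distr FI.r_distr)
qed

lemma word_closed [simp]: "w \<in> lists S \<Longrightarrow> word w \<in> carrier U"
  by (simp add: uea_word_def U_simps)

lemma word_Nil: "word [] = \<one>\<^bsub>U\<^esub>"
  by (simp add: uea_word_def U_simps)

lemma word_append: "\<lbrakk>u \<in> lists S; v \<in> lists S\<rbrakk> \<Longrightarrow> word u \<otimes>\<^bsub>U\<^esub> word v = word (u @ v)"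
  by (simp add: uea_word_def U_simps)

lemma uea_induct [consumes 1, case_names word add smult]:
  assumes "u \<in> carrier U"
    and word: "\<And>w. w \<in> lists S \<Longrightarrow> P (word w)"
    and add: "\<And>u v. \<lbrakk>u \<in> carrier U; v \<in> carrier U; P u; P v\<rbrakk> \<Longrightarrow> P (u \<oplus>\<^bsub>U\<^esub> v)"
    and smult: "\<And>c u. \<lbrakk>u \<in> carrier U; P u\<rbrakk> \<Longrightarrow> P (c \<odot>\<^bsub>U\<^esub> u)"
  shows "P u"
proof -
  obtain f where f: "f \<in> carrier F" "u = \<pi> f" using assms(1) by (auto simp: U_simps)
  have "P (\<pi> f)" using f(1)
  proof (induction rule: free_algebra_induct)
    case zero
    have "\<pi> 0 = 0 \<odot>\<^bsub>U\<^esub> word []"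
      by (simp add: uea_word_def U_simps)
    then show ?case using smult[OF word_closed word, of "[]" 0] by simp
  next
    case (add f h)
    then show ?case using assms(3)[of "\<pi> f" "\<pi> h"] by (simp add: U_simps)
  next
    case (single w c)
    have "\<pi> (Poly_Mapping.single w c) = c \<odot>\<^bsub>U\<^esub> word w"
      using single by (simp add: uea_word_def U_simps)
    then show ?case using single smult[OF word_closed word, of w c] by simp
  qed
  with f show ?thesis by simp
qed

lemma uea_ext:
  assumes "linear_map U V f" "linear_map U V h" "\<And>w. w \<in> lists S \<Longrightarrow> f (word w) = h (word w)"
    "u \<in> carrier U"
  shows "f u = h u"
  using assms(4)
  by (induction rule: uea_induct) (simp_all add: assms(3) linear_mapD[OF assms(1)] linear_mapD[OF assms(2)])

lemma uea_ext2:
  assumes "bilinear_map U U V b" "bilinear_map U U V b'"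
    "\<And>w w'. \<lbrakk>w \<in> lists S; w' \<in> lists S\<rbrakk> \<Longrightarrow> b (word w) (word w') = b' (word w) (word w')"
    "u \<in> carrier U" "v \<in> carrier U"
  shows "b u v = b' u v"
proof -
  have "b (word w) v = b' (word w) v" if "w \<in> lists S" for w
    by (rule uea_ext[OF bilinear_mapD(1)[OF assms(1)] bilinear_mapD(1)[OF assms(2)]])
      (use that assms(3,5) in simp_all)
  then show ?thesis
    using uea_ext[OF bilinear_mapD(2)[OF assms(1,5)] bilinear_mapD(2)[OF assms(2,5)] _ assms(4)] by blast
qed

lemma mult_linear: "x \<in> carrier U \<Longrightarrow> linear_map U U (\<lambda>y. x \<otimes>\<^bsub>U\<^esub> y)"
    "y \<in> carrier U \<Longrightarrow> linear_map U U (\<lambda>x. x \<otimes>\<^bsub>U\<^esub> y)"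
proof -
  have *: "x \<otimes>\<^bsub>U\<^esub> (c \<odot>\<^bsub>U\<^esub> y) = c \<odot>\<^bsub>U\<^esub> (x \<otimes>\<^bsub>U\<^esub> y)"
    "(c \<odot>\<^bsub>U\<^esub> x) \<otimes>\<^bsub>U\<^esub> y = c \<odot>\<^bsub>U\<^esub> (x \<otimes>\<^bsub>U\<^esub> y)"
    if xy: "x \<in> carrier U" "y \<in> carrier U" for x y c
  proof -
    obtain f h where fh: "f \<in> carrier F" "x = \<pi> f" "h \<in> carrier F" "y = \<pi> h"
      using xy by (auto simp: U_simps)
    let ?c = "Poly_Mapping.single [] c"
    have c: "?c \<in> carrier F" by simp
    show "x \<otimes>\<^bsub>U\<^esub> (c \<odot>\<^bsub>U\<^esub> y) = c \<odot>\<^bsub>U\<^esub> (x \<otimes>\<^bsub>U\<^esub> y)"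
      "(c \<odot>\<^bsub>U\<^esub> x) \<otimes>\<^bsub>U\<^esub> y = c \<odot>\<^bsub>U\<^esub> (x \<otimes>\<^bsub>U\<^esub> y)"
      using fh c free_algebra_mult_assoc[OF fh(1,3) c] free_algebra_mult_assoc[OF c fh(1,3)]
        F.smult_closed[of _ c]
      by (simp_all add: U_simps free_algebra_smult_conv free_algebra_mult_closed free_algebra_simps(4))
  qed
  show "x \<in> carrier U \<Longrightarrow> linear_map U U (\<lambda>y. x \<otimes>\<^bsub>U\<^esub> y)"
    by (rule linear_mapI) (auto simp: * U.r_distr)
  show "y \<in> carrier U \<Longrightarrow> linear_map U U (\<lambda>x. x \<otimes>\<^bsub>U\<^esub> y)"
    by (rule linear_mapI) (auto simp: * U.l_distr)
qed

lemma mult_bilinear: "bilinear_map U U U (monoid.mult U)"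
  by (intro bilinear_mapI mult_linear)

lemma compatible_linear_extension:
  assumes V: "vspace V" and h: "uea_compatible \<gg> V h"
  shows "linear_map F V (linear_extension V h)"
    and "n \<in> uea_ideal \<gg> \<Longrightarrow> linear_extension V h n = \<zero>\<^bsub>V\<^esub>"
    and "w \<in> lists S \<Longrightarrow> linear_extension V h (Poly_Mapping.single w c) = c \<odot>\<^bsub>V\<^esub> h w"
proof -
  interpret V: vspace V by fact
  let ?L = "linear_extension V h"
  have closed: "h w \<in> carrier V" if "w \<in> lists S" for w
    using uea_compatibleD(1)[OF h] that by blast
  note compatible = uea_compatibleD(2-4)[OF h]
  show lin: "linear_map F V ?L"
    unfolding linear_map_free_algebra_iff using closed by (intro V.linear_extension_linear) auto
  show single: "?L (Poly_Mapping.single w c) = c \<odot>\<^bsub>V\<^esub> h w" if "w \<in> lists S" for w c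
    using that closed by (simp add: V.linear_extension_single)
  interpret L: linear F V ?L
    by (intro linear.intro linear_axioms.intro vspace_free_algebra V lin)
  \<comment> \<open>The kernel of \<open>?L\<close> is merely a subspace, while
    \<open>uea_ideal\<close> is generated as a two-sided ideal. K is the largest two-sided ideal
    inside the kernel, so it suffices to place the relations in K.\<close>
  define K where "K = {f \<in> carrier F. \<forall>a\<in>carrier F. \<forall>b\<in>carrier F.
    ?L ((a \<otimes>\<^bsub>F\<^esub> f) \<otimes>\<^bsub>F\<^esub> b) = \<zero>\<^bsub>V\<^esub>}"
  have "ideal K F"
  proof (rule idealI)
    show "ring F" by (rule F.ring_axioms)
    have "submodule K (base_field :: 'k ring) F"
    proof (rule F.submoduleI)
      fix c f assume f: "f \<in> K"
      have "(a \<otimes>\<^bsub>F\<^esub> (Poly_Mapping.single [] c \<otimes>\<^bsub>F\<^esub> f)) \<otimes>\<^bsub>F\<^esub> b =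
          ((a \<otimes>\<^bsub>F\<^esub> Poly_Mapping.single [] c) \<otimes>\<^bsub>F\<^esub> f) \<otimes>\<^bsub>F\<^esub> b"
        if "a \<in> carrier F" "b \<in> carrier F" for a b
        using that f by (simp add: K_def F.m_assoc)
      moreover have "c \<odot>\<^bsub>F\<^esub> f = Poly_Mapping.single [] c \<otimes>\<^bsub>F\<^esub> f"
        using f by (simp add: K_def free_algebra_smult_conv free_algebra_simps(4))
      ultimately show "c \<odot>\<^bsub>F\<^esub> f \<in> K"
        using f by (simp add: K_def)
    qed (auto simp: K_def F.r_distr F.l_distr)
    then show "subgroup K (add_monoid F)" by (rule submodule.axioms(1))
  next
    fix f c assume f: "f \<in> K" and c: "c \<in> carrier F"
    have "(a \<otimes>\<^bsub>F\<^esub> (c \<otimes>\<^bsub>F\<^esub> f)) \<otimes>\<^bsub>F\<^esub> b = ((a \<otimes>\<^bsub>F\<^esub> c) \<otimes>\<^bsub>F\<^esub> f) \<otimes>\<^bsub>F\<^esub> b"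
      "(a \<otimes>\<^bsub>F\<^esub> (f \<otimes>\<^bsub>F\<^esub> c)) \<otimes>\<^bsub>F\<^esub> b = (a \<otimes>\<^bsub>F\<^esub> f) \<otimes>\<^bsub>F\<^esub> (c \<otimes>\<^bsub>F\<^esub> b)"
      if "a \<in> carrier F" "b \<in> carrier F" for a b
      using that f c by (simp_all add: K_def F.m_assoc)
    with f c show "c \<otimes>\<^bsub>F\<^esub> f \<in> K" "f \<otimes>\<^bsub>F\<^esub> c \<in> K" by (auto simp: K_def)
  qed
  moreover have "uea_relations \<gg> \<subseteq> K"
  proof
    fix r assume r: "r \<in> uea_relations \<gg>"
    have rF: "r \<in> carrier F" using r relations_closed by blast
    \<comment> \<open>Between two monomials a relation becomes one of the conditions of
      \<open>uea_compatible\<close>, at the position between p and q.\<close>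
    have base: "?L ((Poly_Mapping.single p c \<otimes>\<^bsub>F\<^esub> r) \<otimes>\<^bsub>F\<^esub> Poly_Mapping.single q d) = \<zero>\<^bsub>V\<^esub>"
      if pq: "p \<in> lists S" "q \<in> lists S" for p q c d
    proof -
      have e: "(Poly_Mapping.single p c \<otimes>\<^bsub>F\<^esub> (f \<ominus>\<^bsub>F\<^esub> f')) \<otimes>\<^bsub>F\<^esub> Poly_Mapping.single q d =
        (Poly_Mapping.single p c \<otimes>\<^bsub>F\<^esub> f) \<otimes>\<^bsub>F\<^esub> Poly_Mapping.single q d \<ominus>\<^bsub>F\<^esub>
        (Poly_Mapping.single p c \<otimes>\<^bsub>F\<^esub> f') \<otimes>\<^bsub>F\<^esub> Poly_Mapping.single q d"
        if "f \<in> carrier F" "f' \<in> carrier F" for f f'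
        using that pq by (simp add: a_minus_def F.r_distr F.l_distr F.r_minus F.l_minus)
      from r consider (add) x y where "x \<in> S" "y \<in> S"
          "r = Poly_Mapping.single [x \<oplus> y] 1 - Poly_Mapping.single [x] 1 - Poly_Mapping.single [y] 1"
        | (smult) a x where "x \<in> S" "r = Poly_Mapping.single [a \<odot> x] 1 - Poly_Mapping.single [x] a"
        | (bracket) x y where "x \<in> S" "y \<in> S"
          "r = Poly_Mapping.single [x, y] 1 - Poly_Mapping.single [y, x] 1 - Poly_Mapping.single [bracket \<gg> x y] 1"
        by (auto simp: uea_relations_def)
      then show ?thesis
      proof cases
        case add
        then show ?thesis using pq closed
          by (simp add: F_minus e single compatible V.diff_simps V.smult_r_distr)
      next
        case smult
        then show ?thesis using pq closed
          by (simp add: F_minus e single compatible V.diff_simps V.smult_smult mult_ac)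
      next
        case (bracket x y)
        then show ?thesis using pq closed
          by (simp add: F_minus e single compatible(3)[of p q x y] V.diff_simps V.smult_r_distr)
      qed
    qed
    \<comment> \<open>Linearity passes from monomials to arbitrary factors, here on the left and in
      the next claim on the right.\<close>
    have step: "?L ((a \<otimes>\<^bsub>F\<^esub> r) \<otimes>\<^bsub>F\<^esub> Poly_Mapping.single q d) = \<zero>\<^bsub>V\<^esub>"
      if "a \<in> carrier F" "q \<in> lists S" for a q d
      using that(1)
    proof (induction rule: free_algebra_induct)
      case (add f f')
      then show ?case using rF \<open>q \<in> lists S\<close> by (simp add: F.l_distr flip: free_algebra_simps(3)[where S = "carrier \<gg>"])
    qed (use base that L.zero in \<open>auto simp: free_algebra_simps(2)\<close>)
    have "?L ((a \<otimes>\<^bsub>F\<^esub> r) \<otimes>\<^bsub>F\<^esub> b) = \<zero>\<^bsub>V\<^esub>" if "a \<in> carrier F" "b \<in> carrier F" for a b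
      using that(2)
    proof (induction rule: free_algebra_induct)
      case (add f f')
      then show ?case using rF \<open>a \<in> carrier F\<close> by (simp add: F.r_distr flip: free_algebra_simps(3)[where S = "carrier \<gg>"])
    qed (use step that L.zero in \<open>auto simp: free_algebra_simps(2)\<close>)
    with rF show "r \<in> K" by (simp add: K_def)
  qed
  ultimately have "uea_ideal \<gg> \<subseteq> K" unfolding uea_ideal_def by (rule F.genideal_minimal)
  then show "?L n = \<zero>\<^bsub>V\<^esub>" if n: "n \<in> uea_ideal \<gg>"
  proof -
    have "n \<in> K" using n \<open>uea_ideal \<gg> \<subseteq> K\<close> by blast
    then have "n \<in> carrier F" "?L ((\<one>\<^bsub>F\<^esub> \<otimes>\<^bsub>F\<^esub> n) \<otimes>\<^bsub>F\<^esub> \<one>\<^bsub>F\<^esub>) = \<zero>\<^bsub>V\<^esub>"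
      using F.one_closed unfolding K_def by blast+
    then show ?thesis by simp
  qed
qed

lemma uea_lift_linear:
  assumes V: "vspace V" and h: "uea_compatible \<gg> V h"
  shows "linear_map U V (induced_map V h)"
  using Q.linear_map_some_coset[OF V compatible_linear_extension(1,2)[OF V h]]
  by (simp add: linear_map_def induced_map_def[abs_def] UEA_simps uea_algebra_def)

lemma uea_lift_word:
  assumes V: "vspace V" and h: "uea_compatible \<gg> V h" and w: "w \<in> lists S"
  shows "induced_map V h (word w) = h w"
proof -
  have "h w \<in> carrier V" using uea_compatibleD(1)[OF h] w by blast
  then show ?thesis
    using Q.linear_some_coset[OF V compatible_linear_extension(1,2)[OF V h], of "Poly_Mapping.single w 1"]
      compatible_linear_extension(3)[OF V h w, of 1] w vspace.smult_one[OF V]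
    by (simp add: induced_map_def uea_word_def)
qed

text \<open>The tautological instance: the relations hold in U(g) for words without context, and
  multiplication by \<open>word p\<close> and \<open>word q\<close> carries them to any
  position.\<close>

lemma word_compatible: "uea_compatible \<gg> U word"
proof -
  have split: "word (p @ x # q) = word p \<otimes>\<^bsub>U\<^esub> (word [x] \<otimes>\<^bsub>U\<^esub> word q)"
    if "p \<in> lists S" "q \<in> lists S" "x \<in> S" for p x q
    using that by (simp add: word_append)
  have rel: "\<pi> a = \<pi> b \<oplus>\<^bsub>U\<^esub> \<pi> c" if "a - b - c \<in> uea_relations \<gg>" "a \<in> carrier F" "b \<in> carrier F" "c \<in> carrier F" for a b c
  proof -
    have "a \<ominus>\<^bsub>F\<^esub> (b \<oplus>\<^bsub>F\<^esub> c) \<in> uea_ideal \<gg>"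
      using that F.genideal_self[OF relations_closed]
      by (auto simp: uea_ideal_def F_minus F.diff_simps)
    then have "\<pi> a = \<pi> (b \<oplus>\<^bsub>F\<^esub> c)" using that Q.coset_eq_iff[of a "b \<oplus>\<^bsub>F\<^esub> c"] by simp
    then show ?thesis using that by (simp add: U_simps free_algebra_simps(3))
  qed
  have rel2: "\<pi> a = \<pi> b" if "a - b \<in> uea_relations \<gg>" "a \<in> carrier F" "b \<in> carrier F" for a b
    using that F.genideal_self[OF relations_closed] Q.coset_eq_iff[of a b]
    by (auto simp: uea_ideal_def F_minus)
  have w1: "word [x \<oplus> y] = word [x] \<oplus>\<^bsub>U\<^esub> word [y]"
    "word [c \<odot> x] = c \<odot>\<^bsub>U\<^esub> word [x]"
    "word [x, y] = word [y, x] \<oplus>\<^bsub>U\<^esub> word [bracket \<gg> x y]" if "x \<in> S" "y \<in> S" for x y c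
  proof -
    show "word [x \<oplus> y] = word [x] \<oplus>\<^bsub>U\<^esub> word [y]"
      "word [x, y] = word [y, x] \<oplus>\<^bsub>U\<^esub> word [bracket \<gg> x y]"
      unfolding uea_word_def using that by (intro rel; auto simp: uea_relations_def)+
    show "word [c \<odot> x] = c \<odot>\<^bsub>U\<^esub> word [x]"
      using that rel2[of "Poly_Mapping.single [c \<odot> x] 1" "Poly_Mapping.single [x] c"]
      by (auto simp: uea_word_def U_simps uea_relations_def)
  qed
  note m = linear_mapD[OF mult_linear(1)] linear_mapD[OF mult_linear(2)]
  show ?thesis
    unfolding uea_compatible_def
  proof (intro conjI ballI allI word_closed)
    fix p q x y c assume pq: "p \<in> lists S" "q \<in> lists S" and xy: "x \<in> S" "y \<in> S"
    show "word (p @ (x \<oplus> y) # q) = word (p @ x # q) \<oplus>\<^bsub>U\<^esub> word (p @ y # q)"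
      using pq xy by (simp add: split w1 m)
    have "word (p @ x # y # q) = word p \<otimes>\<^bsub>U\<^esub> (word [x, y] \<otimes>\<^bsub>U\<^esub> word q)"
      "word (p @ y # x # q) = word p \<otimes>\<^bsub>U\<^esub> (word [y, x] \<otimes>\<^bsub>U\<^esub> word q)"
      using pq xy by (simp_all add: word_append)
    then show "word (p @ x # y # q) = word (p @ y # x # q) \<oplus>\<^bsub>U\<^esub> word (p @ bracket \<gg> x y # q)"
      using pq xy by (simp add: split w1(3)[OF xy] m)
  next
    fix p q x c assume pq: "p \<in> lists S" "q \<in> lists S" and x: "x \<in> S"
    show "word (p @ (c \<odot> x) # q) = c \<odot>\<^bsub>U\<^esub> word (p @ x # q)"
      using pq x by (simp add: split w1(2)[OF x x] m)
  qed
qed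

lemma word_singleton_linear: "linear_map \<gg> U (\<lambda>x. word [x])"
proof (rule linear_mapI)
  note D = uea_compatibleD[OF word_compatible]
  show "word [x \<oplus> y] = word [x] \<oplus>\<^bsub>U\<^esub> word [y]" if "x \<in> S" "y \<in> S" for x y
    using D(2)[of "[]" "[]"] that by simp
  show "word [c \<odot> x] = c \<odot>\<^bsub>U\<^esub> word [x]" if "x \<in> S" for c x
    using D(3)[of "[]" "[]"] that by simp
qed simp

end

section \<open>The bialgebra structure of the enveloping algebra\<close>

lemma linearI: "\<lbrakk>vspace V; vspace W; linear_map V W f\<rbrakk> \<Longrightarrow> linear V W f"
  by (simp add: linear.intro linear_axioms.intro)

lemma linear_map_unshuffle:
  assumes "vspace W" "w \<in> lists S"
    "\<And>u v. \<lbrakk>u \<in> lists S; v \<in> lists S\<rbrakk> \<Longrightarrow> linear_map V W (\<lambda>x. F x u v)"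
  shows "linear_map V W (\<lambda>x. unshuffle W w (F x))"
  using assms(2,3)
proof (induction w arbitrary: F rule: list.induct)
  case (Cons x w)
  then show ?case by (simp, intro linear_map_add[OF assms(1)] Cons.IH) auto
qed simp

lemma linear_map_derive_word:
  assumes "vspace W" "w \<in> lists S" "d \<in> S \<rightarrow> S"
    "\<And>u. \<lbrakk>u \<in> lists S; length u = length w\<rbrakk> \<Longrightarrow> linear_map V W (\<lambda>x. F x u)"
  shows "linear_map V W (\<lambda>x. derive_word W d w (F x))"
  using assms(2,4)
proof (induction w arbitrary: F rule: list.induct)
  case (Cons x w)
  have "d x \<in> S" using Cons.prems(1) assms(3) by auto
  with Cons show ?case by (simp, intro linear_map_add[OF assms(1)] Cons.IH) auto
qed (simp add: linear_map_zero_fun assms(1))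

context post_lie_algebra
begin

text \<open>The hypotheses make \<rho> a representation of the Lie algebra on V, through which words
  act on the vector v0. It is used for left multiplication by \<open>\<delta> x\<close> on the
  tensor square and by \<open>\<phi> x\<close> on a D-bialgebra.\<close>

lemma foldr_compatible:
  assumes V: "vspace V" and v0: "v0 \<in> carrier V"
    and lin: "\<And>x. x \<in> S \<Longrightarrow> linear_map V V (\<rho> x)"
    and lin': "\<And>v. v \<in> carrier V \<Longrightarrow> linear_map \<gg> V (\<lambda>x. \<rho> x v)"
    and comm: "\<And>x y v. \<lbrakk>x \<in> S; y \<in> S; v \<in> carrier V\<rbrakk> \<Longrightarrow>
      \<rho> x (\<rho> y v) = \<rho> y (\<rho> x v) \<oplus>\<^bsub>V\<^esub> \<rho> (bracket \<gg> x y) v"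
  shows "uea_compatible \<gg> V (\<lambda>w. foldr \<rho> w v0)"
proof -
  have closed: "foldr \<rho> w v \<in> carrier V" if "w \<in> lists S" "v \<in> carrier V" for w v
    using that by (induction w rule: list.induct) (auto simp: linear_mapD[OF lin])
  have linw: "linear_map V V (foldr \<rho> w)" if "w \<in> lists S" for w
    using that
  proof (induction w rule: list.induct)
    case Nil
    show ?case by (simp add: linear_map_def)
  next
    case (Cons x w)
    then show ?case using linear_map_compose[of V V "foldr \<rho> w" V "\<rho> x"] lin by (simp add: comp_def)
  qed
  note D = linear_mapD[OF linw] linear_mapD[OF lin] linear_mapD[OF lin']
  show ?thesis
    unfolding uea_compatible_def
  proof (intro conjI ballI allI)
    fix p q x y assume pq: "p \<in> lists S" "q \<in> lists S" and xy: "x \<in> S" "y \<in> S"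
    show "foldr \<rho> (p @ (x \<oplus> y) # q) v0 = foldr \<rho> (p @ x # q) v0 \<oplus>\<^bsub>V\<^esub> foldr \<rho> (p @ y # q) v0"
      using pq xy closed[OF pq(2) v0] by (simp add: D)
    show "foldr \<rho> (p @ x # y # q) v0 =
        foldr \<rho> (p @ y # x # q) v0 \<oplus>\<^bsub>V\<^esub> foldr \<rho> (p @ bracket \<gg> x y # q) v0"
      using pq xy closed[OF pq(2) v0] by (simp add: comm[of x y] D)
  qed (use v0 closed D in simp_all)
qed

sublocale T: tensor_product U U by (rule tensor_productI) (rule U.vspace_axioms)+

abbreviation "UU \<equiv> tensor U U"
abbreviation pure (infixr "\<oslash>" 75) where "x \<oslash> y \<equiv> pure_tensor U U x y"
abbreviation tmult where "tmult \<equiv> tensor_op U (monoid.mult U)"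

sublocale UU: vspace UU by (rule T.vspace_tensor)

lemma pure_closed [simp]: "\<lbrakk>x \<in> carrier U; y \<in> carrier U\<rbrakk> \<Longrightarrow> x \<oslash> y \<in> carrier UU"
  by (rule T.pure_closed)

lemma pure_linear: "x \<in> carrier U \<Longrightarrow> linear_map U UU (\<lambda>y. x \<oslash> y)"
  "y \<in> carrier U \<Longrightarrow> linear_map U UU (\<lambda>x. x \<oslash> y)"
  using bilinear_mapD[OF T.pure_bilinear] by auto

lemma tmult_bilinear: "bilinear_map UU UU UU tmult"
  by (rule tensor_op_bilinear(1)[OF U.vspace_axioms mult_bilinear])

lemma tmult_pure [simp]:
  "\<lbrakk>x \<in> carrier U; y \<in> carrier U; x' \<in> carrier U; y' \<in> carrier U\<rbrakk> \<Longrightarrow>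
    tmult (x \<oslash> y) (x' \<oslash> y') = (x \<otimes>\<^bsub>U\<^esub> x') \<oslash> (y \<otimes>\<^bsub>U\<^esub> y')"
  by (rule tensor_op_bilinear(2)[OF U.vspace_axioms mult_bilinear])

lemma tmult_closed [simp]: "\<lbrakk>s \<in> carrier UU; t \<in> carrier UU\<rbrakk> \<Longrightarrow> tmult s t \<in> carrier UU"
  using linear_mapD(1)[OF bilinear_mapD(1)[OF tmult_bilinear]] .

lemmas tmult_add_left = linear_mapD(2)[OF bilinear_mapD(2)[OF tmult_bilinear]]
lemmas tmult_add_right = linear_mapD(2)[OF bilinear_mapD(1)[OF tmult_bilinear]]

abbreviation \<delta> where "\<delta> x \<equiv> word [x] \<oslash> \<one>\<^bsub>U\<^esub> \<oplus>\<^bsub>UU\<^esub> \<one>\<^bsub>U\<^esub> \<oslash> word [x]"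

lemma delta_linear: "linear_map \<gg> UU \<delta>"
  by (intro linear_map_add UU.vspace_axioms linear_map_compose[OF word_singleton_linear pure_linear(1)]
      linear_map_compose[OF word_singleton_linear pure_linear(2)]) auto

lemma word_Cons: "\<lbrakk>x \<in> S; w \<in> lists S\<rbrakk> \<Longrightarrow> word [x] \<otimes>\<^bsub>U\<^esub> word w = word (x # w)"
  by (simp add: word_append)

lemma delta_pure:
  "\<lbrakk>x \<in> S; a \<in> carrier U; b \<in> carrier U\<rbrakk> \<Longrightarrow>
    tmult (\<delta> x) (a \<oslash> b) = (word [x] \<otimes>\<^bsub>U\<^esub> a) \<oslash> b \<oplus>\<^bsub>UU\<^esub> a \<oslash> (word [x] \<otimes>\<^bsub>U\<^esub> b)"
  by (simp add: tmult_add_left)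

lemma word_bracket:
  assumes "x \<in> S" "y \<in> S" "a \<in> carrier U"
  shows "word [x] \<otimes>\<^bsub>U\<^esub> (word [y] \<otimes>\<^bsub>U\<^esub> a) =
    word [y] \<otimes>\<^bsub>U\<^esub> (word [x] \<otimes>\<^bsub>U\<^esub> a) \<oplus>\<^bsub>U\<^esub> word [bracket \<gg> x y] \<otimes>\<^bsub>U\<^esub> a"
proof -
  have "word [x, y] = word [y, x] \<oplus>\<^bsub>U\<^esub> word [bracket \<gg> x y]"
    using uea_compatibleD(4)[OF word_compatible, of "[]" "[]" x y] assms by simp
  then have "word [x] \<otimes>\<^bsub>U\<^esub> word [y] = word [y] \<otimes>\<^bsub>U\<^esub> word [x] \<oplus>\<^bsub>U\<^esub> word [bracket \<gg> x y]"
    using assms by (simp add: word_Cons)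
  then have "(word [x] \<otimes>\<^bsub>U\<^esub> word [y]) \<otimes>\<^bsub>U\<^esub> a =
      (word [y] \<otimes>\<^bsub>U\<^esub> word [x] \<oplus>\<^bsub>U\<^esub> word [bracket \<gg> x y]) \<otimes>\<^bsub>U\<^esub> a"
    by simp
  then show ?thesis using assms by (simp add: U.l_distr U.m_assoc)
qed

text \<open>Expanding the product of the factors \<open>\<delta> x\<close>, each letter is placed
  left or right: this is where unshuffles come from.\<close>

lemma comult_foldr:
  assumes "w \<in> lists S"
  shows "foldr (\<lambda>x. tmult (\<delta> x)) w (\<one>\<^bsub>U\<^esub> \<oslash> \<one>\<^bsub>U\<^esub>) = unshuffle UU w (\<lambda>u v. word u \<oslash> word v)"
  using assms
proof (induction w rule: list.induct)
  case Nil
  show ?case by (simp add: word_Nil)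
next
  case (Cons x w)
  then have x: "x \<in> S" and w: "w \<in> lists S" by auto
  have d: "\<delta> x \<in> carrier UU" using x by simp
  have "tmult (\<delta> x) (unshuffle UU w (\<lambda>u v. word u \<oslash> word v)) =
      unshuffle UU w (\<lambda>u v. tmult (\<delta> x) (word u \<oslash> word v))"
    using w by (intro linear.unshuffle[OF linearI[OF UU.vspace_axioms UU.vspace_axioms
          bilinear_mapD(1)[OF tmult_bilinear d]], where S = S]) simp_all
  also have "\<dots> = unshuffle UU w (\<lambda>u v. word (x # u) \<oslash> word v \<oplus>\<^bsub>UU\<^esub> word u \<oslash> word (x # v))"
    using w x by (intro unshuffle_cong[where S = S]) (simp_all add: delta_pure word_Cons del: tmult_pure)
  also have "\<dots> = unshuffle UU (x # w) (\<lambda>u v. word u \<oslash> word v)"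
    using w x by (simp add: UU.unshuffle_add[where S = S])
  finally show ?case using Cons.IH w by simp
qed

text \<open>The elements \<open>\<delta> x\<close> satisfy the bracket relations: in the commutator
  of \<open>\<delta> x\<close> and \<open>\<delta> y\<close> the mixed terms cancel, as the two
  tensor factors commute with each other. This is verified on pure tensors.\<close>

lemma comult_compatible: "uea_compatible \<gg> UU (\<lambda>w. foldr (\<lambda>x. tmult (\<delta> x)) w (\<one>\<^bsub>U\<^esub> \<oslash> \<one>\<^bsub>U\<^esub>))"
proof (rule foldr_compatible[OF UU.vspace_axioms])
  note lin = bilinear_mapD[OF tmult_bilinear]
  show "\<one>\<^bsub>U\<^esub> \<oslash> \<one>\<^bsub>U\<^esub> \<in> carrier UU" by simp
  show lin1: "linear_map UU UU (tmult (\<delta> x))" if "x \<in> S" for x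
    using that by (intro lin(1)) simp
  show "linear_map \<gg> UU (\<lambda>x. tmult (\<delta> x) t)" if "t \<in> carrier UU" for t
    by (rule linear_map_compose[OF delta_linear lin(2)[OF that]])
  fix x y t assume xy: "x \<in> S" "y \<in> S" and t: "t \<in> carrier UU"
  show "tmult (\<delta> x) (tmult (\<delta> y) t) = tmult (\<delta> y) (tmult (\<delta> x) t) \<oplus>\<^bsub>UU\<^esub> tmult (\<delta> (bracket \<gg> x y)) t"
  proof (rule T.tensor_ext[OF UU.vspace_axioms _ _ _ t])
    show "linear_map UU UU (\<lambda>t. tmult (\<delta> x) (tmult (\<delta> y) t))"
      by (rule linear_map_compose[OF lin1[OF xy(2)] lin1[OF xy(1)]])
    show "linear_map UU UU (\<lambda>t. tmult (\<delta> y) (tmult (\<delta> x) t) \<oplus>\<^bsub>UU\<^esub> tmult (\<delta> (bracket \<gg> x y)) t)"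
      by (intro linear_map_add UU.vspace_axioms linear_map_compose[OF lin1[OF xy(1)] lin1[OF xy(2)]] lin1)
        (use xy in simp)
    fix a b assume ab: "a \<in> carrier U" "b \<in> carrier U"
    note [simp] = linear_mapD(2)[OF pure_linear(1)] linear_mapD(2)[OF pure_linear(2)]
    have [simp]: "\<delta> x \<in> carrier UU" "\<delta> y \<in> carrier UU" "\<delta> (bracket \<gg> x y) \<in> carrier UU"
      using xy by simp_all
    show "tmult (\<delta> x) (tmult (\<delta> y) (a \<oslash> b)) =
        tmult (\<delta> y) (tmult (\<delta> x) (a \<oslash> b)) \<oplus>\<^bsub>UU\<^esub> tmult (\<delta> (bracket \<gg> x y)) (a \<oslash> b)"
      using xy ab by (simp add: tmult_add_left tmult_add_right word_bracket[of x y] UU.a_ac)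
  qed
qed

lemma comult_induced:
  "comult U = induced_map UU (\<lambda>w. foldr (\<lambda>x. tmult (\<delta> x)) w (\<one>\<^bsub>U\<^esub> \<oslash> \<one>\<^bsub>U\<^esub>))"
  by (simp add: fun_eq_iff UEA_simps uea_comult_def Let_def uea_algebra_to_UEA flip: UEA_simps(2,3))

lemma comult_linear: "linear_map U UU (comult U)"
  unfolding comult_induced by (rule uea_lift_linear[OF UU.vspace_axioms comult_compatible])

lemma comult_word:
  "w \<in> lists S \<Longrightarrow> comult U (word w) = unshuffle UU w (\<lambda>u v. word u \<oslash> word v)"
  unfolding comult_induced
  by (simp add: uea_lift_word[OF UU.vspace_axioms comult_compatible] comult_foldr)

lemma comult_closed [simp]: "u \<in> carrier U \<Longrightarrow> comult U u \<in> carrier UU"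
  using linear_mapD(1)[OF comult_linear] .

lemma lift_comult_linear:
  "\<lbrakk>vspace Z; bilinear_map U U Z b\<rbrakk> \<Longrightarrow> linear_map U Z (\<lambda>u. tensor_lift Z b (comult U u))"
  by (rule linear_map_compose[OF comult_linear T.tensor_lift_linear])

lemma lift_comult_word:
  assumes Z: "vspace Z" and b: "bilinear_map U U Z b" and w: "w \<in> lists S"
  shows "tensor_lift Z b (comult U (word w)) = unshuffle Z w (\<lambda>u v. b (word u) (word v))"
proof -
  have "tensor_lift Z b (comult U (word w)) = unshuffle Z w (\<lambda>u v. tensor_lift Z b (word u \<oslash> word v))"
    unfolding comult_word[OF w] using w
    by (intro linear.unshuffle[OF linearI[OF UU.vspace_axioms Z T.tensor_lift_linear[OF Z b]], where S = S])
      simp_all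
  also have "\<dots> = unshuffle Z w (\<lambda>u v. b (word u) (word v))"
    using w by (intro unshuffle_cong[where S = S]) (simp_all add: T.tensor_lift_pure[OF Z b])
  finally show ?thesis .
qed

section \<open>The counit and the bialgebra axioms\<close>

lemma lookup_Nil_ideal:
  assumes "n \<in> uea_ideal \<gg>" shows "Poly_Mapping.lookup n [] = 0"
proof -
  define K where "K = {f \<in> carrier F. Poly_Mapping.lookup f [] = 0}"
  have "submodule K (base_field :: 'k ring) F"
    using F.zero_closed F.a_closed F.smult_closed
    by (intro F.submoduleI) (auto simp: K_def free_algebra_simps(2-4) lookup_add)
  then have "subgroup K (add_monoid F)" by (rule submodule.axioms(1))
  then have "ideal K F"
    by (intro idealI F.ring_axioms) (auto simp: K_def lookup_Nil_free_algebra_mult)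
  moreover have "uea_relations \<gg> \<subseteq> {f. Poly_Mapping.lookup f [] = 0}"
    by (auto simp: uea_relations_def lookup_minus lookup_single when_def)
  then have "uea_relations \<gg> \<subseteq> K"
    using relations_closed by (auto simp: K_def)
  ultimately have "uea_ideal \<gg> \<subseteq> K" unfolding uea_ideal_def by (rule F.genideal_minimal)
  with assms show ?thesis by (auto simp: K_def)
qed

lemma counit_coset: "f \<in> carrier F \<Longrightarrow> counit U (\<pi> f) = Poly_Mapping.lookup f []"
  using Q.some_in_coset[of f] lookup_Nil_ideal[of "(SOME h. h \<in> \<pi> f) \<ominus>\<^bsub>F\<^esub> f"]
  by (simp add: UEA_simps uea_counit_def lookup_minus flip: F_minus)

lemma counit_word: "w \<in> lists S \<Longrightarrow> counit U (word w) = (if w = [] then 1 else 0)"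
  by (simp add: uea_word_def counit_coset lookup_single when_def)

lemma counit_simps:
  "\<lbrakk>x \<in> carrier U; y \<in> carrier U\<rbrakk> \<Longrightarrow> counit U (x \<oplus>\<^bsub>U\<^esub> y) = counit U x + counit U y"
  "x \<in> carrier U \<Longrightarrow> counit U (c \<odot>\<^bsub>U\<^esub> x) = c * counit U x"
  "\<lbrakk>x \<in> carrier U; y \<in> carrier U\<rbrakk> \<Longrightarrow> counit U (x \<otimes>\<^bsub>U\<^esub> y) = counit U x * counit U y"
  using F.a_closed F.smult_closed
  by (auto simp: U_simps(1,3,4,5) counit_coset lookup_add lookup_Nil_free_algebra_mult
      free_algebra_mult_closed free_algebra_simps(3,4))

lemma counit_smult_linear: "b \<in> carrier U \<Longrightarrow> linear_map U U (\<lambda>a. counit U a \<odot>\<^bsub>U\<^esub> b)"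
  by (rule linear_mapI) (auto simp: counit_simps U.smult_l_distr U.smult_smult)

lemma counit_bilinear: "bilinear_map U U U (\<lambda>a b. counit U a \<odot>\<^bsub>U\<^esub> b)"
  by (intro bilinear_mapI linear_map_smult U.vspace_axioms linear_map_id counit_smult_linear)

lemma counit_left: "x \<in> carrier U \<Longrightarrow> tensor_lift U (\<lambda>a b. counit U a \<odot>\<^bsub>U\<^esub> b) (comult U x) = x"
proof (rule uea_ext[OF lift_comult_linear[OF U.vspace_axioms counit_bilinear] linear_map_id])
  fix w assume w: "w \<in> lists S"
  have "unshuffle U w (\<lambda>u v. counit U (word u) \<odot>\<^bsub>U\<^esub> word v) =
      unshuffle U w (\<lambda>u v. if u = [] then word v else \<zero>\<^bsub>U\<^esub>)"
    using w by (intro unshuffle_cong[where S = S]) (simp_all add: counit_word)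
  with w show "tensor_lift U (\<lambda>a b. counit U a \<odot>\<^bsub>U\<^esub> b) (comult U (word w)) = word w"
    by (simp add: lift_comult_word[OF U.vspace_axioms counit_bilinear] U.unshuffle_counit_left[where S = S])
qed

lemma counit_right: "x \<in> carrier U \<Longrightarrow> tensor_lift U (\<lambda>a b. counit U b \<odot>\<^bsub>U\<^esub> a) (comult U x) = x"
proof (rule uea_ext[OF lift_comult_linear[OF U.vspace_axioms bilinear_map_swap[OF counit_bilinear]] linear_map_id])
  fix w assume w: "w \<in> lists S"
  have "unshuffle U w (\<lambda>u v. counit U (word v) \<odot>\<^bsub>U\<^esub> word u) =
      unshuffle U w (\<lambda>u v. if v = [] then word u else \<zero>\<^bsub>U\<^esub>)"
    using w by (intro unshuffle_cong[where S = S]) (simp_all add: counit_word)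
  with w show "tensor_lift U (\<lambda>a b. counit U b \<odot>\<^bsub>U\<^esub> a) (comult U (word w)) = word w"
    by (simp add: lift_comult_word[OF U.vspace_axioms bilinear_map_swap[OF counit_bilinear]]
        U.unshuffle_counit_right[where S = S])
qed

text \<open>Stated for an arbitrary bilinear m because it serves twice: for the product, where it
  shows that the coproduct is multiplicative, and for \<triangleright> in (D3).\<close>

lemma tensor_op_comult_word:
  assumes m: "bilinear_map U U U m" and w [simp]: "w \<in> lists S" "w' \<in> lists S"
  shows "tensor_op U m (comult U (word w)) (comult U (word w')) =
    unshuffle UU w (\<lambda>u v. unshuffle UU w' (\<lambda>u' v'. m (word u) (word u') \<oslash> m (word v) (word v')))"
proof -
  note op = tensor_op_bilinear[OF U.vspace_axioms m]
  note lin = bilinear_mapD[OF op(1)]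
  have "tensor_op U m (comult U (word w)) (comult U (word w')) =
      unshuffle UU w (\<lambda>u v. tensor_op U m (word u \<oslash> word v) (comult U (word w')))"
    unfolding comult_word[OF w(1)]
    by (intro linear.unshuffle[OF linearI[OF UU.vspace_axioms UU.vspace_axioms lin(2)], where S = S]) simp_all
  also have "\<dots> = unshuffle UU w (\<lambda>u v. unshuffle UU w' (\<lambda>u' v'. m (word u) (word u') \<oslash> m (word v) (word v')))"
  proof (rule unshuffle_cong[where S = S])
    fix u v assume [simp]: "u \<in> lists S" "v \<in> lists S"
    have "tensor_op U m (word u \<oslash> word v) (comult U (word w')) =
        unshuffle UU w' (\<lambda>u' v'. tensor_op U m (word u \<oslash> word v) (word u' \<oslash> word v'))"
      unfolding comult_word[OF w(2)]
      by (intro linear.unshuffle[OF linearI[OF UU.vspace_axioms UU.vspace_axioms lin(1)], where S = S]) simp_all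
    also have "\<dots> = unshuffle UU w' (\<lambda>u' v'. m (word u) (word u') \<oslash> m (word v) (word v'))"
      by (intro unshuffle_cong[where S = S]) (simp_all add: op(2))
    finally show "tensor_op U m (word u \<oslash> word v) (comult U (word w')) = \<dots>" .
  qed simp
  finally show ?thesis .
qed

lemma comult_mult:
  assumes "x \<in> carrier U" "y \<in> carrier U"
  shows "comult U (x \<otimes>\<^bsub>U\<^esub> y) = tmult (comult U x) (comult U y)"
proof (rule uea_ext2[OF bilinear_map_linear[OF mult_bilinear comult_linear]
      bilinear_map_compose[OF tmult_bilinear comult_linear comult_linear] _ assms])
  fix w w' assume [simp]: "w \<in> lists S" "w' \<in> lists S"
  show "comult U (word w \<otimes>\<^bsub>U\<^esub> word w') = tmult (comult U (word w)) (comult U (word w'))"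
    unfolding tensor_op_comult_word[OF mult_bilinear \<open>w \<in> lists S\<close> \<open>w' \<in> lists S\<close>]
    by (simp add: word_append comult_word UU.unshuffle_append[where S = S],
        intro unshuffle_cong[where S = S]) (simp_all add: word_append)
qed

lemma coassoc:
  assumes "x \<in> carrier U"
  shows "tensor_lift (tensor U UU)
      (\<lambda>a b. tensor_lift (tensor U UU) (\<lambda>a\<^sub>1 a\<^sub>2. pure_tensor U UU a\<^sub>1 (a\<^sub>2 \<oslash> b)) (comult U a)) (comult U x) =
    tensor_lift (tensor U UU) (\<lambda>a b. pure_tensor U UU a (comult U b)) (comult U x)"
proof -
  interpret T3: tensor_product U UU by (rule tensor_productI[OF U.vspace_axioms UU.vspace_axioms])
  let ?Z = "tensor U UU"
  have Z: "vspace ?Z" by (rule T3.vspace_tensor)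
  have p: "bilinear_map U U ?Z (\<lambda>a\<^sub>1 a\<^sub>2. pure_tensor U UU a\<^sub>1 (a\<^sub>2 \<oslash> b))" if "b \<in> carrier U" for b
    using that by (intro bilinear_map_compose[OF T3.pure_bilinear linear_map_id] pure_linear)
  have l: "bilinear_map U U ?Z
      (\<lambda>a b. tensor_lift ?Z (\<lambda>a\<^sub>1 a\<^sub>2. pure_tensor U UU a\<^sub>1 (a\<^sub>2 \<oslash> b)) (comult U a))"
    by (intro bilinear_mapI lift_comult_linear p Z T.tensor_lift_param U.vspace_axioms comult_closed
        linear_map_compose[OF pure_linear(1) bilinear_mapD(1)[OF T3.pure_bilinear]])
  have r: "bilinear_map U U ?Z (\<lambda>a b. pure_tensor U UU a (comult U b))"
    by (rule bilinear_map_compose[OF T3.pure_bilinear linear_map_id comult_linear])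
  show ?thesis
  proof (rule uea_ext[OF lift_comult_linear[OF Z l] lift_comult_linear[OF Z r] _ assms])
    fix w assume w: "w \<in> lists S"
    have "unshuffle ?Z w (\<lambda>u v. tensor_lift ?Z (\<lambda>a\<^sub>1 a\<^sub>2. pure_tensor U UU a\<^sub>1 (a\<^sub>2 \<oslash> word v)) (comult U (word u))) =
        unshuffle ?Z w (\<lambda>u v. unshuffle ?Z u (\<lambda>a b. pure_tensor U UU (word a) (word b \<oslash> word v)))"
      using w by (intro unshuffle_cong[where S = S] lift_comult_word Z p) simp_all
    also have "\<dots> = unshuffle ?Z w (\<lambda>u v. unshuffle ?Z v (\<lambda>a b. pure_tensor U UU (word u) (word a \<oslash> word b)))"
      using w by (intro vspace.unshuffle_coassoc[OF Z, where S = S]) (simp_all add: T3.pure_closed)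
    also have "\<dots> = unshuffle ?Z w (\<lambda>u v. pure_tensor U UU (word u) (comult U (word v)))"
      using w
      by (intro unshuffle_cong[where S = S], simp, subst comult_word, simp)
        (intro linear.unshuffle[OF linearI[OF UU.vspace_axioms Z bilinear_mapD(1)[OF T3.pure_bilinear]],
            where S = S, symmetric], simp_all)
    finally show "tensor_lift ?Z (\<lambda>a b. tensor_lift ?Z (\<lambda>a\<^sub>1 a\<^sub>2. pure_tensor U UU a\<^sub>1 (a\<^sub>2 \<oslash> b)) (comult U a))
          (comult U (word w)) =
        tensor_lift ?Z (\<lambda>a b. pure_tensor U UU a (comult U b)) (comult U (word w))"
      using w by (simp add: lift_comult_word[OF Z l] lift_comult_word[OF Z r])
  qed
qed

lemma bialgebra_UEA: "bialgebra U"
proof (intro bialgebra.intro bialgebra_axioms.intro)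
  show "module (base_field :: 'k ring) U" by (rule U.module_axioms)
  show "ring U" by (rule U.ring_axioms)
  show "comult U \<one>\<^bsub>U\<^esub> = \<one>\<^bsub>U\<^esub> \<oslash> \<one>\<^bsub>U\<^esub>"
    using comult_word[of "[]"] by (simp add: word_Nil)
  show "counit U \<one>\<^bsub>U\<^esub> = 1"
    using counit_word[of "[]"] by (simp add: word_Nil)
qed (simp_all add: linear_mapD[OF mult_linear(1)] linear_mapD[OF mult_linear(2)] comult_linear
    counit_simps coassoc counit_left counit_right comult_mult)

end

section \<open>The action of the enveloping algebra\<close>

text \<open>Here the parameter enters through the derivation \<open>d x\<close>, so linearity of F
  is required at every position of a word. The length restriction matches the induction hypothesis
  in \<open>T_linear_position\<close>.\<close>

lemma linear_map_derive_word_param: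
  assumes V: "vspace V" and q: "q \<in> lists S"
    and F: "\<And>p r. \<lbrakk>p \<in> lists S; r \<in> lists S; Suc (length p + length r) = length q\<rbrakk>
      \<Longrightarrow> linear_map Y V (\<lambda>x. F (p @ x # r))"
    and d: "\<And>z. z \<in> S \<Longrightarrow> linear_map W Y (\<lambda>x. d x z)"
  shows "linear_map W V (\<lambda>x. derive_word V (d x) q F)"
  using q F
proof (induction q arbitrary: F rule: list.induct)
  case Nil
  show ?case by (simp add: linear_map_zero_fun V)
next
  case (Cons z q)
  then have z: "z \<in> S" and q: "q \<in> lists S" by auto
  have "linear_map W V (\<lambda>x. F (d x z # q))"
    using linear_map_compose[OF d[OF z] Cons.prems(2)[of "[]" q]] q by simp
  moreover have "linear_map W V (\<lambda>x. derive_word V (d x) q (\<lambda>v. F (z # v)))"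
  proof (rule Cons.IH[OF q])
    show "linear_map Y V (\<lambda>x. F (z # p @ x # r))"
      if "p \<in> lists S" "r \<in> lists S" "Suc (length p + length r) = length q" for p r
      using Cons.prems(2)[of "z # p" r] that z by simp
  qed
  ultimately show ?case by (simp add: linear_map_add V)
qed

lemma derive_word_fun_cong:
  assumes "w \<in> lists S" "\<And>s. s \<in> S \<Longrightarrow> d s = e s"
  shows "derive_word V d w F = derive_word V e w F"
  using assms by (induction w arbitrary: F rule: list.induct) simp_all

context vspace
begin

lemma derive_word_fun_add:
  assumes "w \<in> lists S" "d \<in> S \<rightarrow> S" "e \<in> S \<rightarrow> S" "\<And>u. u \<in> lists S \<Longrightarrow> F u \<in> carrier V"
    "\<And>p r a b. \<lbrakk>p \<in> lists S; r \<in> lists S; a \<in> S; b \<in> S\<rbrakk> \<Longrightarrow>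
      F (p @ f a b # r) = F (p @ a # r) \<oplus> F (p @ b # r)"
  shows "derive_word V (\<lambda>s. f (d s) (e s)) w F = derive_word V d w F \<oplus> derive_word V e w F"
  using assms(1,4,5)
proof (induction w arbitrary: F rule: list.induct)
  case (Cons c w)
  then have c: "c \<in> S" "w \<in> lists S" "d c \<in> S" "e c \<in> S" using assms(2,3) by auto
  have "derive_word V (\<lambda>s. f (d s) (e s)) w (\<lambda>v. F (c # v)) =
      derive_word V d w (\<lambda>v. F (c # v)) \<oplus> derive_word V e w (\<lambda>v. F (c # v))"
    using Cons.prems(2) Cons.prems(3)[of "c # _"] c by (intro Cons.IH) simp_all
  moreover have "F (f (d c) (e c) # w) = F (d c # w) \<oplus> F (e c # w)"
    using Cons.prems(3)[of "[]" w] c by simp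
  moreover have "derive_word V d w (\<lambda>v. F (c # v)) \<in> carrier V"
    "derive_word V e w (\<lambda>v. F (c # v)) \<in> carrier V"
    using c Cons.prems(2) assms(2,3) by (simp_all add: derive_word_closed[where S = S])
  ultimately show ?case using c Cons.prems(2) by (simp add: a_ac)
qed simp

text \<open>Both sides equal the sum over ordered pairs of distinct positions plus the two
  composites applied to a single letter. This is the commutator rule for derivations, arranged so as
  to avoid minus signs.\<close>

lemma derive_word_commute:
  assumes "w \<in> lists S" "d \<in> S \<rightarrow> S" "e \<in> S \<rightarrow> S" "\<And>u. u \<in> lists S \<Longrightarrow> F u \<in> carrier V"
  shows "derive_word V d w (\<lambda>v. derive_word V e v F) \<oplus> derive_word V (\<lambda>z. d (e z)) w F =
    derive_word V e w (\<lambda>v. derive_word V d v F) \<oplus> derive_word V (\<lambda>z. e (d z)) w F"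
  using assms(1,4)
proof (induction w arbitrary: F rule: list.induct)
  case (Cons x w)
  then have S [simp]: "x \<in> S" "w \<in> lists S" "d x \<in> S" "e x \<in> S" "d (e x) \<in> S" "e (d x) \<in> S"
    using assms(2,3) by auto
  have ed: "(\<lambda>z. e (d z)) \<in> S \<rightarrow> S" "(\<lambda>z. d (e z)) \<in> S \<rightarrow> S" using assms(2,3) by auto
  note [simp] = derive_word_closed[where S = S] Cons.prems(2) assms(2,3) ed
  show ?case
    using Cons.IH[of "\<lambda>u. F (x # u)"]
      add.m_comm[of "derive_word V d w (\<lambda>v. derive_word V e v (\<lambda>v. F (x # v)))"
        "derive_word V (\<lambda>z. d (e z)) w (\<lambda>v. F (x # v))"]
    by (simp add: derive_word_add[where S = S] a_ac)
qed simp

end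

context post_lie_algebra
begin

section \<open>Well-definedness of T on words\<close>

abbreviation "T \<equiv> T_word \<gg>"

lemma tri_funcset [simp]: "x \<in> S \<Longrightarrow> tri \<gg> x \<in> S \<rightarrow> S"
  by simp

lemma list_update_in_lists: "\<lbrakk>w \<in> lists S; a \<in> S\<rbrakk> \<Longrightarrow> w[k := a] \<in> lists S"
  using set_update_subset_insert[of w k a] by (auto simp: in_lists_conv_set)

text \<open>Induction on the length and not on the list, since the recursion calls T on modified
  tails.\<close>

lemma T_closed [simp]: "\<lbrakk>w \<in> lists S; y \<in> S\<rbrakk> \<Longrightarrow> T w y \<in> S"
proof (induction "length w" arbitrary: w)
  case (Suc n)
  then obtain x w' where w: "w = x # w'" "x \<in> S" "w' \<in> lists S" "length w' = n" by (cases w) auto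
  have "T (w'[k := x \<triangleright> w' ! k]) y \<in> S" if "k < length w'" for k
    using that w Suc by (intro Suc.hyps(1) list_update_in_lists) (auto simp: in_lists_conv_set)
  then show ?case using w Suc by (auto intro!: M.minus_closed M.finsum_closed)
qed simp

lemma T_Cons:
  assumes "x \<in> S" "w \<in> lists S" "y \<in> S"
  shows "T (x # w) y = x \<triangleright> T w y \<ominus> derive_word \<gg> (tri \<gg> x) w (\<lambda>u. T u y)"
  using assms g.derive_word_conv_finsum[of w S "tri \<gg> x" "\<lambda>u. T u y"] by simp

lemma T_linear_right: "w \<in> lists S \<Longrightarrow> linear_map \<gg> \<gg> (T w)"
proof (induction "length w" arbitrary: w)
  case 0
  then show ?case by (simp add: linear_map_def)
next
  case (Suc n)
  then obtain x w' where w: "w = x # w'" "x \<in> S" "w' \<in> lists S" "length w' = n" by (cases w) auto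
  have "linear_map \<gg> \<gg> (\<lambda>y. x \<triangleright> T w' y \<ominus> derive_word \<gg> (tri \<gg> x) w' (\<lambda>u. T u y))"
    using w Suc
    by (intro linear_map_diff g.vspace_axioms linear_map_compose[OF _ tri_linear(1)]
        linear_map_derive_word[where S = S]) simp_all
  then show ?case
    by (rule linear_map_cong[OF g.vspace_axioms]) (use w in \<open>simp add: T_Cons del: T_word.simps\<close>)
qed

declare T_word.simps(2) [simp del]

text \<open>The letter x is involved in one of two ways: it is the head and acts on the letters of
  q, or it is one of the letters acted upon. Both cases refer to shorter words with the variable
  letter in any position, hence the induction on the total length.\<close>

lemma T_linear_position:
  assumes "p \<in> lists S" "q \<in> lists S" "z \<in> S"
  shows "linear_map \<gg> \<gg> (\<lambda>x. T (p @ x # q) z)"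
  using assms(1,2)
proof (induction "length p + length q" arbitrary: p q rule: less_induct)
  case less
  show ?case
  proof (cases p)
    case Nil
    have "linear_map \<gg> \<gg> (\<lambda>x. x \<triangleright> T q z \<ominus> derive_word \<gg> (tri \<gg> x) q (\<lambda>u. T u z))"
      using less.prems assms(3) less.hyps Nil
      by (intro linear_map_diff g.vspace_axioms tri_linear linear_map_derive_word_param[where S = S and Y = \<gg>])
        simp_all
    then show ?thesis
      by (rule linear_map_cong[OF g.vspace_axioms]) (use less.prems assms(3) Nil in \<open>simp add: T_Cons\<close>)
  next
    case (Cons a p')
    then have a [simp]: "a \<in> S" "p' \<in> lists S" using less.prems by auto
    note [simp] = less.prems(2) assms(3)
    let ?D = "\<lambda>w. derive_word \<gg> (tri \<gg> a) w"
    have IH: "linear_map \<gg> \<gg> (\<lambda>x. T (u @ x # v) z)"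
      if "u \<in> lists S" "v \<in> lists S" "length u = length p'" "length v = length q" for u v
      using that Cons by (intro less.hyps) simp_all
    \<comment> \<open>The derivative along a splits into the part before x, the part at x and the
      part after x.\<close>
    have "linear_map \<gg> \<gg> (\<lambda>x. a \<triangleright> T (p' @ x # q) z \<ominus>
        (?D p' (\<lambda>u. T (u @ x # q) z) \<oplus> (T (p' @ (a \<triangleright> x) # q) z \<oplus> ?D q (\<lambda>v. T (p' @ x # v) z))))"
      by (intro linear_map_diff linear_map_add g.vspace_axioms linear_map_compose[OF IH tri_linear(1)]
          linear_map_compose[OF tri_linear(1) IH] linear_map_derive_word[where S = S] IH) simp_all
    then show ?thesis
      by (rule linear_map_cong[OF g.vspace_axioms])
        (simp add: Cons T_Cons g.derive_word_append[where S = S])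
  qed
qed

text \<open>With x and y in front, expanding T twice leaves terms in which they act on
  \<open>T q z\<close> and on the letters of q. The axiom \<open>bracket_tri\<close> handles single
  actions, and terms with two derivations obey \<open>derive_word_commute\<close>. With a letter a
  in front, the identity for the tail is differentiated along a.\<close>

lemma T_bracket_word:
  assumes "p \<in> lists S" "q \<in> lists S" "x \<in> S" "y \<in> S" "z \<in> S"
  shows "T (p @ x # y # q) z = T (p @ y # x # q) z \<oplus> T (p @ bracket \<gg> x y # q) z"
  using assms(1-4)
proof (induction "length p" arbitrary: p q x y)
  case 0
  note [simp] = assms(5) 0(3-5)
  let ?t = "T q z" and ?F = "\<lambda>u. T u z"
  let ?D = "\<lambda>x. derive_word \<gg> (tri \<gg> x) q ?F"
  let ?DD = "\<lambda>x y. derive_word \<gg> (tri \<gg> x) q (\<lambda>v. derive_word \<gg> (tri \<gg> y) v ?F)"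
  let ?E = "\<lambda>x y. derive_word \<gg> (\<lambda>s. x \<triangleright> (y \<triangleright> s)) q ?F"
  have [simp]: "?D x \<in> S" if "x \<in> S" for x
    using that by (intro g.derive_word_closed[where S = S]) simp_all
  have [simp]: "?E x y \<in> S" "?DD x y \<in> S" if "x \<in> S" "y \<in> S" for x y
    using that by (auto intro!: g.derive_word_closed[where S = S])
  have dlin: "derive_word \<gg> (\<lambda>s. d s \<oplus> e s) q ?F = derive_word \<gg> d q ?F \<oplus> derive_word \<gg> e q ?F"
    if "d \<in> S \<rightarrow> S" "e \<in> S \<rightarrow> S" for d e
    using that linear_mapD(2)[OF T_linear_position]
    by (intro g.derive_word_fun_add[where S = S]) simp_all
  \<comment> \<open>The axiom \<open>bracket_tri\<close> with the associators expanded and every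
    term moved to the side where it is positive.\<close>
  have act: "bracket \<gg> x y \<triangleright> s \<oplus> ((x \<triangleright> y) \<triangleright> s \<oplus> y \<triangleright> (x \<triangleright> s)) = x \<triangleright> (y \<triangleright> s) \<oplus> (y \<triangleright> x) \<triangleright> s"
    if "s \<in> S" for s
    using that by (simp add: bracket_tri tri_assoc_def g.diff_simps M.a_ac)
  \<comment> \<open>The same identity for the derivations of q that the acting elements induce, by
    additivity of \<open>derive_word\<close> in the derivation.\<close>
  have dd: "?D (bracket \<gg> x y) \<oplus> (?D (x \<triangleright> y) \<oplus> ?E y x) = ?E x y \<oplus> ?D (y \<triangleright> x)"
  proof -
    have "?D (bracket \<gg> x y) \<oplus> (?D (x \<triangleright> y) \<oplus> ?E y x) =
        derive_word \<gg> (\<lambda>s. bracket \<gg> x y \<triangleright> s \<oplus> ((x \<triangleright> y) \<triangleright> s \<oplus> y \<triangleright> (x \<triangleright> s))) q ?F"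
      by (subst dlin, simp, simp, subst dlin) simp_all
    also have "\<dots> = derive_word \<gg> (\<lambda>s. x \<triangleright> (y \<triangleright> s) \<oplus> (y \<triangleright> x) \<triangleright> s) q ?F"
      using act 0(3) by (rule derive_word_fun_cong[rotated])
    also have "\<dots> = ?E x y \<oplus> ?D (y \<triangleright> x)"
      by (subst dlin) simp_all
    finally show ?thesis .
  qed
  have comm: "?DD x y \<oplus> ?E x y = ?DD y x \<oplus> ?E y x"
    by (rule g.derive_word_commute[where S = S]) simp_all
  \<comment> \<open>Two steps of the recursion. The derivative of \<open>y # q\<close> along x has,
    besides the terms for q, one for the letter y itself, which becomes
    \<open>x \<triangleright> y\<close>.\<close>
  have TT: "T (x # y # q) z = (x \<triangleright> (y \<triangleright> ?t) \<ominus> x \<triangleright> ?D y) \<ominus>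
      (((x \<triangleright> y) \<triangleright> ?t \<ominus> ?D (x \<triangleright> y)) \<oplus> (y \<triangleright> ?D x \<ominus> ?DD x y))"
    if xy: "x \<in> S" "y \<in> S" for x y
  proof -
    have "derive_word \<gg> (tri \<gg> x) q (\<lambda>v. T (y # v) z) =
        derive_word \<gg> (tri \<gg> x) q (\<lambda>v. y \<triangleright> T v z \<oplus> \<ominus> derive_word \<gg> (tri \<gg> y) v ?F)"
      using xy by (intro derive_word_cong[where S = S]) (simp_all add: T_Cons a_minus_def)
    also have "\<dots> = derive_word \<gg> (tri \<gg> x) q (\<lambda>v. y \<triangleright> T v z) \<oplus>
        derive_word \<gg> (tri \<gg> x) q (\<lambda>v. \<ominus> derive_word \<gg> (tri \<gg> y) v ?F)"
      using xy by (intro g.derive_word_add[where S = S]) (simp_all add: g.derive_word_closed[where S = S])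
    also have "derive_word \<gg> (tri \<gg> x) q (\<lambda>v. y \<triangleright> T v z) = y \<triangleright> ?D x"
      using xy
      by (intro linear.derive_word[OF linearI[OF g.vspace_axioms g.vspace_axioms tri_linear(1)], where S = S, symmetric]) simp_all
    also have "derive_word \<gg> (tri \<gg> x) q (\<lambda>v. \<ominus> derive_word \<gg> (tri \<gg> y) v ?F) = \<ominus> ?DD x y"
      using xy
      by (intro linear.derive_word[OF linearI[OF g.vspace_axioms g.vspace_axioms
              linear_map_uminus[OF g.vspace_axioms linear_map_id]], where S = S, symmetric])
        (simp_all add: g.derive_word_closed[where S = S])
    finally have "derive_word \<gg> (tri \<gg> x) q (\<lambda>v. T (y # v) z) = y \<triangleright> ?D x \<ominus> ?DD x y"
      by (simp add: a_minus_def)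
    then show ?thesis
      using xy linear_map_diffD[OF g.vspace_axioms g.vspace_axioms tri_linear(1)[OF xy(1)], of "y \<triangleright> ?t" "?D y"]
      by (simp add: T_Cons)
  qed
  \<comment> \<open>Solved for one term each, the three identities act as rewrite rules, and what
    remains is a rearrangement of summands.\<close>
  have e1: "?DD x y = ?DD y x \<oplus> ?E y x \<ominus> ?E x y"
    using comm by (simp add: g.eq_diff_iff)
  have e2: "?D (bracket \<gg> x y) = ?E x y \<oplus> ?D (y \<triangleright> x) \<ominus> (?D (x \<triangleright> y) \<oplus> ?E y x)"
    using dd by (simp add: g.eq_diff_iff)
  have e3: "bracket \<gg> x y \<triangleright> ?t = x \<triangleright> (y \<triangleright> ?t) \<oplus> (y \<triangleright> x) \<triangleright> ?t \<ominus> ((x \<triangleright> y) \<triangleright> ?t \<oplus> y \<triangleright> (x \<triangleright> ?t))"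
    using act[of ?t] by (simp add: g.eq_diff_iff)
  have "T (x # y # q) z = T (y # x # q) z \<oplus> T (bracket \<gg> x y # q) z"
    unfolding TT[OF 0(4,5)] TT[OF 0(5,4)] T_Cons[OF bracket_closed[OF 0(4,5)] 0(3) assms(5)] e1 e2 e3
    by (simp add: g.diff_simps M.a_ac)
  with 0 show ?case by simp
next
  case (Suc n)
  then obtain a p' where p: "p = a # p'" "a \<in> S" "p' \<in> lists S" "length p' = n" by (cases p) auto
  note [simp] = p assms(5) Suc.prems(2-4)
  let ?D = "\<lambda>w. derive_word \<gg> (tri \<gg> a) w"
  have IH: "T (u @ x # y # v) z = T (u @ y # x # v) z \<oplus> T (u @ bracket \<gg> x y # v) z"
    if "u \<in> lists S" "v \<in> lists S" "length u = n" "x \<in> S" "y \<in> S" for u v x y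
    using that by (intro Suc.hyps(1)) simp_all
  have e1: "?D p' (\<lambda>u. T (u @ x # y # q) z) =
      ?D p' (\<lambda>u. T (u @ y # x # q) z) \<oplus> ?D p' (\<lambda>u. T (u @ bracket \<gg> x y # q) z)"
    by (subst g.derive_word_add[where S = S, symmetric])
      (auto intro!: derive_word_cong[where S = S] IH)
  have e2: "?D q (\<lambda>v. T (p' @ x # y # v) z) =
      ?D q (\<lambda>v. T (p' @ y # x # v) z) \<oplus> ?D q (\<lambda>v. T (p' @ bracket \<gg> x y # v) z)"
    by (subst g.derive_word_add[where S = S, symmetric])
      (auto intro!: derive_word_cong[where S = S] IH)
  \<comment> \<open>The term in which a hits the bracket: \<open>tri_bracket\<close> gives a sum of
    two brackets, and linearity of T at this position separates them.\<close>
  have e3: "T (p' @ (a \<triangleright> bracket \<gg> x y) # q) z =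
      T (p' @ bracket \<gg> (a \<triangleright> x) y # q) z \<oplus> T (p' @ bracket \<gg> x (a \<triangleright> y) # q) z"
    using linear_mapD(2)[OF T_linear_position[of p' q z]] by (simp add: tri_bracket)
  note e4 = IH[of p' q "a \<triangleright> x" y] IH[of p' q x "a \<triangleright> y"]
  have e5: "a \<triangleright> T (p' @ x # y # q) z = a \<triangleright> T (p' @ y # x # q) z \<oplus> a \<triangleright> T (p' @ bracket \<gg> x y # q) z"
    using IH[of p' q x y] by (simp add: linear_mapD(2)[OF tri_linear(1)])
  show ?case
    using e3 e4 e5
    by (simp add: T_Cons g.derive_word_append[where S = S] g.derive_word_closed[where S = S] e1 e2
        g.diff_simps M.a_ac)
qed

lemma T_compatible: "y \<in> S \<Longrightarrow> uea_compatible \<gg> \<gg> (\<lambda>w. T w y)"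
  unfolding uea_compatible_def
  by (intro conjI ballI allI; (rule T_bracket_word)?)
    (simp_all add: linear_mapD(2,3)[OF T_linear_position])

text \<open>A single letter z acts as a derivation of the bracket by \<open>tri_bracket\<close>, and
  differentiating a word along z is compatible with unshuffling by
  \<open>derive_word_unshuffle\<close>. The recursion of T passes both facts on to words.\<close>

lemma T_bracket:
  assumes "w \<in> lists S" "x \<in> S" "y \<in> S"
  shows "T w (bracket \<gg> x y) = unshuffle \<gg> w (\<lambda>a b. bracket \<gg> (T a x) (T b y))"
  using assms(1)
proof (induction "length w" arbitrary: w)
  case 0
  then show ?case by simp
next
  case (Suc n)
  then obtain z w' where w: "w = z # w'" "z \<in> S" "w' \<in> lists S" "length w' = n" by (cases w) auto
  note [simp] = w(2,3) assms(2,3)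
  let ?D = "\<lambda>w. derive_word \<gg> (tri \<gg> z) w" and ?B = "\<lambda>a b. bracket \<gg> (T a x) (T b y)"
  note [simp] = g.derive_word_closed[where S = S] g.unshuffle_closed[where S = S]
  have IH: "T u (bracket \<gg> x y) = unshuffle \<gg> u ?B" if "u \<in> lists S" "length u = n" for u
    using Suc.hyps(1)[of u] that by simp
  have "?D w' (\<lambda>u. T u (bracket \<gg> x y)) = ?D w' (\<lambda>u. unshuffle \<gg> u ?B)"
    using w by (intro derive_word_cong[where S = S] IH) simp_all
  also have "\<dots> = unshuffle \<gg> w' (\<lambda>a b. ?D a (\<lambda>a'. ?B a' b) \<oplus> ?D b (\<lambda>b'. ?B a b'))"
    by (rule g.derive_word_unshuffle[where S = S]) simp_all
  finally have D: "?D w' (\<lambda>u. T u (bracket \<gg> x y)) = \<dots>" .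
  have Z: "z \<triangleright> T w' (bracket \<gg> x y) = unshuffle \<gg> w' (\<lambda>a b. z \<triangleright> ?B a b)"
    unfolding IH[OF w(3,4)]
    by (intro linear.unshuffle[OF linearI[OF g.vspace_axioms g.vspace_axioms tri_linear(1)], where S = S]) simp_all
  \<comment> \<open>With the subtracted derivatives of the recursion moved to the left, the claim
    for one splitting of the tail is just the derivation rule for z.\<close>
  have point: "(?B (z # a) b \<oplus> ?B a (z # b)) \<oplus> (?D a (\<lambda>a'. ?B a' b) \<oplus> ?D b (\<lambda>b'. ?B a b')) = z \<triangleright> ?B a b"
    if [simp]: "a \<in> lists S" "b \<in> lists S" for a b
  proof -
    have "?D a (\<lambda>a'. ?B a' b) = bracket \<gg> (?D a (\<lambda>a'. T a' x)) (T b y)"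
      by (intro linear.derive_word[OF linearI[OF g.vspace_axioms g.vspace_axioms bracket_linear(2)], where S = S, symmetric]) simp_all
    moreover have "?D b (\<lambda>b'. ?B a b') = bracket \<gg> (T a x) (?D b (\<lambda>b'. T b' y))"
      by (intro linear.derive_word[OF linearI[OF g.vspace_axioms g.vspace_axioms bracket_linear(1)], where S = S, symmetric]) simp_all
    ultimately show ?thesis
      using linear_map_diffD[OF g.vspace_axioms g.vspace_axioms bracket_linear(2)]
        linear_map_diffD[OF g.vspace_axioms g.vspace_axioms bracket_linear(1)]
      by (simp add: T_Cons tri_bracket g.diff_simps M.a_ac)
  qed
  have "unshuffle \<gg> w ?B \<oplus> ?D w' (\<lambda>u. T u (bracket \<gg> x y)) =
    unshuffle \<gg> w' (\<lambda>a b. (?B (z # a) b \<oplus> ?B a (z # b)) \<oplus> (?D a (\<lambda>a'. ?B a' b) \<oplus> ?D b (\<lambda>b'. ?B a b')))"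
    unfolding D w(1) by (simp add: g.unshuffle_add[where S = S])
  also have "\<dots> = unshuffle \<gg> w' (\<lambda>a b. z \<triangleright> ?B a b)"
    by (intro unshuffle_cong[where S = S] point) simp_all
  finally have "unshuffle \<gg> w ?B \<oplus> ?D w' (\<lambda>u. T u (bracket \<gg> x y)) = z \<triangleright> T w' (bracket \<gg> x y)"
    by (simp add: Z)
  then have "unshuffle \<gg> w ?B = z \<triangleright> T w' (bracket \<gg> x y) \<ominus> ?D w' (\<lambda>u. T u (bracket \<gg> x y))"
    unfolding w(1) by (simp add: g.eq_diff_iff del: unshuffle.simps)
  then show ?case unfolding w(1) by (simp add: T_Cons del: unshuffle.simps)
qed


section \<open>Descending T and \<triangleright> to the enveloping algebra\<close>

lemma uea_rep_keys:
  assumes "u \<in> carrier U" shows "Poly_Mapping.keys (SOME f. f \<in> u) \<subseteq> lists S"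
proof -
  obtain f where "f \<in> carrier F" "u = \<pi> f" using assms by (auto simp: U_simps)
  then show ?thesis using Q.some_in_coset(1)[of f] by (simp add: free_algebra_simps)
qed

lemma uea_T_linear_left: "y \<in> S \<Longrightarrow> linear_map U \<gg> (\<lambda>u. uea_T \<gg> u y)"
  unfolding uea_T_def by (intro uea_lift_linear g.vspace_axioms T_compatible)

lemma uea_T_linear_right: "u \<in> carrier U \<Longrightarrow> linear_map \<gg> \<gg> (uea_T \<gg> u)"
  unfolding uea_T_def induced_map_def using uea_rep_keys
  by (intro linear_map_linear_extension_param g.vspace_axioms T_linear_right) blast

lemma uea_T_word [simp]: "\<lbrakk>w \<in> lists S; y \<in> S\<rbrakk> \<Longrightarrow> uea_T \<gg> (word w) y = T w y"
  unfolding uea_T_def by (intro uea_lift_word g.vspace_axioms T_compatible)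

lemma uea_T_closed [simp]: "\<lbrakk>u \<in> carrier U; y \<in> S\<rbrakk> \<Longrightarrow> uea_T \<gg> u y \<in> S"
  by (rule linear_mapD(1)[OF uea_T_linear_right])

abbreviation "M \<equiv> uea_tri_word \<gg>"

lemma M_simps:
  "M u [] = counit U u \<odot>\<^bsub>U\<^esub> \<one>\<^bsub>U\<^esub>"
  "M u [y] = word [uea_T \<gg> u y]"
  "M u (y # z # ys) = tensor_lift U (\<lambda>a b. word [uea_T \<gg> a y] \<otimes>\<^bsub>U\<^esub> M b (z # ys)) (comult U u)"
  by (simp_all add: UEA_simps tensor_lift_def induced_map_def flip: uea_algebra_to_UEA)

declare uea_tri_word.simps [simp del]

lemma M_bilinear:
  assumes "linear_map U U (\<lambda>u. M u ys)" "y \<in> S"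
  shows "bilinear_map U U U (\<lambda>a b. word [uea_T \<gg> a y] \<otimes>\<^bsub>U\<^esub> M b ys)"
  by (rule bilinear_map_compose[OF mult_bilinear
        linear_map_compose[OF uea_T_linear_left[OF assms(2)] word_singleton_linear] assms(1)])

lemma M_linear: "ys \<in> lists S \<Longrightarrow> linear_map U U (\<lambda>u. M u ys)"
proof (induction ys rule: list.induct)
  case Nil
  then show ?case by (simp add: M_simps counit_smult_linear)
next
  case (Cons y ys)
  then have y: "y \<in> S" and ys: "ys \<in> lists S" by auto
  show ?case
  proof (cases ys)
    case Nil
    then show ?thesis
      using linear_map_compose[OF uea_T_linear_left[OF y] word_singleton_linear] by (simp add: M_simps)
  next
    case (Cons z zs)
    then show ?thesis
      using lift_comult_linear[OF U.vspace_axioms M_bilinear[OF Cons.IH[OF ys] y]] by (simp add: M_simps)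
  qed
qed

lemma M_closed [simp]: "\<lbrakk>u \<in> carrier U; ys \<in> lists S\<rbrakk> \<Longrightarrow> M u ys \<in> carrier U"
  by (rule linear_mapD(1)[OF M_linear])

lemma M_word_Nil: "w \<in> lists S \<Longrightarrow> M (word w) [] = (if w = [] then \<one>\<^bsub>U\<^esub> else \<zero>\<^bsub>U\<^esub>)"
  by (simp add: M_simps counit_word)

text \<open>Absorbs the separate equation for words of one letter: for empty \<open>ys\<close> the
  counit in \<open>M_word_Nil\<close> leaves only the splitting with b empty.\<close>

lemma M_word_Cons:
  assumes "w \<in> lists S" "y \<in> S" "ys \<in> lists S"
  shows "M (word w) (y # ys) = unshuffle U w (\<lambda>a b. word [T a y] \<otimes>\<^bsub>U\<^esub> M (word b) ys)"
proof (cases ys)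
  case Nil
  have "unshuffle U w (\<lambda>a b. word [T a y] \<otimes>\<^bsub>U\<^esub> M (word b) ys) =
      unshuffle U w (\<lambda>a b. if b = [] then word [T a y] else \<zero>\<^bsub>U\<^esub>)"
    using assms Nil by (intro unshuffle_cong[where S = S]) (simp_all add: M_word_Nil)
  then show ?thesis using assms Nil by (simp add: M_simps U.unshuffle_counit_right[where S = S])
next
  case (Cons z zs)
  have "M (word w) (y # ys) = unshuffle U w (\<lambda>a b. word [uea_T \<gg> (word a) y] \<otimes>\<^bsub>U\<^esub> M (word b) ys)"
    using Cons lift_comult_word[OF U.vspace_axioms M_bilinear[OF M_linear[OF assms(3)] assms(2)] assms(1)]
    by (simp add: M_simps)
  also have "\<dots> = unshuffle U w (\<lambda>a b. word [T a y] \<otimes>\<^bsub>U\<^esub> M (word b) ys)"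
    using assms by (intro unshuffle_cong[where S = S]) simp_all
  finally show ?thesis .
qed

text \<open>This is (D4) on words. Splitting off the letters of p one at a time groups the parts of
  w differently from splitting w for p and q, which coassociativity repairs.\<close>

lemma M_word_append:
  assumes "w \<in> lists S" "p \<in> lists S" "q \<in> lists S"
  shows "M (word w) (p @ q) = unshuffle U w (\<lambda>a b. M (word a) p \<otimes>\<^bsub>U\<^esub> M (word b) q)"
  using assms(2,1)
proof (induction p arbitrary: w rule: list.induct)
  case Nil
  have "unshuffle U w (\<lambda>a b. M (word a) [] \<otimes>\<^bsub>U\<^esub> M (word b) q) =
      unshuffle U w (\<lambda>a b. if a = [] then M (word b) q else \<zero>\<^bsub>U\<^esub>)"
    using Nil assms(3) by (intro unshuffle_cong[where S = S]) (simp_all add: M_word_Nil)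
  then show ?case using Nil assms(3) by (simp add: U.unshuffle_counit_left[where S = S])
next
  case (Cons y p)
  then have [simp]: "y \<in> S" "p \<in> lists S" "q \<in> lists S" "w \<in> lists S" using assms by auto
  have "M (word w) ((y # p) @ q) = unshuffle U w (\<lambda>a v. word [T a y] \<otimes>\<^bsub>U\<^esub> M (word v) (p @ q))"
    by (simp add: M_word_Cons)
  also have "\<dots> = unshuffle U w (\<lambda>a v. unshuffle U v (\<lambda>b c. word [T a y] \<otimes>\<^bsub>U\<^esub> (M (word b) p \<otimes>\<^bsub>U\<^esub> M (word c) q)))"
    by (intro unshuffle_cong[where S = S], simp, subst Cons.IH)
      (simp_all add: linear.unshuffle[OF linearI[OF U.vspace_axioms U.vspace_axioms mult_linear(1)], where S = S])
  also have "\<dots> = unshuffle U w (\<lambda>u c. unshuffle U u (\<lambda>a b. word [T a y] \<otimes>\<^bsub>U\<^esub> (M (word b) p \<otimes>\<^bsub>U\<^esub> M (word c) q)))"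
    by (rule U.unshuffle_coassoc[where S = S, symmetric]) simp_all
  also have "\<dots> = unshuffle U w (\<lambda>u c. unshuffle U u (\<lambda>a b. (word [T a y] \<otimes>\<^bsub>U\<^esub> M (word b) p) \<otimes>\<^bsub>U\<^esub> M (word c) q))"
    by (intro unshuffle_cong[where S = S]) (simp_all add: U.m_assoc)
  also have "\<dots> = unshuffle U w (\<lambda>u c. M (word u) (y # p) \<otimes>\<^bsub>U\<^esub> M (word c) q)"
    by (intro unshuffle_cong[where S = S])
      (simp_all add: M_word_Cons linear.unshuffle[OF linearI[OF U.vspace_axioms U.vspace_axioms mult_linear(2)], where S = S])
  finally show ?case .
qed

text \<open>The letters x and y receive the two parts of an ordered splitting of w, so exchanging
  them needs cocommutativity. The commutators that arise add up to the right-hand side of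
  \<open>T_bracket\<close>.\<close>

lemma M_bracket:
  assumes [simp]: "w \<in> lists S" "x \<in> S" "y \<in> S"
  shows "M (word w) [x, y] = M (word w) [y, x] \<oplus>\<^bsub>U\<^esub> M (word w) [bracket \<gg> x y]"
proof -
  have e: "M (word w) [x, y] = unshuffle U w (\<lambda>a b. word [T a x, T b y])"
    if "w \<in> lists S" "x \<in> S" "y \<in> S" for w x y
    unfolding M_word_Cons[OF that(1,2), of "[y]", simplified, OF that(3)] using that
    by (intro unshuffle_cong[where S = S]) (simp_all add: M_simps word_Cons)
  have "M (word w) [bracket \<gg> x y] = word [unshuffle \<gg> w (\<lambda>a b. bracket \<gg> (T a x) (T b y))]"
    by (simp add: M_simps T_bracket)
  also have "\<dots> = unshuffle U w (\<lambda>a b. word [bracket \<gg> (T a x) (T b y)])"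
    by (rule linear.unshuffle[OF linearI[OF g.vspace_axioms U.vspace_axioms word_singleton_linear], where S = S]) simp_all
  finally have b: "M (word w) [bracket \<gg> x y] = \<dots>" .
  have "M (word w) [x, y] = unshuffle U w (\<lambda>a b. word [T b y, T a x] \<oplus>\<^bsub>U\<^esub> word [bracket \<gg> (T a x) (T b y)])"
    unfolding e[OF assms]
  proof (rule unshuffle_cong[where S = S])
    show "word [T a x, T b y] = word [T b y, T a x] \<oplus>\<^bsub>U\<^esub> word [bracket \<gg> (T a x) (T b y)]"
      if "a \<in> lists S" "b \<in> lists S" for a b
      using uea_compatibleD(4)[OF word_compatible, of "[]" "[]" "T a x" "T b y"] that by simp
  qed simp
  also have "\<dots> = unshuffle U w (\<lambda>a b. word [T b y, T a x]) \<oplus>\<^bsub>U\<^esub> M (word w) [bracket \<gg> x y]"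
    unfolding b by (rule U.unshuffle_add[where S = S]) simp_all
  also have "unshuffle U w (\<lambda>a b. word [T b y, T a x]) = M (word w) [y, x]"
    unfolding e[OF assms(1,3,2)] by (rule U.unshuffle_swap[where S = S]) simp_all
  finally show ?thesis .
qed

lemma M_compatible:
  assumes "u \<in> carrier U" shows "uea_compatible \<gg> U (M u)"
proof -
  note ml = linear_map_compose[OF _ mult_linear(1)] linear_map_compose[OF _ mult_linear(2)]
  have lin: "linear_map \<gg> U (\<lambda>x. M (word w) (p @ x # q))"
    if [simp]: "w \<in> lists S" "p \<in> lists S" "q \<in> lists S" for w p q
  proof (rule linear_map_cong[OF g.vspace_axioms])
    \<comment> \<open>Isolates the letter x, which then occurs only as an argument of T, where
      linearity is known.\<close>
    show "linear_map \<gg> U (\<lambda>x. unshuffle U w (\<lambda>a v. M (word a) p \<otimes>\<^bsub>U\<^esub>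
        unshuffle U v (\<lambda>b c. word [T b x] \<otimes>\<^bsub>U\<^esub> M (word c) q)))"
      by (intro linear_map_unshuffle[where S = S] U.vspace_axioms ml
          linear_map_compose[OF T_linear_right word_singleton_linear]) simp_all
    show "M (word w) (p @ x # q) = unshuffle U w (\<lambda>a v. M (word a) p \<otimes>\<^bsub>U\<^esub>
        unshuffle U v (\<lambda>b c. word [T b x] \<otimes>\<^bsub>U\<^esub> M (word c) q))" if "x \<in> S" for x
      using that by (subst M_word_append) (auto intro!: unshuffle_cong[where S = S] simp: M_word_Cons)
  qed
  have br: "M (word w) (p @ x # y # q) = M (word w) (p @ y # x # q) \<oplus>\<^bsub>U\<^esub> M (word w) (p @ bracket \<gg> x y # q)"
    if [simp]: "w \<in> lists S" "p \<in> lists S" "q \<in> lists S" "x \<in> S" "y \<in> S" for w p q x y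
  proof -
    \<comment> \<open>With the middle part m isolated, \<open>M_bracket\<close> can be applied to it
      in the context of p and q.\<close>
    have *: "M (word w) (p @ m @ q) = unshuffle U w (\<lambda>a v. unshuffle U v (\<lambda>b c. M (word a) p \<otimes>\<^bsub>U\<^esub> (M (word b) m \<otimes>\<^bsub>U\<^esub> M (word c) q)))"
      if [simp]: "m \<in> lists S" for m
      by (subst M_word_append) (auto intro!: unshuffle_cong[where S = S] simp: M_word_append
          linear.unshuffle[OF linearI[OF U.vspace_axioms U.vspace_axioms mult_linear(1)], where S = S])
    have "M (word w) (p @ [x, y] @ q) =
        unshuffle U w (\<lambda>a v. unshuffle U v (\<lambda>b c. M (word a) p \<otimes>\<^bsub>U\<^esub> (M (word b) [y, x] \<otimes>\<^bsub>U\<^esub> M (word c) q)) \<oplus>\<^bsub>U\<^esub>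
          unshuffle U v (\<lambda>b c. M (word a) p \<otimes>\<^bsub>U\<^esub> (M (word b) [bracket \<gg> x y] \<otimes>\<^bsub>U\<^esub> M (word c) q)))"
      by (subst *, simp)
        (intro unshuffle_cong[where S = S], simp, subst U.unshuffle_add[where S = S, symmetric],
          auto intro!: unshuffle_cong[where S = S] simp: M_bracket[of _ x y] U.l_distr U.r_distr)
    also have "\<dots> = M (word w) (p @ [y, x] @ q) \<oplus>\<^bsub>U\<^esub> M (word w) (p @ [bracket \<gg> x y] @ q)"
      by (subst (1 2) *, simp, simp, rule U.unshuffle_add[where S = S])
        (simp_all add: U.unshuffle_closed[where S = S])
    finally show ?thesis by simp
  qed
  note D = linear_mapD[OF M_linear] linear_mapD[OF lin]
  show ?thesis
    unfolding uea_compatible_def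
  proof (intro conjI ballI allI M_closed assms)
    fix p q x y c assume [simp]: "p \<in> lists S" "q \<in> lists S" "x \<in> S" "y \<in> S"
    show "M u (p @ (x \<oplus> y) # q) = M u (p @ x # q) \<oplus>\<^bsub>U\<^esub> M u (p @ y # q)"
      by (rule uea_ext[OF M_linear linear_map_add[OF U.vspace_axioms M_linear M_linear] _ assms])
        (simp_all add: D)
    show "M u (p @ x # y # q) = M u (p @ y # x # q) \<oplus>\<^bsub>U\<^esub> M u (p @ bracket \<gg> x y # q)"
      by (rule uea_ext[OF M_linear linear_map_add[OF U.vspace_axioms M_linear M_linear] _ assms])
        (simp_all add: br[of _ p q x y])
  next
    fix p q x c assume [simp]: "p \<in> lists S" "q \<in> lists S" "x \<in> S"
    show "M u (p @ (c \<odot> x) # q) = c \<odot>\<^bsub>U\<^esub> M u (p @ x # q)"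
      by (rule uea_ext[OF M_linear linear_map_smult[OF U.vspace_axioms M_linear] _ assms])
        (simp_all add: D)
  qed
qed

lemma tri_U: "tri U u v = induced_map U (M u) v"
  by (simp add: UEA_simps uea_tri_def induced_map_def uea_algebra_to_UEA)

text \<open>The two arguments are linear for different reasons: the second by compatibility with the
  relations, the first because the representative chosen for v stays fixed.\<close>

lemma tri_U_bilinear: "bilinear_map U U U (tri U)"
proof (rule bilinear_mapI)
  show "linear_map U U (tri U u)" if "u \<in> carrier U" for u
    using uea_lift_linear[OF U.vspace_axioms M_compatible[OF that]]
    by (rule linear_map_cong[OF U.vspace_axioms]) (simp add: tri_U)
  show "linear_map U U (\<lambda>u. tri U u v)" if "v \<in> carrier U" for v
    unfolding tri_U induced_map_def using uea_rep_keys[OF that]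
    by (intro linear_map_linear_extension_param U.vspace_axioms M_linear) blast
qed

lemma tri_U_word: "\<lbrakk>u \<in> carrier U; ys \<in> lists S\<rbrakk> \<Longrightarrow> tri U u (word ys) = M u ys"
  unfolding tri_U by (intro uea_lift_word U.vspace_axioms M_compatible)

lemma tri_U_closed [simp]: "\<lbrakk>u \<in> carrier U; v \<in> carrier U\<rbrakk> \<Longrightarrow> tri U u v \<in> carrier U"
  by (rule linear_mapD(1)[OF bilinear_mapD(1)[OF tri_U_bilinear]])

end

section \<open>The D-bialgebra structure of the enveloping algebra\<close>

lemma (in linear) preimage_submodule:
  assumes "submodule N (base_field :: 'k ring) W"
  shows "submodule {x \<in> carrier V. f x \<in> N} (base_field :: 'k ring) V"
  by (rule V.submoduleI) (simp_all add: W.submoduleD[OF assms])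

text \<open>The length condition is what places the summands in a given piece of the
  filtration.\<close>

lemma (in vspace) unshuffle_mem:
  assumes N: "submodule N (base_field :: 'k ring) V" and w: "w \<in> lists S"
    and F: "\<And>u v. \<lbrakk>u \<in> lists S; v \<in> lists S; length u + length v = length w\<rbrakk> \<Longrightarrow> F u v \<in> N"
  shows "unshuffle V w F \<in> N"
  using w F
proof (induction w arbitrary: F rule: list.induct)
  case (Cons x w)
  then show ?case by (simp, intro submoduleD(3)[OF N] Cons.IH) simp_all
qed simp

context post_lie_algebra
begin

lemma T_singleton [simp]: "\<lbrakk>x \<in> S; y \<in> S\<rbrakk> \<Longrightarrow> T [x] y = x \<triangleright> y"
  by (simp add: T_Cons a_minus_def)

lemma M_one: "ys \<in> lists S \<Longrightarrow> M (word []) ys = word ys"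
proof (induction ys rule: list.induct)
  case (Cons y ys)
  then show ?case by (subst M_word_Cons) (simp_all add: word_Cons)
qed (simp add: M_word_Nil, simp add: word_Nil)

text \<open>The letter s goes either to the head y, where T gives
  \<open>s \<triangleright> y\<close>, or to the remaining word; the empty part acts as the
  identity. So s acts by the Leibniz rule.\<close>

lemma M_singleton:
  assumes s: "s \<in> S" and "w \<in> lists S"
  shows "M (word [s]) w = derive_word U (tri \<gg> s) w word"
  using assms(2)
proof (induction w rule: list.induct)
  case (Cons y w)
  then have [simp]: "y \<in> S" "w \<in> lists S" by auto
  have "word [y] \<otimes>\<^bsub>U\<^esub> derive_word U (tri \<gg> s) w word =
      derive_word U (tri \<gg> s) w (\<lambda>v. word [y] \<otimes>\<^bsub>U\<^esub> word v)"
    using s by (intro linear.derive_word[OF linearI[OF U.vspace_axioms U.vspace_axioms mult_linear(1)], where S = S]) simp_all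
  also have "\<dots> = derive_word U (tri \<gg> s) w (\<lambda>v. word (y # v))"
    using s by (intro derive_word_cong[where S = S]) (simp_all add: word_Cons)
  finally show ?case using s Cons.IH by (subst M_word_Cons) (simp_all add: M_one word_Cons)
qed (use s in \<open>simp add: M_word_Nil\<close>)

lemma tri_one_left: "x \<in> carrier U \<Longrightarrow> \<one>\<^bsub>U\<^esub> \<triangleright>\<^bsub>U\<^esub> x = x"
  by (rule uea_ext[OF bilinear_mapD(1)[OF tri_U_bilinear] linear_map_id])
    (simp_all add: tri_U_word M_one flip: word_Nil)

lemma tri_one_right: "x \<in> carrier U \<Longrightarrow> x \<triangleright>\<^bsub>U\<^esub> \<one>\<^bsub>U\<^esub> = counit U x \<odot>\<^bsub>U\<^esub> \<one>\<^bsub>U\<^esub>"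
  using tri_U_word[of x "[]"] by (simp add: M_simps word_Nil)

lemma tri_mult:
  assumes u: "u \<in> carrier U" and yz: "y \<in> carrier U" "z \<in> carrier U"
  shows "u \<triangleright>\<^bsub>U\<^esub> (y \<otimes>\<^bsub>U\<^esub> z) =
    tensor_lift U (\<lambda>a b. (a \<triangleright>\<^bsub>U\<^esub> y) \<otimes>\<^bsub>U\<^esub> (b \<triangleright>\<^bsub>U\<^esub> z)) (comult U u)"
proof -
  note tl = bilinear_mapD[OF tri_U_bilinear]
  have b: "bilinear_map U U U (\<lambda>a b. (a \<triangleright>\<^bsub>U\<^esub> y) \<otimes>\<^bsub>U\<^esub> (b \<triangleright>\<^bsub>U\<^esub> z))"
    if "y \<in> carrier U" "z \<in> carrier U" for y z
    using that by (intro bilinear_map_compose[OF mult_bilinear] tl)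
  have word: "word w \<triangleright>\<^bsub>U\<^esub> (y \<otimes>\<^bsub>U\<^esub> z) =
      unshuffle U w (\<lambda>a b. (word a \<triangleright>\<^bsub>U\<^esub> y) \<otimes>\<^bsub>U\<^esub> (word b \<triangleright>\<^bsub>U\<^esub> z))" if [simp]: "w \<in> lists S" for w
  proof (rule uea_ext2[OF bilinear_map_linear[OF mult_bilinear tl(1)] _ _ yz])
    show "word w \<in> carrier U" by simp
    show "bilinear_map U U U (\<lambda>y z. unshuffle U w (\<lambda>a b. (word a \<triangleright>\<^bsub>U\<^esub> y) \<otimes>\<^bsub>U\<^esub> (word b \<triangleright>\<^bsub>U\<^esub> z)))"
      by (intro bilinear_mapI linear_map_unshuffle[where S = S] U.vspace_axioms
          linear_map_compose[OF tl(1) mult_linear(1)] linear_map_compose[OF tl(1) mult_linear(2)]) simp_all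
    show "word w \<triangleright>\<^bsub>U\<^esub> (word p \<otimes>\<^bsub>U\<^esub> word q) =
        unshuffle U w (\<lambda>a b. (word a \<triangleright>\<^bsub>U\<^esub> word p) \<otimes>\<^bsub>U\<^esub> (word b \<triangleright>\<^bsub>U\<^esub> word q))"
      if [simp]: "p \<in> lists S" "q \<in> lists S" for p q
      by (simp add: word_append tri_U_word M_word_append)
        (intro unshuffle_cong[where S = S], simp_all add: tri_U_word)
  qed
  show ?thesis
    by (rule uea_ext[OF tl(2) lift_comult_linear[OF U.vspace_axioms b[OF yz]] _ u])
      (use yz in \<open>simp_all add: word lift_comult_word[OF U.vspace_axioms b[OF yz]]\<close>)
qed

lemma linear_unshuffle_UU:
  assumes "linear_map U UU f" "w \<in> lists A" "\<And>u v. \<lbrakk>u \<in> lists A; v \<in> lists A\<rbrakk> \<Longrightarrow> G u v \<in> carrier U"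
  shows "f (unshuffle U w G) = unshuffle UU w (\<lambda>u v. f (G u v))"
  using assms by (intro linear.unshuffle[OF linearI[OF U.vspace_axioms UU.vspace_axioms assms(1)]])

lemma linear_unshuffle_UU_UU:
  assumes "linear_map UU UU f" "w \<in> lists A" "\<And>u v. \<lbrakk>u \<in> lists A; v \<in> lists A\<rbrakk> \<Longrightarrow> G u v \<in> carrier UU"
  shows "f (unshuffle UU w G) = unshuffle UU w (\<lambda>u v. f (G u v))"
  using assms by (intro linear.unshuffle[OF linearI[OF UU.vspace_axioms UU.vspace_axioms assms(1)]])

text \<open>Cocommutativity is what allows the letter \<open>y\<close> to be moved past the other tensor factor.\<close>

lemma comult_M:
  assumes "w \<in> lists S" "ys \<in> lists S"
  shows "comult U (M (word w) ys) = unshuffle UU w (\<lambda>a b. unshuffle UU ys (\<lambda>p q. M (word a) p \<oslash> M (word b) q))"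
  using assms(2,1)
proof (induction ys arbitrary: w rule: list.induct)
  case Nil
  have one: "comult U \<one>\<^bsub>U\<^esub> = \<one>\<^bsub>U\<^esub> \<oslash> \<one>\<^bsub>U\<^esub>"
    using comult_word[of "[]"] by (simp add: word_Nil)
  have "unshuffle UU w (\<lambda>a b. M (word a) [] \<oslash> M (word b) []) =
      unshuffle UU w (\<lambda>a b. if a = [] then (if b = [] then \<one>\<^bsub>U\<^esub> \<oslash> \<one>\<^bsub>U\<^esub> else \<zero>\<^bsub>UU\<^esub>) else \<zero>\<^bsub>UU\<^esub>)"
    using Nil by (intro unshuffle_cong[where S = S])
      (simp_all add: M_word_Nil T.pure_zero_left T.pure_zero_right)
  also have "\<dots> = (if w = [] then \<one>\<^bsub>U\<^esub> \<oslash> \<one>\<^bsub>U\<^esub> else \<zero>\<^bsub>UU\<^esub>)"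
    using Nil by (subst UU.unshuffle_counit_left[where S = S]) simp_all
  finally show ?case
    using Nil by (simp add: M_word_Nil one linear_map_zeroD[OF U.vspace_axioms UU.vspace_axioms comult_linear])
next
  case (Cons y ys)
  then have [simp]: "y \<in> S" "ys \<in> lists S" "w \<in> lists S" by auto
  note [simp] = UU.unshuffle_closed[where S = S]
  \<comment> \<open>G and H collect the two summands of \<open>\<delta>\<close> at
    \<open>T a y\<close>: the new letter joins the left or the right tensor factor.\<close>
  define G where "G a c d = unshuffle UU ys (\<lambda>p q. (word [T a y] \<otimes>\<^bsub>U\<^esub> M (word c) p) \<oslash> M (word d) q)" for a c d
  define H where "H a c d = unshuffle UU ys (\<lambda>p q. M (word c) p \<oslash> (word [T a y] \<otimes>\<^bsub>U\<^esub> M (word d) q))" for a c d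
  have [simp]: "G a c d \<in> carrier UU" "H a c d \<in> carrier UU" if "a \<in> lists S" "c \<in> lists S" "d \<in> lists S" for a c d
    using that by (simp_all add: G_def H_def)
  have step: "comult U (word [T a y] \<otimes>\<^bsub>U\<^esub> M (word b) ys) = unshuffle UU b (\<lambda>c d. G a c d \<oplus>\<^bsub>UU\<^esub> H a c d)"
    if [simp]: "a \<in> lists S" "b \<in> lists S" for a b
  proof -
    let ?t = "T a y"
    have tl: "linear_map UU UU (tmult (\<delta> ?t))"
      by (rule bilinear_mapD(1)[OF tmult_bilinear]) simp
    have "comult U (word [?t] \<otimes>\<^bsub>U\<^esub> M (word b) ys) = tmult (\<delta> ?t) (comult U (M (word b) ys))"
      by (simp add: comult_mult comult_word word_Nil)
    also have "\<dots> = unshuffle UU b (\<lambda>c d. tmult (\<delta> ?t) (unshuffle UU ys (\<lambda>p q. M (word c) p \<oslash> M (word d) q)))"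
      unfolding Cons.IH[OF \<open>ys \<in> lists S\<close> \<open>b \<in> lists S\<close>] by (rule linear_unshuffle_UU_UU[OF tl, where A = S]) simp_all
    also have "\<dots> = unshuffle UU b (\<lambda>c d. G a c d \<oplus>\<^bsub>UU\<^esub> H a c d)"
    proof (rule unshuffle_cong[where S = S])
      fix c d assume [simp]: "c \<in> lists S" "d \<in> lists S"
      have "tmult (\<delta> ?t) (unshuffle UU ys (\<lambda>p q. M (word c) p \<oslash> M (word d) q)) =
          unshuffle UU ys (\<lambda>p q. tmult (\<delta> ?t) (M (word c) p \<oslash> M (word d) q))"
        by (rule linear_unshuffle_UU_UU[OF tl, where A = S]) simp_all
      also have "\<dots> = unshuffle UU ys (\<lambda>p q. (word [?t] \<otimes>\<^bsub>U\<^esub> M (word c) p) \<oslash> M (word d) q \<oplus>\<^bsub>UU\<^esub>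
          M (word c) p \<oslash> (word [?t] \<otimes>\<^bsub>U\<^esub> M (word d) q))"
        by (intro unshuffle_cong[where S = S]) (simp_all add: delta_pure del: tmult_pure)
      also have "\<dots> = G a c d \<oplus>\<^bsub>UU\<^esub> H a c d"
        unfolding G_def H_def by (rule UU.unshuffle_add[where S = S]) simp_all
      finally show "tmult (\<delta> ?t) (unshuffle UU ys (\<lambda>p q. M (word c) p \<oslash> M (word d) q)) = \<dots>" .
    qed simp
    finally show ?thesis .
  qed
  have L: "comult U (M (word w) (y # ys)) =
      unshuffle UU w (\<lambda>a b. unshuffle UU b (\<lambda>c d. G a c d)) \<oplus>\<^bsub>UU\<^esub> unshuffle UU w (\<lambda>a b. unshuffle UU b (\<lambda>c d. H a c d))"
  proof -
    have "comult U (M (word w) (y # ys)) =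
        unshuffle UU w (\<lambda>a b. comult U (word [T a y] \<otimes>\<^bsub>U\<^esub> M (word b) ys))"
      by (subst M_word_Cons) (simp_all add: linear_unshuffle_UU[OF comult_linear, where A = S])
    also have "\<dots> = unshuffle UU w (\<lambda>a b. unshuffle UU b (\<lambda>c d. G a c d) \<oplus>\<^bsub>UU\<^esub> unshuffle UU b (\<lambda>c d. H a c d))"
      by (intro unshuffle_cong[where S = S]) (simp_all add: step UU.unshuffle_add[where S = S])
    also have "\<dots> = unshuffle UU w (\<lambda>a b. unshuffle UU b (\<lambda>c d. G a c d)) \<oplus>\<^bsub>UU\<^esub> unshuffle UU w (\<lambda>a b. unshuffle UU b (\<lambda>c d. H a c d))"
      by (rule UU.unshuffle_add[where S = S]) simp_all
    finally show ?thesis .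
  qed
  have R1: "unshuffle UU w (\<lambda>a b. unshuffle UU ys (\<lambda>p q. M (word a) (y # p) \<oslash> M (word b) q)) =
      unshuffle UU w (\<lambda>a b. unshuffle UU b (\<lambda>c d. G a c d))"
  proof -
    have "unshuffle UU w (\<lambda>a b. unshuffle UU ys (\<lambda>p q. M (word a) (y # p) \<oslash> M (word b) q)) =
        unshuffle UU w (\<lambda>a b. unshuffle UU a (\<lambda>c d. G c d b))"
    proof (rule unshuffle_cong[where S = S])
      fix a b assume [simp]: "a \<in> lists S" "b \<in> lists S"
      have "unshuffle UU ys (\<lambda>p q. M (word a) (y # p) \<oslash> M (word b) q) =
          unshuffle UU ys (\<lambda>p q. unshuffle UU a (\<lambda>c d. (word [T c y] \<otimes>\<^bsub>U\<^esub> M (word d) p) \<oslash> M (word b) q))"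
        by (intro unshuffle_cong[where S = S], simp, subst M_word_Cons)
          (simp_all add: linear_unshuffle_UU[OF pure_linear(2), where A = S])
      also have "\<dots> = unshuffle UU a (\<lambda>c d. G c d b)"
        unfolding G_def by (rule UU.unshuffle_exchange[where S = S and S' = S]) simp_all
      finally show "unshuffle UU ys (\<lambda>p q. M (word a) (y # p) \<oslash> M (word b) q) = \<dots>" .
    qed simp
    also have "\<dots> = unshuffle UU w (\<lambda>a b. unshuffle UU b (\<lambda>c d. G a c d))"
      by (rule UU.unshuffle_coassoc[where S = S]) simp_all
    finally show ?thesis .
  qed
  have R2: "unshuffle UU w (\<lambda>a b. unshuffle UU ys (\<lambda>p q. M (word a) p \<oslash> M (word b) (y # q))) =
      unshuffle UU w (\<lambda>a b. unshuffle UU b (\<lambda>c d. H a c d))"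
  proof -
    have "unshuffle UU w (\<lambda>a b. unshuffle UU ys (\<lambda>p q. M (word a) p \<oslash> M (word b) (y # q))) =
        unshuffle UU w (\<lambda>a b. unshuffle UU b (\<lambda>c d. H c a d))"
    proof (rule unshuffle_cong[where S = S])
      fix a b assume [simp]: "a \<in> lists S" "b \<in> lists S"
      have "unshuffle UU ys (\<lambda>p q. M (word a) p \<oslash> M (word b) (y # q)) =
          unshuffle UU ys (\<lambda>p q. unshuffle UU b (\<lambda>c d. M (word a) p \<oslash> (word [T c y] \<otimes>\<^bsub>U\<^esub> M (word d) q)))"
        by (intro unshuffle_cong[where S = S], simp, subst M_word_Cons)
          (simp_all add: linear_unshuffle_UU[OF pure_linear(1), where A = S])
      also have "\<dots> = unshuffle UU b (\<lambda>c d. H c a d)"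
        unfolding H_def by (rule UU.unshuffle_exchange[where S = S and S' = S]) simp_all
      finally show "unshuffle UU ys (\<lambda>p q. M (word a) p \<oslash> M (word b) (y # q)) = \<dots>" .
    qed simp
    \<comment> \<open>The part of w that acts on y was split off after the part for the left factor.
      Regrouping, exchanging these two parts and regrouping again puts it in front.\<close>
    also have "\<dots> = unshuffle UU w (\<lambda>u d. unshuffle UU u (\<lambda>a c. H c a d))"
      by (rule UU.unshuffle_coassoc[where S = S, symmetric]) simp_all
    also have "\<dots> = unshuffle UU w (\<lambda>u d. unshuffle UU u (\<lambda>a c. H a c d))"
      by (intro unshuffle_cong[where S = S] UU.unshuffle_swap[where S = S]) simp_all
    also have "\<dots> = unshuffle UU w (\<lambda>a b. unshuffle UU b (\<lambda>c d. H a c d))"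
      by (rule UU.unshuffle_coassoc[where S = S]) simp_all
    finally show ?thesis .
  qed
  have "unshuffle UU w (\<lambda>a b. unshuffle UU (y # ys) (\<lambda>p q. M (word a) p \<oslash> M (word b) q)) =
      unshuffle UU w (\<lambda>a b. unshuffle UU ys (\<lambda>p q. M (word a) (y # p) \<oslash> M (word b) q)) \<oplus>\<^bsub>UU\<^esub>
      unshuffle UU w (\<lambda>a b. unshuffle UU ys (\<lambda>p q. M (word a) p \<oslash> M (word b) (y # q)))"
    unfolding unshuffle.simps(2) by (rule UU.unshuffle_add[where S = S]) simp_all
  then show ?case unfolding R1 R2 L[symmetric] by (rule sym)
qed

lemma comult_tri:
  assumes "x \<in> carrier U" "y \<in> carrier U"
  shows "comult U (x \<triangleright>\<^bsub>U\<^esub> y) = tensor_op U (tri U) (comult U x) (comult U y)"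
proof (rule uea_ext2[OF bilinear_map_linear[OF tri_U_bilinear comult_linear] bilinear_map_compose[OF
        tensor_op_bilinear(1)[OF U.vspace_axioms tri_U_bilinear] comult_linear comult_linear] _ assms])
  fix w w' assume [simp]: "w \<in> lists S" "w' \<in> lists S"
  show "comult U (word w \<triangleright>\<^bsub>U\<^esub> word w') = tensor_op U (tri U) (comult U (word w)) (comult U (word w'))"
    unfolding tensor_op_comult_word[OF tri_U_bilinear \<open>w \<in> lists S\<close> \<open>w' \<in> lists S\<close>]
    by (simp add: tri_U_word comult_M) (intro unshuffle_cong[where S = S], simp_all add: tri_U_word)
qed

text \<open>On words this is the recursion for T: \<open>word w\<close> sends
  \<open>word [t]\<close> to \<open>word [T w t]\<close>, and \<open>word [s]\<close> differentiates
  w by \<open>M_singleton\<close>.\<close>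

lemma tri_assoc_U:
  assumes [simp]: "s \<in> S" "t \<in> S" and z: "z \<in> carrier U"
  shows "(word [s] \<otimes>\<^bsub>U\<^esub> z) \<triangleright>\<^bsub>U\<^esub> word [t] =
    word [s] \<triangleright>\<^bsub>U\<^esub> (z \<triangleright>\<^bsub>U\<^esub> word [t]) \<ominus>\<^bsub>U\<^esub> (word [s] \<triangleright>\<^bsub>U\<^esub> z) \<triangleright>\<^bsub>U\<^esub> word [t]"
proof (rule uea_ext[OF _ _ _ z])
  note tl = bilinear_mapD[OF tri_U_bilinear]
  show "linear_map U U (\<lambda>z. (word [s] \<otimes>\<^bsub>U\<^esub> z) \<triangleright>\<^bsub>U\<^esub> word [t])"
    by (rule linear_map_compose[OF mult_linear(1) tl(2)]) simp_all
  show "linear_map U U (\<lambda>z. word [s] \<triangleright>\<^bsub>U\<^esub> (z \<triangleright>\<^bsub>U\<^esub> word [t]) \<ominus>\<^bsub>U\<^esub> (word [s] \<triangleright>\<^bsub>U\<^esub> z) \<triangleright>\<^bsub>U\<^esub> word [t])"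
    by (intro linear_map_diff U.vspace_axioms linear_map_compose[OF tl(2) tl(1)]
        linear_map_compose[OF tl(1) tl(2)]) simp_all
  fix w assume [simp]: "w \<in> lists S"
  let ?D = "derive_word \<gg> (tri \<gg> s) w (\<lambda>u. T u t)"
  have [simp]: "?D \<in> S" by (intro g.derive_word_closed[where S = S]) simp_all
  have "(word [s] \<triangleright>\<^bsub>U\<^esub> word w) \<triangleright>\<^bsub>U\<^esub> word [t] = derive_word U (tri \<gg> s) w (\<lambda>u. word u \<triangleright>\<^bsub>U\<^esub> word [t])"
    by (simp add: tri_U_word[of "word [s]" w] M_singleton
        linear.derive_word[OF linearI[OF U.vspace_axioms U.vspace_axioms tl(2)], where S = S])
  also have "\<dots> = derive_word U (tri \<gg> s) w (\<lambda>u. word [T u t])"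
    by (intro derive_word_cong[where S = S]) (simp_all add: tri_U_word M_simps)
  also have "\<dots> = word [?D]"
    by (rule linear.derive_word[OF linearI[OF g.vspace_axioms U.vspace_axioms word_singleton_linear],
          where S = S, symmetric]) simp_all
  finally have "(word [s] \<triangleright>\<^bsub>U\<^esub> word w) \<triangleright>\<^bsub>U\<^esub> word [t] = word [?D]" .
  moreover have "word [s \<triangleright> T w t \<ominus> ?D] = word [s \<triangleright> T w t] \<ominus>\<^bsub>U\<^esub> word [?D]"
    by (rule linear_map_diffD[OF g.vspace_axioms U.vspace_axioms word_singleton_linear]) simp_all
  ultimately show "(word [s] \<otimes>\<^bsub>U\<^esub> word w) \<triangleright>\<^bsub>U\<^esub> word [t] =
      word [s] \<triangleright>\<^bsub>U\<^esub> (word w \<triangleright>\<^bsub>U\<^esub> word [t]) \<ominus>\<^bsub>U\<^esub> (word [s] \<triangleright>\<^bsub>U\<^esub> word w) \<triangleright>\<^bsub>U\<^esub> word [t]"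
    by (simp add: word_Cons tri_U_word M_simps T_Cons[of s w t])
qed


section \<open>The filtration and the primitive elements of the enveloping algebra\<close>

text \<open>The bound is strict, so that \<open>span_words 0\<close> is zero and the leading-term
  statements below also cover degree zero. The filtration is shifted by one against it, see
  \<open>filt_U\<close>.\<close>

definition span_words :: "nat \<Rightarrow> ('k, 'g) uea set"
  where "span_words n = submodule_span U {word w | w. w \<in> lists S \<and> length w < n}"

lemma submodule_iff:
  "submodule N (base_field :: 'k ring) U \<longleftrightarrow> submodule N (base_field :: 'k ring) (uea_algebra \<gg>)"
  using vspace.submoduleD[OF vspace_uea_algebra, of N] U.submoduleD[of N]
  by (auto intro!: vspace.submoduleI[OF vspace_uea_algebra] U.submoduleI simp: UEA_simps)

lemma filt_U: "filt U n = span_words (Suc n)"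
  by (simp add: UEA_simps uea_filt_def span_words_def submodule_span_def submodule_iff less_Suc_eq_le)

lemma span_words_submodule: "submodule (span_words n) (base_field :: 'k ring) U"
  unfolding span_words_def by (rule U.submodule_span_submodule) auto

lemmas span_wordsD = U.submoduleD[OF span_words_submodule]

lemma span_words_closed [simp]: "u \<in> span_words n \<Longrightarrow> u \<in> carrier U"
  using span_wordsD(1) by blast

lemma word_in_span: "\<lbrakk>w \<in> lists S; length w < n\<rbrakk> \<Longrightarrow> word w \<in> span_words n"
  unfolding span_words_def by (rule subsetD[OF submodule_span_superset]) blast

lemma span_words_minimal:
  assumes "submodule N (base_field :: 'k ring) U" "\<And>w. \<lbrakk>w \<in> lists S; length w < n\<rbrakk> \<Longrightarrow> word w \<in> N"
  shows "span_words n \<subseteq> N"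
  unfolding span_words_def by (rule submodule_span_minimal) (use assms in auto)

lemma span_words_mono: "m \<le> n \<Longrightarrow> span_words m \<subseteq> span_words n"
  by (intro span_words_minimal span_words_submodule word_in_span) auto

lemma span_words_exhaustive: "u \<in> carrier U \<Longrightarrow> \<exists>n. u \<in> span_words (Suc n)"
proof (induction rule: uea_induct)
  case (word w)
  then show ?case using word_in_span[of w "Suc (length w)"] by auto
next
  case (add u v)
  then obtain m n where "u \<in> span_words (Suc m)" "v \<in> span_words (Suc n)" by auto
  then have "u \<in> span_words (Suc (max m n))" "v \<in> span_words (Suc (max m n))"
    using span_words_mono[of "Suc m" "Suc (max m n)"] span_words_mono[of "Suc n" "Suc (max m n)"] by auto
  then show ?case using span_wordsD(3) by blast
next
  case (smult c u)
  then show ?case using span_wordsD(4) by blast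
qed

lemma linear_span_words:
  assumes "linear_map U U f" "\<And>w. \<lbrakk>w \<in> lists S; length w < n\<rbrakk> \<Longrightarrow> f (word w) \<in> span_words m"
    "u \<in> span_words n"
  shows "f u \<in> span_words m"
proof -
  have "span_words n \<subseteq> {u \<in> carrier U. f u \<in> span_words m}"
    by (rule span_words_minimal[OF linear.preimage_submodule[OF
          linearI[OF U.vspace_axioms U.vspace_axioms assms(1)] span_words_submodule]])
      (use assms(2) in simp)
  with assms(3) show ?thesis by blast
qed

lemma span_words_mult:
  assumes x: "x \<in> span_words (Suc i)" and y: "y \<in> span_words (Suc j)"
  shows "x \<otimes>\<^bsub>U\<^esub> y \<in> span_words (Suc (i + j))"
proof (rule linear_span_words[OF mult_linear(2) _ x])
  show "y \<in> carrier U" using y by simp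
  fix w assume w: "w \<in> lists S" "length w < Suc i"
  show "word w \<otimes>\<^bsub>U\<^esub> y \<in> span_words (Suc (i + j))"
    by (rule linear_span_words[OF mult_linear(1) _ y])
      (use w in \<open>auto simp: word_append intro!: word_in_span\<close>)
qed

lemma filt_one_ker_U: "filt_one_ker U = (\<lambda>x. word [x]) ` S"
proof
  show "(\<lambda>x. word [x]) ` S \<subseteq> filt_one_ker U"
    by (auto simp: filt_one_ker_def filt_U counit_word intro!: word_in_span)
  note lin = linear_mapD[OF word_singleton_linear]
  \<comment> \<open>Scalars plus letters: a subspace that contains the words of length below two.
    Since letters have counit zero, the counit reads off the scalar part.\<close>
  define N where "N = {c \<odot>\<^bsub>U\<^esub> \<one>\<^bsub>U\<^esub> \<oplus>\<^bsub>U\<^esub> word [x] | c x. x \<in> S}"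
  have "submodule N (base_field :: 'k ring) U"
  proof (rule U.submoduleI)
    show "N \<subseteq> carrier U" by (auto simp: N_def)
    have "\<zero>\<^bsub>U\<^esub> = 0 \<odot>\<^bsub>U\<^esub> \<one>\<^bsub>U\<^esub> \<oplus>\<^bsub>U\<^esub> word [\<zero>]"
      using linear_map_zeroD[OF g.vspace_axioms U.vspace_axioms word_singleton_linear] by simp
    then show "\<zero>\<^bsub>U\<^esub> \<in> N" unfolding N_def by blast
  next
    fix u v assume "u \<in> N" "v \<in> N"
    then obtain c x d y where "u = c \<odot>\<^bsub>U\<^esub> \<one>\<^bsub>U\<^esub> \<oplus>\<^bsub>U\<^esub> word [x]" "v = d \<odot>\<^bsub>U\<^esub> \<one>\<^bsub>U\<^esub> \<oplus>\<^bsub>U\<^esub> word [y]" "x \<in> S" "y \<in> S"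
      by (auto simp: N_def)
    then have "u \<oplus>\<^bsub>U\<^esub> v = (c + d) \<odot>\<^bsub>U\<^esub> \<one>\<^bsub>U\<^esub> \<oplus>\<^bsub>U\<^esub> word [x \<oplus> y]" "x \<oplus> y \<in> S"
      by (simp_all add: lin U.smult_l_distr U.a_ac)
    then show "u \<oplus>\<^bsub>U\<^esub> v \<in> N" unfolding N_def by blast
  next
    fix a u assume "u \<in> N"
    then obtain c x where "u = c \<odot>\<^bsub>U\<^esub> \<one>\<^bsub>U\<^esub> \<oplus>\<^bsub>U\<^esub> word [x]" "x \<in> S" by (auto simp: N_def)
    then have "a \<odot>\<^bsub>U\<^esub> u = (a * c) \<odot>\<^bsub>U\<^esub> \<one>\<^bsub>U\<^esub> \<oplus>\<^bsub>U\<^esub> word [a \<odot> x]" "a \<odot> x \<in> S"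
      by (simp_all add: lin U.smult_r_distr U.smult_smult)
    then show "a \<odot>\<^bsub>U\<^esub> u \<in> N" unfolding N_def by blast
  qed
  then have "span_words 2 \<subseteq> N"
  proof (rule span_words_minimal)
    fix w assume w: "w \<in> lists S" "length w < 2"
    have "word [] = 1 \<odot>\<^bsub>U\<^esub> \<one>\<^bsub>U\<^esub> \<oplus>\<^bsub>U\<^esub> word [\<zero>]"
      using linear_map_zeroD[OF g.vspace_axioms U.vspace_axioms word_singleton_linear] by (simp add: word_Nil)
    then have "word [] \<in> N" unfolding N_def by blast
    moreover have "word [x] \<in> N" if "x \<in> S" for x
    proof -
      have "word [x] = 0 \<odot>\<^bsub>U\<^esub> \<one>\<^bsub>U\<^esub> \<oplus>\<^bsub>U\<^esub> word [x]" using that by simp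
      then show ?thesis using that unfolding N_def by blast
    qed
    ultimately show "word w \<in> N" using w by (cases w) (auto simp: less_Suc_eq numeral_2_eq_2)
  qed
  then show "filt_one_ker U \<subseteq> (\<lambda>x. word [x]) ` S"
    by (auto simp: filt_one_ker_def filt_U N_def numeral_2_eq_2 counit_simps counit_word simp flip: word_Nil
        dest!: subsetD)
qed

text \<open>Passing x over one letter costs a bracket, that is, a word one letter shorter. This is
  commutativity of the associated graded algebra.\<close>

lemma move_letter:
  assumes "u \<in> lists S" "v \<in> lists S" "x \<in> S"
  shows "word (u @ x # v) \<ominus>\<^bsub>U\<^esub> word (x # u @ v) \<in> span_words (Suc (length u + length v))"
  using assms(1)
proof (induction u rule: list.induct)
  case Nil
  then show ?case using assms span_wordsD(2) by (simp add: a_minus_def U.r_neg)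
next
  case (Cons a u)
  then have [simp]: "a \<in> S" "u \<in> lists S" "v \<in> lists S" "x \<in> S" using assms by auto
  have "word [a] \<otimes>\<^bsub>U\<^esub> (word (u @ x # v) \<ominus>\<^bsub>U\<^esub> word (x # u @ v)) \<in> span_words (Suc (1 + (length u + length v)))"
    using Cons.IH by (intro span_words_mult word_in_span) simp_all
  moreover have "word [a] \<otimes>\<^bsub>U\<^esub> (word (u @ x # v) \<ominus>\<^bsub>U\<^esub> word (x # u @ v)) =
      word (a # u @ x # v) \<ominus>\<^bsub>U\<^esub> word (a # x # u @ v)"
    using linear_map_diffD[OF U.vspace_axioms U.vspace_axioms mult_linear(1)] by (simp add: word_Cons)
  moreover have "word (a # x # u @ v) \<ominus>\<^bsub>U\<^esub> word (x # a # u @ v) = word (bracket \<gg> a x # u @ v)"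
    using uea_compatibleD(4)[OF word_compatible, of "[]" "u @ v" a x] by (simp add: U.diff_simps U.a_ac)
  moreover have "word (bracket \<gg> a x # u @ v) \<in> span_words (Suc (1 + (length u + length v)))"
    by (intro word_in_span) simp_all
  ultimately have "(word (a # u @ x # v) \<ominus>\<^bsub>U\<^esub> word (a # x # u @ v)) \<oplus>\<^bsub>U\<^esub>
      (word (a # x # u @ v) \<ominus>\<^bsub>U\<^esub> word (x # a # u @ v)) \<in> span_words (Suc (1 + (length u + length v)))"
    using span_wordsD(3) by simp
  also have "(word (a # u @ x # v) \<ominus>\<^bsub>U\<^esub> word (a # x # u @ v)) \<oplus>\<^bsub>U\<^esub>
      (word (a # x # u @ v) \<ominus>\<^bsub>U\<^esub> word (x # a # u @ v)) = word (a # u @ x # v) \<ominus>\<^bsub>U\<^esub> word (x # a # u @ v)"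
    by (simp add: U.diff_simps U.a_ac)
  finally show ?case by simp
qed

text \<open>The map \<open>\<mu> \<circ> \<Delta>\<close> doubles primitive elements and acts on the \<open>n\<close>-th graded piece of the
  filtration as multiplication by \<open>2\<^sup>n\<close>. So in characteristic zero primitive elements have degree
  at most one; the Poincare-Birkhoff-Witt theorem is not needed.\<close>

definition doubling :: "('k, 'g) uea \<Rightarrow> ('k, 'g) uea"
  where "doubling u = tensor_lift U (monoid.mult U) (comult U u)"

lemma doubling_linear: "linear_map U U doubling"
  unfolding doubling_def by (rule lift_comult_linear[OF U.vspace_axioms mult_bilinear])

lemma doubling_word: "w \<in> lists S \<Longrightarrow> doubling (word w) = unshuffle U w (\<lambda>u v. word (u @ v))"
  unfolding doubling_def lift_comult_word[OF U.vspace_axioms mult_bilinear]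
  by (intro unshuffle_cong[where S = S]) (simp_all add: word_append)

text \<open>Each of the \<open>2 ^ length w\<close> splittings of w contributes w up to shorter
  words. In the induction step \<open>?A\<close> and \<open>?B\<close> collect the splittings that
  put x in the left and in the right subword; \<open>?B\<close> agrees with \<open>?A\<close> by
  \<open>move_letter\<close>, and \<open>?A\<close> is x times the doubling of the tail.\<close>

lemma doubling_word_leading:
  assumes "w \<in> lists S"
  shows "doubling (word w) \<ominus>\<^bsub>U\<^esub> 2 ^ length w \<odot>\<^bsub>U\<^esub> word w \<in> span_words (length w)"
  using assms
proof (induction w rule: list.induct)
  case Nil
  then show ?case using span_wordsD(2) by (simp add: doubling_word a_minus_def U.r_neg)
next
  case (Cons x w)
  then have [simp]: "x \<in> S" "w \<in> lists S" by auto
  let ?N = "span_words (Suc (length w))"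
  let ?A = "unshuffle U w (\<lambda>u v. word (x # u @ v))" and ?B = "unshuffle U w (\<lambda>u v. word (u @ x # v))"
  let ?c = "(2::'k) ^ length w \<odot>\<^bsub>U\<^esub> word (x # w)"
  have [simp]: "?A \<in> carrier U" "?B \<in> carrier U" by (simp_all add: U.unshuffle_closed[where S = S])
  have "unshuffle U w (\<lambda>u v. word (u @ x # v) \<ominus>\<^bsub>U\<^esub> word (x # u @ v)) \<in> ?N"
    using move_letter by (intro U.unshuffle_mem[OF span_words_submodule, where S = S]) force+
  moreover have "?B = unshuffle U w (\<lambda>u v. (word (u @ x # v) \<ominus>\<^bsub>U\<^esub> word (x # u @ v)) \<oplus>\<^bsub>U\<^esub> word (x # u @ v))"
    by (intro unshuffle_cong[where S = S]) (simp_all add: U.diff_simps)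
  then have "?B = unshuffle U w (\<lambda>u v. word (u @ x # v) \<ominus>\<^bsub>U\<^esub> word (x # u @ v)) \<oplus>\<^bsub>U\<^esub> ?A"
    by (simp add: U.unshuffle_add[where S = S])
  ultimately have B: "?B \<ominus>\<^bsub>U\<^esub> ?A \<in> ?N"
    by (simp add: U.diff_eq_iff U.diff_simps(1,2)) (simp add: a_minus_def U.a_assoc U.r_neg)
  \<comment> \<open>\<open>span_words_mult\<close> speaks of indices \<open>Suc i\<close>, so the
    empty tail, for which the difference is zero, is treated apart.\<close>
  have "word [x] \<otimes>\<^bsub>U\<^esub> (doubling (word w) \<ominus>\<^bsub>U\<^esub> 2 ^ length w \<odot>\<^bsub>U\<^esub> word w) \<in> ?N"
    if "length w \<noteq> 0"
    using span_words_mult[of "word [x]" 1 "doubling (word w) \<ominus>\<^bsub>U\<^esub> 2 ^ length w \<odot>\<^bsub>U\<^esub> word w" "length w - 1"]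
      Cons.IH that by (simp add: word_in_span)
  moreover have "doubling (word w) \<ominus>\<^bsub>U\<^esub> 2 ^ length w \<odot>\<^bsub>U\<^esub> word w = \<zero>\<^bsub>U\<^esub>" if "length w = 0"
    using that by (simp add: doubling_word a_minus_def U.r_neg)
  ultimately have "word [x] \<otimes>\<^bsub>U\<^esub> (doubling (word w) \<ominus>\<^bsub>U\<^esub> 2 ^ length w \<odot>\<^bsub>U\<^esub> word w) \<in> ?N"
    using span_wordsD(2) by (cases "length w = 0") auto
  moreover have "word [x] \<otimes>\<^bsub>U\<^esub> doubling (word w) = ?A"
  proof -
    have "word [x] \<otimes>\<^bsub>U\<^esub> doubling (word w) = unshuffle U w (\<lambda>u v. word [x] \<otimes>\<^bsub>U\<^esub> word (u @ v))"
      by (simp add: doubling_word linear.unshuffle[OF linearI[OF U.vspace_axioms U.vspace_axioms mult_linear(1)], where S = S])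
    also have "\<dots> = ?A" by (intro unshuffle_cong[where S = S]) (simp_all add: word_Cons)
    finally show ?thesis .
  qed
  then have "word [x] \<otimes>\<^bsub>U\<^esub> (doubling (word w) \<ominus>\<^bsub>U\<^esub> 2 ^ length w \<odot>\<^bsub>U\<^esub> word w) = ?A \<ominus>\<^bsub>U\<^esub> ?c"
    using linear_map_diffD[OF U.vspace_axioms U.vspace_axioms mult_linear(1)] linear_mapD[OF doubling_linear]
    by (simp add: linear_mapD(3)[OF mult_linear(1)] word_Cons)
  ultimately have A: "?A \<ominus>\<^bsub>U\<^esub> ?c \<in> ?N" by simp
  have "(?B \<ominus>\<^bsub>U\<^esub> ?A) \<oplus>\<^bsub>U\<^esub> ((?A \<ominus>\<^bsub>U\<^esub> ?c) \<oplus>\<^bsub>U\<^esub> (?A \<ominus>\<^bsub>U\<^esub> ?c)) \<in> ?N"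
    using A B span_wordsD(3) by blast
  also have "(?B \<ominus>\<^bsub>U\<^esub> ?A) \<oplus>\<^bsub>U\<^esub> ((?A \<ominus>\<^bsub>U\<^esub> ?c) \<oplus>\<^bsub>U\<^esub> (?A \<ominus>\<^bsub>U\<^esub> ?c)) = (?A \<oplus>\<^bsub>U\<^esub> ?B) \<ominus>\<^bsub>U\<^esub> (?c \<oplus>\<^bsub>U\<^esub> ?c)"
    by (simp add: U.diff_simps U.a_ac)
  also have "?c \<oplus>\<^bsub>U\<^esub> ?c = 2 ^ length (x # w) \<odot>\<^bsub>U\<^esub> word (x # w)"
    by (simp flip: U.smult_l_distr)
  finally show ?case by (simp add: doubling_word)
qed

text \<open>For words shorter than n both terms already lie in \<open>span_words n\<close>; for
  words of length n the previous lemma applies.\<close>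

lemma doubling_leading:
  assumes "u \<in> span_words (Suc n)" shows "doubling u \<ominus>\<^bsub>U\<^esub> 2 ^ n \<odot>\<^bsub>U\<^esub> u \<in> span_words n"
proof (rule linear_span_words[OF _ _ assms])
  show "linear_map U U (\<lambda>u. doubling u \<ominus>\<^bsub>U\<^esub> 2 ^ n \<odot>\<^bsub>U\<^esub> u)"
    by (intro linear_map_diff linear_map_smult linear_map_id U.vspace_axioms doubling_linear)
  fix w assume w: "w \<in> lists S" "length w < Suc n"
  show "doubling (word w) \<ominus>\<^bsub>U\<^esub> 2 ^ n \<odot>\<^bsub>U\<^esub> word w \<in> span_words n"
  proof (cases "length w = n")
    case True
    then show ?thesis using doubling_word_leading[OF w(1)] by simp
  next
    case False
    then have "doubling (word w) \<in> span_words n"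
      using w unfolding doubling_word[OF w(1)]
      by (intro U.unshuffle_mem[OF span_words_submodule, where S = S] word_in_span) simp_all
    then show ?thesis using False w by (intro span_wordsD(4,5) word_in_span) simp_all
  qed
qed

lemma primitives_U: "primitives U = filt_one_ker U"
proof
  show "filt_one_ker U \<subseteq> primitives U"
    unfolding filt_one_ker_U by (auto simp: primitives_def comult_word word_Nil)
  show "primitives U \<subseteq> filt_one_ker U"
  proof
    fix u assume u: "u \<in> primitives U"
    then have uc [simp]: "u \<in> carrier U" and \<Delta>: "comult U u = u \<oslash> \<one>\<^bsub>U\<^esub> \<oplus>\<^bsub>UU\<^esub> \<one>\<^bsub>U\<^esub> \<oslash> u"
      by (auto simp: primitives_def)
    have lift: "tensor_lift U b (comult U u) = b u \<one>\<^bsub>U\<^esub> \<oplus>\<^bsub>U\<^esub> b \<one>\<^bsub>U\<^esub> u" if b: "bilinear_map U U U b" for b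
      using linear_mapD(2)[OF T.tensor_lift_linear[OF U.vspace_axioms b], of "u \<oslash> \<one>\<^bsub>U\<^esub>" "\<one>\<^bsub>U\<^esub> \<oslash> u"]
      by (simp add: \<Delta> T.tensor_lift_pure[OF U.vspace_axioms b])
    have c1: "counit U \<one>\<^bsub>U\<^esub> = 1" using counit_word[of "[]"] by (simp add: word_Nil)
    \<comment> \<open>The counit axiom for a primitive element. Applying the counit to it gives
      twice the counit of u on the right, so that counit vanishes.\<close>
    have "u = counit U u \<odot>\<^bsub>U\<^esub> \<one>\<^bsub>U\<^esub> \<oplus>\<^bsub>U\<^esub> u"
      using counit_left[OF uc] lift[OF counit_bilinear] by (simp add: c1)
    then have "counit U u = counit U (counit U u \<odot>\<^bsub>U\<^esub> \<one>\<^bsub>U\<^esub> \<oplus>\<^bsub>U\<^esub> u)" by simp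
    then have counit: "counit U u = 0" by (simp add: counit_simps c1)
    have double: "doubling u = 2 \<odot>\<^bsub>U\<^esub> u"
      using lift[OF mult_bilinear] U.smult_l_distr[OF uc, of 1 1] by (simp add: doubling_def)
    \<comment> \<open>Descent through the filtration: above index two the factor 2 - 2^(n+2) is
      invertible, and the index drops by one. In index two the factor would be 2 - 2, so the descent
      stops there.\<close>
    have "u \<in> span_words 2" if "u \<in> span_words (Suc (Suc n))" for n
      using that
    proof (induction n)
      case 0
      then show ?case by (simp add: numeral_2_eq_2)
    next
      case (Suc n)
      have "(2 - 2 ^ Suc (Suc n) :: 'k) \<odot>\<^bsub>U\<^esub> u \<in> span_words (Suc (Suc n))"
        using doubling_leading[OF Suc.prems] by (simp add: double U.smult_left_diff del: power_Suc)
      then have *: "inverse (2 - 2 ^ Suc (Suc n) :: 'k) \<odot>\<^bsub>U\<^esub> ((2 - 2 ^ Suc (Suc n) :: 'k) \<odot>\<^bsub>U\<^esub> u) \<in> span_words (Suc (Suc n))"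
        by (rule span_wordsD(4))
      have "(2::'k) \<noteq> 2 ^ Suc (Suc n)"
      proof
        assume "(2::'k) = 2 ^ Suc (Suc n)"
        then have "of_nat 2 = (of_nat (2 ^ Suc (Suc n)) :: 'k)" by simp
        then have "(2::nat) = 2 ^ Suc (Suc n)" unfolding of_nat_eq_iff .
        then show False by simp
      qed
      then have "u \<in> span_words (Suc (Suc n))"
        using * by (simp add: U.smult_smult del: power_Suc)
      then show ?case by (rule Suc.IH)
    qed
    moreover obtain n where "u \<in> span_words (Suc n)" using span_words_exhaustive[OF uc] by blast
    then have "u \<in> span_words (Suc (Suc n))" using span_words_mono[of "Suc n" "Suc (Suc n)"] by auto
    ultimately have "u \<in> span_words 2" by blast
    with counit show "u \<in> filt_one_ker U" by (simp add: filt_one_ker_def filt_U numeral_2_eq_2)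
  qed
qed

lemma D_bialgebra_UEA: "D_bialgebra U"
proof (intro D_bialgebra.intro D_bialgebra_axioms.intro bialgebra_UEA)
  show "bilinear_op U (tri U)" by (simp add: bilinear_op_iff tri_U_bilinear)
  show "submodule (filt U n) (base_field :: 'k ring) U" for n
    unfolding filt_U by (rule span_words_submodule)
  show "filt U 0 = {c \<odot>\<^bsub>U\<^esub> \<one>\<^bsub>U\<^esub> | c. True}"
  proof
    have "submodule {c \<odot>\<^bsub>U\<^esub> \<one>\<^bsub>U\<^esub> | c. True} (base_field :: 'k ring) U"
    proof (rule U.submoduleI)
      show "\<zero>\<^bsub>U\<^esub> \<in> {c \<odot>\<^bsub>U\<^esub> \<one>\<^bsub>U\<^esub> | c. True}" by (auto intro!: exI[of _ 0])
    qed (auto simp: U.smult_smult simp flip: U.smult_l_distr)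
    moreover have "word [] \<in> {c \<odot>\<^bsub>U\<^esub> \<one>\<^bsub>U\<^esub> | c. True}" by (auto simp: word_Nil intro!: exI[of _ 1])
    ultimately show "filt U 0 \<subseteq> {c \<odot>\<^bsub>U\<^esub> \<one>\<^bsub>U\<^esub> | c. True}"
      unfolding filt_U by (intro span_words_minimal) simp_all
    show "{c \<odot>\<^bsub>U\<^esub> \<one>\<^bsub>U\<^esub> | c. True} \<subseteq> filt U 0"
      unfolding filt_U by (auto simp flip: word_Nil intro!: span_wordsD(4) word_in_span)
  qed
  show "filt U n \<subseteq> filt U (Suc n)" for n
    unfolding filt_U by (rule span_words_mono) simp
  show "(\<Union>n. filt U n) = carrier U"
    unfolding filt_U using span_words_exhaustive by auto
  show "\<lbrakk>x \<in> filt U i; y \<in> filt U j\<rbrakk> \<Longrightarrow> x \<otimes>\<^bsub>U\<^esub> y \<in> filt U (i + j)" for x y i j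
    unfolding filt_U by (rule span_words_mult)
  show "filt_one_ker U = primitives U" by (simp add: primitives_U)
  show "A = carrier U"
    if A: "subring A U" and smult: "\<And>c x. x \<in> A \<Longrightarrow> c \<odot>\<^bsub>U\<^esub> x \<in> A" and gen: "filt_one_ker U \<subseteq> A" for A
  proof
    show "A \<subseteq> carrier U" by (rule subringE(1)[OF A])
    have "word w \<in> A" if "w \<in> lists S" for w
      using that
    proof (induction w rule: list.induct)
      case Nil
      show ?case using subringE(3)[OF A] by (simp add: word_Nil)
    next
      case (Cons x w)
      then have "word [x] \<otimes>\<^bsub>U\<^esub> word w \<in> A"
        using gen by (intro subringE(6)[OF A]) (auto simp: filt_one_ker_U)
      then show ?case using Cons.prems by (simp add: word_Cons)
    qed
    moreover have "u \<in> A" if "u \<in> carrier U" "\<And>w. w \<in> lists S \<Longrightarrow> word w \<in> A" for u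
      using that by (induction rule: uea_induct) (auto intro: subringE(7)[OF A] smult)
    ultimately show "carrier U \<subseteq> A" by blast
  qed
  show "(x \<otimes>\<^bsub>U\<^esub> y) \<ominus>\<^bsub>U\<^esub> (y \<otimes>\<^bsub>U\<^esub> x) \<in> filt_one_ker U" if xy: "x \<in> filt_one_ker U" "y \<in> filt_one_ker U" for x y
  proof -
    obtain s t where st: "s \<in> S" "t \<in> S" "x = word [s]" "y = word [t]"
      using xy by (auto simp: filt_one_ker_U)
    have "word [s, t] \<ominus>\<^bsub>U\<^esub> word [t, s] = word [bracket \<gg> s t]"
      using uea_compatibleD(4)[OF word_compatible, of "[]" "[]" s t] st by (simp add: U.diff_simps U.a_ac)
    then show ?thesis using st by (auto simp: filt_one_ker_U word_Cons)
  qed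
qed (auto simp: tri_one_left tri_one_right comult_tri tri_mult filt_one_ker_U tri_assoc_U)

end

section \<open>Post-Lie algebras of primitive elements\<close>

lemma vspace_subspace:
  assumes "vspace V" and N: "submodule N (base_field :: 'k::field_char_0 ring) V"
    and eq: "carrier W = N" "add W = add V" "\<zero>\<^bsub>W\<^esub> = \<zero>\<^bsub>V\<^esub>" "module.smult W = module.smult (V :: ('k, 'a, 'm) module_scheme)"
  shows "vspace W"
proof -
  interpret vspace V by fact
  note D = submoduleD[OF N]
  have c: "x \<in> carrier V" if "x \<in> N" for x using that D(1) by blast
  have "abelian_group W"
  proof (rule abelian_groupI, unfold eq)
    fix x assume "x \<in> N"
    then show "\<exists>y\<in>N. y \<oplus>\<^bsub>V\<^esub> x = \<zero>\<^bsub>V\<^esub>"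
      by (intro bexI[of _ "\<ominus>\<^bsub>V\<^esub> x"]) (simp_all add: l_neg c D(6))
  qed (simp_all add: D(2,3) c a_ac)
  then show ?thesis
    by (intro vspace.intro vspace_axioms.intro)
      (simp_all add: eq c D(4) smult_l_distr smult_r_distr smult_smult)
qed

lemma D_bialgebra_homD:
  assumes "f \<in> D_bialgebra_hom D E"
  shows "f \<in> extensional (carrier D)" "linear_map D E f" "f \<one>\<^bsub>D\<^esub> = \<one>\<^bsub>E\<^esub>"
    "\<lbrakk>x \<in> carrier D; y \<in> carrier D\<rbrakk> \<Longrightarrow> f (x \<otimes>\<^bsub>D\<^esub> y) = f x \<otimes>\<^bsub>E\<^esub> f y"
    "x \<in> carrier D \<Longrightarrow> counit E (f x) = counit D x"
    "x \<in> carrier D \<Longrightarrow>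
      comult E (f x) = tensor_lift (tensor E E) (\<lambda>a b. pure_tensor E E (f a) (f b)) (comult D x)"
    "\<lbrakk>x \<in> carrier D; y \<in> carrier D\<rbrakk> \<Longrightarrow> f (x \<triangleright>\<^bsub>D\<^esub> y) = f x \<triangleright>\<^bsub>E\<^esub> f y"
  using assms by (simp_all add: D_bialgebra_hom_def)

lemma post_lie_homD:
  assumes "f \<in> post_lie_hom \<gg> \<hh>"
  shows "f \<in> extensional (carrier \<gg>)" "linear_map \<gg> \<hh> f"
    "\<lbrakk>x \<in> carrier \<gg>; y \<in> carrier \<gg>\<rbrakk> \<Longrightarrow> f (bracket \<gg> x y) = bracket \<hh> (f x) (f y)"
    "\<lbrakk>x \<in> carrier \<gg>; y \<in> carrier \<gg>\<rbrakk> \<Longrightarrow> f (x \<triangleright>\<^bsub>\<gg>\<^esub> y) = f x \<triangleright>\<^bsub>\<hh>\<^esub> f y"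
  using assms by (simp_all add: post_lie_hom_def)

lemma Prim_simps:
  "carrier (Prim D) = primitives D" "\<zero>\<^bsub>Prim D\<^esub> = \<zero>\<^bsub>D\<^esub>" "add (Prim D) = add D"
  "module.smult (Prim D) = module.smult D" "tri (Prim D) = tri D"
  "bracket (Prim D) x y = (x \<otimes>\<^bsub>D\<^esub> y) \<ominus>\<^bsub>D\<^esub> (y \<otimes>\<^bsub>D\<^esub> x)"
  by (simp_all add: Prim_def)

context D_bialgebra
begin

sublocale D: vspace D
  using module_axioms by (simp add: vspace_iff_module)

abbreviation "P \<equiv> primitives D"

sublocale T: tensor_product D D by (rule tensor_productI) (rule D.vspace_axioms)+
sublocale DD: vspace "tensor D D" by (rule T.vspace_tensor)

lemma mult_linear:
  "x \<in> carrier D \<Longrightarrow> linear_map D D (\<lambda>y. x \<otimes> y)" "y \<in> carrier D \<Longrightarrow> linear_map D D (\<lambda>x. x \<otimes> y)"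
  by (auto intro!: linear_mapI simp: r_distr l_distr smult_mult mult_smult)

lemma mult_bilinear: "bilinear_map D D D (monoid.mult D)"
  by (intro bilinear_mapI mult_linear)

lemmas mult_diff_right = linear_map_diffD[OF D.vspace_axioms D.vspace_axioms mult_linear(1)]
lemmas mult_diff_left = linear_map_diffD[OF D.vspace_axioms D.vspace_axioms mult_linear(2)]

lemma tri_linear:
  "x \<in> carrier D \<Longrightarrow> linear_map D D (\<lambda>y. x \<triangleright> y)" "y \<in> carrier D \<Longrightarrow> linear_map D D (\<lambda>x. x \<triangleright> y)"
  using tri_bilinear by (auto simp: bilinear_op_def)

lemmas tri_diff_right = linear_map_diffD[OF D.vspace_axioms D.vspace_axioms tri_linear(1)]
lemmas tri_diff_left = linear_map_diffD[OF D.vspace_axioms D.vspace_axioms tri_linear(2)]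

lemma tri_closed [simp]: "\<lbrakk>x \<in> carrier D; y \<in> carrier D\<rbrakk> \<Longrightarrow> x \<triangleright> y \<in> carrier D"
  using linear_mapD(1)[OF tri_linear(1)] .

lemma P_comult: "x \<in> P \<Longrightarrow> comult D x = pure_tensor D D x \<one> \<oplus>\<^bsub>tensor D D\<^esub> pure_tensor D D \<one> x"
  by (simp add: primitives_def)

lemma P_I:
  "\<lbrakk>x \<in> carrier D; comult D x = pure_tensor D D x \<one> \<oplus>\<^bsub>tensor D D\<^esub> pure_tensor D D \<one> x\<rbrakk> \<Longrightarrow> x \<in> P"
  by (simp add: primitives_def)

lemma P_closed [simp]: "x \<in> P \<Longrightarrow> x \<in> carrier D"
  by (simp add: primitives_def)

lemma P_counit: "x \<in> P \<Longrightarrow> counit D x = 0"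
  using D2_primitives by (auto simp: filt_one_ker_def)

lemma counit_zero: "counit D \<zero> = 0"
  using counit_smult[of "\<zero>" 0] by simp

text \<open>By (D2) the primitive elements are the part of \<open>filt D 1\<close> on which the
  counit vanishes, and there closure is immediate.\<close>

lemma P_submodule: "submodule P (base_field :: 'k ring) D"
proof -
  note F = D.submoduleD[OF filt_submodule[of 1]]
  show ?thesis
    unfolding D2_primitives[symmetric] filt_one_ker_def using F
    by (intro D.submoduleI) (auto simp: counit_add counit_smult counit_zero)
qed

lemma lift_comult_P:
  assumes "x \<in> P" "vspace Z" "bilinear_map D D Z b"
  shows "tensor_lift Z b (comult D x) = b x \<one> \<oplus>\<^bsub>Z\<^esub> b \<one> x"
  unfolding P_comult[OF assms(1)]
  using assms(1) linear_mapD(2)[OF T.tensor_lift_linear[OF assms(2,3)],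
      of "pure_tensor D D x \<one>" "pure_tensor D D \<one> x"]
  by (simp add: T.pure_closed T.tensor_lift_pure[OF assms(2,3)])

lemma tri_one_P: "x \<in> P \<Longrightarrow> x \<triangleright> \<one> = \<zero>"
  by (simp add: D1_right P_counit)

lemma tri_mult_P:
  assumes "x \<in> P" "y \<in> carrier D" "z \<in> carrier D"
  shows "x \<triangleright> (y \<otimes> z) = (x \<triangleright> y) \<otimes> z \<oplus> y \<otimes> (x \<triangleright> z)"
  using assms
  by (simp add: D4 D1_left lift_comult_P[OF assms(1) D.vspace_axioms
        bilinear_map_compose[OF mult_bilinear tri_linear(2) tri_linear(2)]])

text \<open>When (D3) is expanded for two primitive elements, both mixed terms contain the factor
  \<open>x \<triangleright> \<one>\<close>, which is zero by (D1).\<close>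

lemma tri_P:
  assumes "x \<in> P" "y \<in> P" shows "x \<triangleright> y \<in> P"
proof -
  have bil: "bilinear_map D D D (tri D)" using tri_bilinear by (simp add: bilinear_op_iff)
  note op = tensor_op_bilinear[OF D.vspace_axioms bil]
  note [simp] = linear_mapD(2)[OF bilinear_mapD(1)[OF op(1)]] linear_mapD(2)[OF bilinear_mapD(2)[OF op(1)]] T.pure_closed
  have "comult D (x \<triangleright> y) = pure_tensor D D (x \<triangleright> y) \<one> \<oplus>\<^bsub>tensor D D\<^esub> pure_tensor D D \<one> (x \<triangleright> y)"
    using assms
    by (simp add: D3 P_comult op(2) D1_left tri_one_P T.pure_zero_left T.pure_zero_right)
  then show ?thesis using assms by (intro P_I) simp_all
qed

lemma commutator_P: "\<lbrakk>x \<in> P; y \<in> P\<rbrakk> \<Longrightarrow> (x \<otimes> y) \<ominus> (y \<otimes> x) \<in> P"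
  using D6 by (simp add: D2_primitives)

lemma vspace_Prim: "vspace (Prim D)"
  by (rule vspace_subspace[OF D.vspace_axioms P_submodule]) (simp_all add: Prim_simps)

lemma linear_map_PrimI:
  "\<lbrakk>linear_map V D f; \<And>x. x \<in> carrier V \<Longrightarrow> f x \<in> P\<rbrakk> \<Longrightarrow> linear_map V (Prim D) f"
  by (auto simp: linear_map_def Prim_simps)

lemma linear_map_PrimD: "linear_map V (Prim D) f \<Longrightarrow> linear_map V D f"
  by (simp add: linear_map_def Prim_simps Pi_iff)

lemma linear_map_from_Prim: "linear_map D V f \<Longrightarrow> linear_map (Prim D) V f"
  by (auto simp: linear_map_def Prim_simps)

lemma Prim_minus: "\<lbrakk>x \<in> P; y \<in> P\<rbrakk> \<Longrightarrow> x \<ominus>\<^bsub>Prim D\<^esub> y = x \<ominus> y"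
  using linear_map_diffD[OF vspace_Prim D.vspace_axioms linear_map_from_Prim[OF linear_map_id], of x y]
  by (simp add: Prim_simps)

text \<open>The axioms have separate sources: the Lie axioms come from associativity, closure from
  (D3) and (D6), \<open>tri_bracket\<close> from the Leibniz rule that (D4) gives for primitive
  elements, and \<open>bracket_tri\<close> from (D5) antisymmetrized in x and y.\<close>

lemma post_lie_algebra_Prim: "post_lie_algebra (Prim D)"
proof (intro post_lie_algebra.intro post_lie_algebra_axioms.intro)
  show "module (base_field :: 'k ring) (Prim D)" using vspace_Prim by (simp add: vspace_iff_module)
  show "bilinear_op (Prim D) (bracket (Prim D))"
    unfolding bilinear_op_iff Prim_simps(6)[abs_def]
    by (intro bilinear_mapI linear_map_PrimI linear_map_from_Prim linear_map_diff D.vspace_axioms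
        mult_linear commutator_P) (simp_all add: Prim_simps)
  show "bilinear_op (Prim D) (tri (Prim D))"
    unfolding bilinear_op_iff Prim_simps(5)
    by (intro bilinear_mapI linear_map_PrimI linear_map_from_Prim tri_linear tri_P) (simp_all add: Prim_simps)
  fix x assume "x \<in> carrier (Prim D)"
  then have x [simp]: "x \<in> P" by (simp add: Prim_simps)
  show "bracket (Prim D) x x = \<zero>\<^bsub>Prim D\<^esub>"
    by (simp add: Prim_simps D.diff_simps)
  fix y z assume "y \<in> carrier (Prim D)" "z \<in> carrier (Prim D)"
  then have yz [simp]: "y \<in> P" "z \<in> P" by (simp_all add: Prim_simps)
  show "bracket (Prim D) x (bracket (Prim D) y z) \<oplus>\<^bsub>Prim D\<^esub>
      bracket (Prim D) y (bracket (Prim D) z x) \<oplus>\<^bsub>Prim D\<^esub>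
      bracket (Prim D) z (bracket (Prim D) x y) = \<zero>\<^bsub>Prim D\<^esub>"
    by (simp add: Prim_simps mult_diff_left mult_diff_right m_assoc D.diff_simps M.a_ac)
  show "z \<triangleright>\<^bsub>Prim D\<^esub> bracket (Prim D) x y =
      bracket (Prim D) (z \<triangleright>\<^bsub>Prim D\<^esub> x) y \<oplus>\<^bsub>Prim D\<^esub> bracket (Prim D) x (z \<triangleright>\<^bsub>Prim D\<^esub> y)"
    by (simp add: Prim_simps tri_diff_right tri_mult_P D.diff_simps M.a_ac)
  have D5': "(a \<otimes> b) \<triangleright> c = a \<triangleright> (b \<triangleright> c) \<ominus> (a \<triangleright> b) \<triangleright> c" if "a \<in> P" "b \<in> P" "c \<in> P" for a b c
    using D5 that by (simp add: D2_primitives)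
  have "a \<ominus> b \<in> P" if "a \<in> P" "b \<in> P" for a b using D.submoduleD(5)[OF P_submodule that] .
  then show "bracket (Prim D) x y \<triangleright>\<^bsub>Prim D\<^esub> z = tri_assoc (Prim D) x y z \<ominus>\<^bsub>Prim D\<^esub> tri_assoc (Prim D) y x z"
    by (simp add: tri_assoc_def Prim_simps Prim_minus tri_P D5' tri_diff_left)
qed

text \<open>Morphisms preserve the coproduct and the unit, hence primitivity. That part is also
  stated by itself, because composites with \<open>Prim_map\<close> are meaningful only at primitive
  elements.\<close>

lemma Prim_map_hom:
  assumes E: "D_bialgebra E" and f: "f \<in> D_bialgebra_hom D E"
  shows "Prim_map D f \<in> post_lie_hom (Prim D) (Prim E)" and "x \<in> P \<Longrightarrow> f x \<in> primitives E"
proof -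
  interpret E: D_bialgebra E by fact
  note f = D_bialgebra_homD[OF f]
  have bil: "bilinear_map D D (tensor E E) (\<lambda>a b. pure_tensor E E (f a) (f b))"
    by (rule bilinear_map_compose[OF E.T.pure_bilinear f(2) f(2)])
  show P: "f x \<in> primitives E" if "x \<in> P" for x
    using that linear_mapD(1)[OF f(2)]
    by (intro E.P_I) (simp_all add: f(3,6) lift_comult_P[OF that E.DD.vspace_axioms bil])
  have diff: "f (x \<ominus> y) = f x \<ominus>\<^bsub>E\<^esub> f y" if "x \<in> carrier D" "y \<in> carrier D" for x y
    using that by (rule linear_map_diffD[OF D.vspace_axioms E.D.vspace_axioms f(2)])
  have "linear_map (Prim D) (Prim E) (Prim_map D f)"
    by (rule linear_map_cong[OF vspace_Prim E.linear_map_PrimI[OF linear_map_from_Prim[OF f(2)]]])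
      (simp_all add: Prim_simps P Prim_map_def)
  then show "Prim_map D f \<in> post_lie_hom (Prim D) (Prim E)"
    by (auto simp: post_lie_hom_def Prim_simps Prim_map_def commutator_P tri_P diff f(4,7))
qed

lemma Prim_map_id: "Prim_map D (\<lambda>x\<in>carrier D. x) = (\<lambda>x\<in>carrier (Prim D). x)"
  by (auto simp: Prim_map_def Prim_simps restrict_def fun_eq_iff)

lemma Prim_map_compose:
  assumes "D_bialgebra E" "f \<in> D_bialgebra_hom D E"
  shows "Prim_map D (compose (carrier D) h f) = compose (carrier (Prim D)) (Prim_map E h) (Prim_map D f)"
  using Prim_map_hom(2)[OF assms] by (auto simp: Prim_map_def Prim_simps compose_def restrict_def fun_eq_iff)

end


section \<open>The adjunction\<close>

context post_lie_algebra
begin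

lemma unit_primitive [simp]: "x \<in> S \<Longrightarrow> word [x] \<in> primitives U"
  by (simp add: primitives_U filt_one_ker_U)

lemma transpose_hom_apply: "x \<in> S \<Longrightarrow> transpose_hom \<gg> f x = f (word [x])"
  by (simp add: transpose_hom_def compose_def Prim_map_def UEA_unit_def)

lemma transpose_hom_extensional: "transpose_hom \<gg> f \<in> extensional S"
  by (simp add: transpose_hom_def)

lemma word_bracket_commutator:
  "\<lbrakk>x \<in> S; y \<in> S\<rbrakk> \<Longrightarrow> word [bracket \<gg> x y] = (word [x] \<otimes>\<^bsub>U\<^esub> word [y]) \<ominus>\<^bsub>U\<^esub> (word [y] \<otimes>\<^bsub>U\<^esub> word [x])"
  using uea_compatibleD(4)[OF word_compatible, of "[]" "[]" x y]
  by (simp add: word_Cons U.diff_simps U.a_ac)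

lemma word_tri: "\<lbrakk>x \<in> S; y \<in> S\<rbrakk> \<Longrightarrow> word [x \<triangleright> y] = word [x] \<triangleright>\<^bsub>U\<^esub> word [y]"
  by (simp add: tri_U_word M_simps)

lemma transpose_hom_hom:
  assumes D: "D_bialgebra D" and f: "f \<in> D_bialgebra_hom U D"
  shows "transpose_hom \<gg> f \<in> post_lie_hom \<gg> (Prim D)"
proof -
  interpret D: D_bialgebra D by fact
  note fD = D_bialgebra_homD[OF f]
  have P: "f (word [x]) \<in> primitives D" if "x \<in> S" for x
    using that by (intro D_bialgebra.Prim_map_hom(2)[OF D_bialgebra_UEA D f]) simp
  have "linear_map \<gg> (Prim D) (transpose_hom \<gg> f)"
    by (rule linear_map_cong[OF g.vspace_axioms
          D.linear_map_PrimI[OF linear_map_compose[OF word_singleton_linear fD(2)]]])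
      (simp_all add: P transpose_hom_apply)
  moreover have "f (word [x] \<otimes>\<^bsub>U\<^esub> word [y] \<ominus>\<^bsub>U\<^esub> word [y] \<otimes>\<^bsub>U\<^esub> word [x]) =
      f (word [x]) \<otimes>\<^bsub>D\<^esub> f (word [y]) \<ominus>\<^bsub>D\<^esub> f (word [y]) \<otimes>\<^bsub>D\<^esub> f (word [x])"
    if "x \<in> S" "y \<in> S" for x y
    using that linear_map_diffD[OF U.vspace_axioms D.D.vspace_axioms fD(2)] by (simp add: fD(4))
  ultimately show ?thesis
    by (auto simp: post_lie_hom_def transpose_hom_extensional transpose_hom_apply Prim_simps
        word_bracket_commutator word_tri fD(7))
qed

section \<open>Extending a post-Lie morphism to the enveloping algebra\<close>

definition extend_word :: "('k, 'd) D_bialg \<Rightarrow> ('g \<Rightarrow> 'd) \<Rightarrow> 'g list \<Rightarrow> 'd"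
  where "extend_word D \<phi> w = foldr (\<lambda>x. monoid.mult D (\<phi> x)) w \<one>\<^bsub>D\<^esub>"

text \<open>The inverse of \<open>transpose_hom\<close>, obtained from the universal property of
  U(g). The restriction makes it extensional, as morphisms are required to be.\<close>

definition extend :: "('k, 'd) D_bialg \<Rightarrow> ('g \<Rightarrow> 'd) \<Rightarrow> ('k, 'g) uea \<Rightarrow> 'd"
  where "extend D \<phi> = (\<lambda>u\<in>carrier U. induced_map D (extend_word D \<phi>) u)"

context
  fixes D :: "('k, 'd) D_bialg" and \<phi>
  assumes D: "D_bialgebra D" and \<phi>: "\<phi> \<in> post_lie_hom \<gg> (Prim D)"
begin

interpretation D: D_bialgebra D by (rule D)

abbreviation "e \<equiv> extend_word D \<phi>"
abbreviation "E \<equiv> extend D \<phi>"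

lemmas \<phi>D = post_lie_homD[OF \<phi>]
lemmas phi_linear = D.linear_map_PrimD[OF \<phi>D(2)]

lemma phi_P [simp]: "x \<in> S \<Longrightarrow> \<phi> x \<in> primitives D"
  using linear_mapD(1)[OF \<phi>D(2)] by (simp add: Prim_simps)

lemma e_simps: "e [] = \<one>\<^bsub>D\<^esub>" "e (x # w) = \<phi> x \<otimes>\<^bsub>D\<^esub> e w"
  by (simp_all add: extend_word_def)

text \<open>Since \<phi> maps brackets to commutators, the left multiplications by
  \<open>\<phi> x\<close> form a representation of the Lie algebra on D.\<close>

lemma e_compatible: "uea_compatible \<gg> D e"
  unfolding extend_word_def[abs_def]
proof (rule foldr_compatible[OF D.D.vspace_axioms])
  show "linear_map D D ((\<otimes>\<^bsub>D\<^esub>) (\<phi> x))" if "x \<in> S" for x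
    using that by (intro D.mult_linear) simp
  show "linear_map \<gg> D (\<lambda>x. \<phi> x \<otimes>\<^bsub>D\<^esub> v)" if "v \<in> carrier D" for v
    by (rule linear_map_compose[OF phi_linear D.mult_linear(2)[OF that]])
  show "\<phi> x \<otimes>\<^bsub>D\<^esub> (\<phi> y \<otimes>\<^bsub>D\<^esub> v) = \<phi> y \<otimes>\<^bsub>D\<^esub> (\<phi> x \<otimes>\<^bsub>D\<^esub> v) \<oplus>\<^bsub>D\<^esub> \<phi> (bracket \<gg> x y) \<otimes>\<^bsub>D\<^esub> v"
    if "x \<in> S" "y \<in> S" "v \<in> carrier D" for x y v
    using that by (simp add: \<phi>D(3) Prim_simps D.mult_diff_left D.m_assoc D.D.diff_simps D.M.a_ac)
qed simp

lemma e_closed [simp]: "w \<in> lists S \<Longrightarrow> e w \<in> carrier D"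
  by (rule uea_compatibleD(1)[OF e_compatible])

lemma e_append: "\<lbrakk>u \<in> lists S; v \<in> lists S\<rbrakk> \<Longrightarrow> e (u @ v) = e u \<otimes>\<^bsub>D\<^esub> e v"
  by (induction u rule: list.induct) (simp_all add: e_simps D.m_assoc)

lemma E_linear: "linear_map U D E"
  by (rule linear_map_cong[OF U.vspace_axioms uea_lift_linear[OF D.D.vspace_axioms e_compatible]])
    (simp add: extend_def)

lemma E_word [simp]: "w \<in> lists S \<Longrightarrow> E (word w) = e w"
  by (simp add: extend_def uea_lift_word[OF D.D.vspace_axioms e_compatible])

lemma E_closed [simp]: "u \<in> carrier U \<Longrightarrow> E u \<in> carrier D"
  by (rule linear_mapD(1)[OF E_linear])

lemma counit_e: "w \<in> lists S \<Longrightarrow> counit D (e w) = (if w = [] then 1 else 0)"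
  by (cases w) (simp_all add: e_simps D.counit_one D.counit_mult D.P_counit)

text \<open>The same expansion as in U(g), with the primitive elements \<open>\<phi> x\<close> in
  place of letters.\<close>

lemma comult_e:
  assumes "w \<in> lists S"
  shows "comult D (e w) = unshuffle (tensor D D) w (\<lambda>u v. pure_tensor D D (e u) (e v))"
  using assms
proof (induction w rule: list.induct)
  case Nil
  show ?case by (simp add: e_simps D.comult_one)
next
  case (Cons x w)
  then have [simp]: "x \<in> S" "w \<in> lists S" by auto
  note op = tensor_op_bilinear[OF D.D.vspace_axioms D.mult_bilinear]
  note [simp] = D.T.pure_closed linear_mapD(2)[OF bilinear_mapD(2)[OF op(1)]]
  let ?\<delta> = "pure_tensor D D (\<phi> x) \<one>\<^bsub>D\<^esub> \<oplus>\<^bsub>tensor D D\<^esub> pure_tensor D D \<one>\<^bsub>D\<^esub> (\<phi> x)"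
  have "comult D (e (x # w)) = tensor_op D (monoid.mult D) (comult D (\<phi> x)) (comult D (e w))"
    by (simp add: e_simps D.comult_mult)
  also have "comult D (\<phi> x) = ?\<delta>"
    by (rule D.P_comult) simp
  also have "tensor_op D (monoid.mult D) ?\<delta> (comult D (e w)) =
      unshuffle (tensor D D) w (\<lambda>u v. tensor_op D (monoid.mult D) ?\<delta> (pure_tensor D D (e u) (e v)))"
    unfolding Cons.IH[OF \<open>w \<in> lists S\<close>]
    by (intro linear.unshuffle[OF linearI[OF D.DD.vspace_axioms D.DD.vspace_axioms
            bilinear_mapD(1)[OF op(1)]], where S = S]) simp_all
  also have "\<dots> = unshuffle (tensor D D) w (\<lambda>u v. pure_tensor D D (e (x # u)) (e v) \<oplus>\<^bsub>tensor D D\<^esub>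
      pure_tensor D D (e u) (e (x # v)))"
    by (intro unshuffle_cong[where S = S]) (simp_all add: op(2) e_simps)
  also have "\<dots> = unshuffle (tensor D D) (x # w) (\<lambda>u v. pure_tensor D D (e u) (e v))"
    by (simp add: D.DD.unshuffle_add[where S = S] e_simps)
  finally show ?case .
qed

text \<open>A primitive element acts on products as a derivation by \<open>tri_mult_P\<close>, and
  on letters \<phi> commutes with \<triangleright>.\<close>

lemma phi_tri_e:
  assumes x: "x \<in> S" and "w \<in> lists S"
  shows "\<phi> x \<triangleright>\<^bsub>D\<^esub> e w = derive_word D (tri \<gg> x) w e"
  using assms(2)
proof (induction w rule: list.induct)
  case Nil
  show ?case using x by (simp add: e_simps D.tri_one_P)
next
  case (Cons y w)
  then have [simp]: "y \<in> S" "w \<in> lists S" by auto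
  have "\<phi> y \<otimes>\<^bsub>D\<^esub> derive_word D (tri \<gg> x) w e = derive_word D (tri \<gg> x) w (\<lambda>v. \<phi> y \<otimes>\<^bsub>D\<^esub> e v)"
    using x by (intro linear.derive_word[OF linearI[OF D.D.vspace_axioms D.D.vspace_axioms
            D.mult_linear(1)], where S = S]) simp_all
  then show ?case
    using x Cons.IH by (simp add: e_simps(2)[abs_def] D.tri_mult_P \<phi>D(4) Prim_simps)
qed

text \<open>For products of primitive elements (D5) is the very recursion that defines T; the
  derivative terms of that recursion are matched by \<open>phi_tri_e\<close>.\<close>

lemma phi_T:
  assumes "w \<in> lists S" "y \<in> S"
  shows "\<phi> (T w y) = e w \<triangleright>\<^bsub>D\<^esub> \<phi> y"
  using assms(1)
proof (induction "length w" arbitrary: w)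
  case 0
  then show ?case using assms(2) by (simp add: e_simps D.D1_left)
next
  case (Suc n)
  then obtain x w' where w: "w = x # w'" "x \<in> S" "w' \<in> lists S" "length w' = n" by (cases w) auto
  note [simp] = w(2,3) assms(2)
  have IH: "\<phi> (T u y) = e u \<triangleright>\<^bsub>D\<^esub> \<phi> y" if "u \<in> lists S" "length u = n" for u
    using Suc.hyps(1)[of u] that by simp
  let ?D = "derive_word \<gg> (tri \<gg> x) w' (\<lambda>u. T u y)"
  have [simp]: "?D \<in> S" by (intro g.derive_word_closed[where S = S]) simp_all
  have "(\<phi> x \<triangleright>\<^bsub>D\<^esub> e w') \<triangleright>\<^bsub>D\<^esub> \<phi> y = derive_word D (tri \<gg> x) w' (\<lambda>u. e u \<triangleright>\<^bsub>D\<^esub> \<phi> y)"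
    unfolding phi_tri_e[OF w(2,3)]
    by (intro linear.derive_word[OF linearI[OF D.D.vspace_axioms D.D.vspace_axioms D.tri_linear(2)], where S = S]) simp_all
  also have "\<dots> = derive_word D (tri \<gg> x) w' (\<lambda>u. \<phi> (T u y))"
    using w by (intro derive_word_cong[where S = S] IH[symmetric]) simp_all
  also have "\<dots> = \<phi> ?D"
    by (rule linear.derive_word[OF linearI[OF g.vspace_axioms D.D.vspace_axioms phi_linear], where S = S, symmetric]) simp_all
  finally have D: "(\<phi> x \<triangleright>\<^bsub>D\<^esub> e w') \<triangleright>\<^bsub>D\<^esub> \<phi> y = \<phi> ?D" .
  have "e w \<triangleright>\<^bsub>D\<^esub> \<phi> y = \<phi> x \<triangleright>\<^bsub>D\<^esub> (e w' \<triangleright>\<^bsub>D\<^esub> \<phi> y) \<ominus>\<^bsub>D\<^esub> (\<phi> x \<triangleright>\<^bsub>D\<^esub> e w') \<triangleright>\<^bsub>D\<^esub> \<phi> y"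
    unfolding w(1) e_simps by (rule D.D5) (simp_all add: D.D2_primitives)
  also have "\<dots> = \<phi> (x \<triangleright> T w' y) \<ominus>\<^bsub>D\<^esub> \<phi> ?D"
    unfolding D using IH[OF w(3,4)] by (simp add: \<phi>D(4) Prim_simps)
  also have "\<dots> = \<phi> (T w y)"
    unfolding w(1) using linear_map_diffD[OF g.vspace_axioms D.D.vspace_axioms phi_linear] by (simp add: T_Cons)
  finally show ?case ..
qed

text \<open>(D4) peels one letter off \<open>ys\<close> just as the recursion of M does:
  \<open>comult_e\<close> matches the splittings of w, and \<open>phi_T\<close> settles the
  letter.\<close>

lemma E_M:
  assumes "w \<in> lists S" "ys \<in> lists S"
  shows "E (M (word w) ys) = e w \<triangleright>\<^bsub>D\<^esub> e ys"
  using assms(2,1)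
proof (induction ys arbitrary: w rule: list.induct)
  case Nil
  have "E \<one>\<^bsub>U\<^esub> = \<one>\<^bsub>D\<^esub>" using E_word[of "[]"] by (simp add: word_Nil e_simps)
  then show ?case
    using Nil linear_map_zeroD[OF U.vspace_axioms D.D.vspace_axioms E_linear]
    by (simp add: M_word_Nil e_simps D.D1_right counit_e)
next
  case (Cons y ys)
  then have [simp]: "y \<in> S" "ys \<in> lists S" "w \<in> lists S" by auto
  note [simp] = D.T.pure_closed
  have b: "bilinear_map D D D (\<lambda>a b. (a \<triangleright>\<^bsub>D\<^esub> \<phi> y) \<otimes>\<^bsub>D\<^esub> (b \<triangleright>\<^bsub>D\<^esub> e ys))"
    by (intro bilinear_map_compose[OF D.mult_bilinear] D.tri_linear) simp_all
  have "e w \<triangleright>\<^bsub>D\<^esub> e (y # ys) = tensor_lift D (\<lambda>a b. (a \<triangleright>\<^bsub>D\<^esub> \<phi> y) \<otimes>\<^bsub>D\<^esub> (b \<triangleright>\<^bsub>D\<^esub> e ys)) (comult D (e w))"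
    unfolding e_simps by (rule D.D4) simp_all
  also have "\<dots> = unshuffle D w (\<lambda>u v. tensor_lift D (\<lambda>a b. (a \<triangleright>\<^bsub>D\<^esub> \<phi> y) \<otimes>\<^bsub>D\<^esub> (b \<triangleright>\<^bsub>D\<^esub> e ys)) (pure_tensor D D (e u) (e v)))"
    unfolding comult_e[OF \<open>w \<in> lists S\<close>]
    by (intro linear.unshuffle[OF linearI[OF D.DD.vspace_axioms D.D.vspace_axioms
            D.T.tensor_lift_linear[OF D.D.vspace_axioms b]], where S = S]) simp_all
  also have "\<dots> = unshuffle D w (\<lambda>u v. E (word [T u y] \<otimes>\<^bsub>U\<^esub> M (word v) ys))"
  proof (rule unshuffle_cong[where S = S])
    fix u v assume [simp]: "u \<in> lists S" "v \<in> lists S"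
    \<comment> \<open>Multiplicativity of E for a letter as left factor is enough here; the general
      case is part of \<open>extend_hom\<close>.\<close>
    have mult: "E (word [t] \<otimes>\<^bsub>U\<^esub> a) = \<phi> t \<otimes>\<^bsub>D\<^esub> E a" if "t \<in> S" "a \<in> carrier U" for t a
      by (rule uea_ext[OF linear_map_compose[OF mult_linear(1) E_linear]
            linear_map_compose[OF E_linear D.mult_linear(1)] _ that(2)])
        (use that in \<open>simp_all add: word_Cons e_simps\<close>)
    show "tensor_lift D (\<lambda>a b. (a \<triangleright>\<^bsub>D\<^esub> \<phi> y) \<otimes>\<^bsub>D\<^esub> (b \<triangleright>\<^bsub>D\<^esub> e ys)) (pure_tensor D D (e u) (e v)) =
        E (word [T u y] \<otimes>\<^bsub>U\<^esub> M (word v) ys)"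
      using Cons.IH[of v] by (simp add: D.T.tensor_lift_pure[OF D.D.vspace_axioms b] mult phi_T)
  qed simp
  also have "\<dots> = E (M (word w) (y # ys))"
    by (subst M_word_Cons) (simp_all add: linear.unshuffle[OF linearI[OF U.vspace_axioms
            D.D.vspace_axioms E_linear], where S = S])
  finally show ?case ..
qed

lemma extend_hom: "E \<in> D_bialgebra_hom U D"
proof -
  have bil: "bilinear_map U U (tensor D D) (\<lambda>a b. pure_tensor D D (E a) (E b))"
    by (rule bilinear_map_compose[OF D.T.pure_bilinear E_linear E_linear])
  have "counit D (E u) = counit U u" if "u \<in> carrier U" for u
    using that
  proof (induction rule: uea_induct)
    case (word w)
    then show ?case by (simp add: counit_e counit_word)
  qed (simp_all add: linear_mapD[OF E_linear] D.counit_add D.counit_smult counit_simps)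
  moreover have "E (u \<otimes>\<^bsub>U\<^esub> v) = E u \<otimes>\<^bsub>D\<^esub> E v" if "u \<in> carrier U" "v \<in> carrier U" for u v
    by (rule uea_ext2[OF bilinear_map_linear[OF mult_bilinear E_linear]
          bilinear_map_compose[OF D.mult_bilinear E_linear E_linear] _ that])
      (simp add: word_append e_append)
  moreover have "E (u \<triangleright>\<^bsub>U\<^esub> v) = E u \<triangleright>\<^bsub>D\<^esub> E v" if "u \<in> carrier U" "v \<in> carrier U" for u v
    by (rule uea_ext2[OF bilinear_map_linear[OF tri_U_bilinear E_linear]
          bilinear_map_compose[OF D.tri_bilinear[unfolded bilinear_op_iff] E_linear E_linear] _ that])
      (simp add: tri_U_word E_M)
  moreover have "comult D (E u) = tensor_lift (tensor D D) (\<lambda>a b. pure_tensor D D (E a) (E b)) (comult U u)"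
    if "u \<in> carrier U" for u
  proof (rule uea_ext[OF linear_map_compose[OF E_linear D.comult_linear]
        lift_comult_linear[OF D.DD.vspace_axioms bil] _ that])
    fix w assume [simp]: "w \<in> lists S"
    show "comult D (E (word w)) =
        tensor_lift (tensor D D) (\<lambda>a b. pure_tensor D D (E a) (E b)) (comult U (word w))"
      unfolding lift_comult_word[OF D.DD.vspace_axioms bil \<open>w \<in> lists S\<close>]
      by (simp add: comult_e) (intro unshuffle_cong[where S = S], simp_all)
  qed
  moreover have "E \<one>\<^bsub>U\<^esub> = \<one>\<^bsub>D\<^esub>" using E_word[of "[]"] by (simp add: word_Nil e_simps)
  moreover have "E \<in> extensional (carrier U)" by (simp add: extend_def)
  ultimately show ?thesis using E_linear by (simp add: D_bialgebra_hom_def)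
qed

lemma extend_word_singleton: "x \<in> S \<Longrightarrow> E (word [x]) = \<phi> x"
  by (simp add: e_simps)

lemma transpose_extend: "transpose_hom \<gg> E = \<phi>"
  by (rule extensionalityI[OF transpose_hom_extensional \<phi>D(1)])
    (simp add: transpose_hom_apply extend_word_singleton del: E_word)

end

lemma hom_ext:
  assumes D: "D_bialgebra D" and f: "f \<in> D_bialgebra_hom U D" and h: "h \<in> D_bialgebra_hom U D"
    and eq: "\<And>x. x \<in> S \<Longrightarrow> f (word [x]) = h (word [x])"
  shows "f = h"
proof -
  note fD = D_bialgebra_homD[OF f] and hD = D_bialgebra_homD[OF h]
  have words: "f (word w) = h (word w)" if "w \<in> lists S" for w
    using that
  proof (induction w rule: list.induct)
    case Nil
    show ?case by (simp add: word_Nil fD hD)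
  next
    case (Cons x w)
    then show ?case using fD(4)[of "word [x]" "word w"] hD(4)[of "word [x]" "word w"] by (simp add: word_Cons eq)
  qed
  show ?thesis
    by (rule extensionalityI[OF fD(1) hD(1)]) (rule uea_ext[OF fD(2) hD(2) words])
qed

lemma transpose_hom_bij:
  assumes D: "D_bialgebra D"
  shows "bij_betw (transpose_hom \<gg>) (D_bialgebra_hom U D) (post_lie_hom \<gg> (Prim D))"
proof (rule bij_betwI[where g = "extend D"])
  show "transpose_hom \<gg> \<in> D_bialgebra_hom U D \<rightarrow> post_lie_hom \<gg> (Prim D)"
    using transpose_hom_hom[OF D] by blast
  show "extend D \<in> post_lie_hom \<gg> (Prim D) \<rightarrow> D_bialgebra_hom U D"
    using extend_hom[OF D] by blast
  show "transpose_hom \<gg> (extend D \<phi>) = \<phi>" if "\<phi> \<in> post_lie_hom \<gg> (Prim D)" for \<phi>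
    by (rule transpose_extend[OF D that])
  fix f assume f: "f \<in> D_bialgebra_hom U D"
  note t = transpose_hom_hom[OF D f]
  show "extend D (transpose_hom \<gg> f) = f"
    by (rule hom_ext[OF D extend_hom[OF D t] f])
      (simp add: extend_word_singleton[OF D t] transpose_hom_apply)
qed

text \<open>The action of the functor on morphisms is recovered from the adjunction: \<phi> followed
  by the unit of \<open>\<hh>\<close> is a post-Lie morphism into \<open>Prim (UEA \<hh>)\<close>,
  and its extension is \<open>UEA_map\<close>. That \<open>UEA_map\<close> respects \<triangleright>
  then needs no new calculation.\<close>

lemma UEA_map_eq_extend:
  assumes \<hh>: "post_lie_algebra \<hh>" and \<phi>: "\<phi> \<in> post_lie_hom \<gg> \<hh>"
  defines "\<phi>' \<equiv> \<lambda>x\<in>S. uea_word \<hh> [\<phi> x]"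
  shows "\<phi>' \<in> post_lie_hom \<gg> (Prim (UEA \<hh>))" and "UEA_map \<gg> \<hh> \<phi> = extend (UEA \<hh>) \<phi>'"
    and "w \<in> lists S \<Longrightarrow> uea_word \<hh> (map \<phi> w) = extend_word (UEA \<hh>) \<phi>' w"
proof -
  interpret h: post_lie_algebra \<hh> by fact
  interpret H: D_bialgebra "UEA \<hh>" by (rule h.D_bialgebra_UEA)
  note \<phi>D = post_lie_homD[OF \<phi>]
  have \<phi>c [simp]: "\<phi> x \<in> carrier \<hh>" if "x \<in> S" for x using linear_mapD(1)[OF \<phi>D(2) that] .
  have "linear_map \<gg> (Prim (UEA \<hh>)) \<phi>'"
    by (rule linear_map_cong[OF g.vspace_axioms
          H.linear_map_PrimI[OF linear_map_compose[OF \<phi>D(2) h.word_singleton_linear]]])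
      (simp_all add: \<phi>'_def)
  then show "\<phi>' \<in> post_lie_hom \<gg> (Prim (UEA \<hh>))"
    by (auto simp: post_lie_hom_def \<phi>'_def Prim_simps \<phi>D(3,4) h.word_bracket_commutator h.word_tri)
  have map: "map \<phi> w \<in> lists (carrier \<hh>)" if "w \<in> lists S" for w
    using that by (induction w rule: list.induct) simp_all
  show words: "uea_word \<hh> (map \<phi> w) = extend_word (UEA \<hh>) \<phi>' w" if "w \<in> lists S" for w
    using that
  proof (induction w rule: list.induct)
    case (Cons x w)
    then show ?case using map[of w] h.word_Cons[of "\<phi> x" "map \<phi> w"] by (simp add: extend_word_def \<phi>'_def)
  qed (simp add: extend_word_def h.word_Nil)
  show "UEA_map \<gg> \<hh> \<phi> = extend (UEA \<hh>) \<phi>'"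
    unfolding UEA_map_def extend_def
  proof (rule restrict_ext)
    fix u assume u: "u \<in> carrier U"
    show "induced_map (UEA \<hh>) (\<lambda>w. uea_word \<hh> (map \<phi> w)) u = induced_map (UEA \<hh>) (extend_word (UEA \<hh>) \<phi>') u"
      \<comment> \<open>The two functions are compared on words over \<open>S\<close>, which covers
        the support of the chosen representative.\<close>
      unfolding induced_map_def linear_extension_def
      using uea_rep_keys[OF u] map
      by (intro h.U.add.finprod_cong') (auto simp: words[symmetric] subset_eq)
  qed
qed

lemma UEA_map_hom:
  assumes "post_lie_algebra \<hh>" "\<phi> \<in> post_lie_hom \<gg> \<hh>"
  shows "UEA_map \<gg> \<hh> \<phi> \<in> D_bialgebra_hom U (UEA \<hh>)"
  unfolding UEA_map_eq_extend(2)[OF assms]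
  by (rule extend_hom[OF post_lie_algebra.D_bialgebra_UEA[OF assms(1)] UEA_map_eq_extend(1)[OF assms]])

lemma UEA_map_word:
  assumes "post_lie_algebra \<hh>" "\<phi> \<in> post_lie_hom \<gg> \<hh>" "w \<in> lists S"
  shows "UEA_map \<gg> \<hh> \<phi> (word w) = uea_word \<hh> (map \<phi> w)"
  unfolding UEA_map_eq_extend(2,3)[OF assms(1,2)] UEA_map_eq_extend(3)[OF assms]
  by (rule E_word[OF post_lie_algebra.D_bialgebra_UEA[OF assms(1)] UEA_map_eq_extend(1)[OF assms(1,2)] assms(3)])

end

section \<open>Functoriality and naturality\<close>

lemma linear_map_restrict:
  assumes "vspace V" "linear_map V W f" shows "linear_map V W (restrict f (carrier V))"
  by (rule linear_map_cong[OF assms]) simp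

lemma UEA_map_id:
  assumes "post_lie_algebra \<gg>"
  shows "UEA_map \<gg> \<gg> (\<lambda>x\<in>carrier \<gg>. x) = (\<lambda>x\<in>carrier (UEA \<gg>). x)"
proof -
  interpret post_lie_algebra \<gg> by fact
  have id: "(\<lambda>x\<in>S. x) \<in> post_lie_hom \<gg> \<gg>"
    using linear_map_restrict[OF g.vspace_axioms linear_map_id] by (auto simp: post_lie_hom_def)
  note hom = D_bialgebra_homD[OF UEA_map_hom[OF assms id]]
  have "map (\<lambda>x\<in>S. x) w = w" if "w \<in> lists S" for w
    using that by (induction w rule: list.induct) simp_all
  then have "UEA_map \<gg> \<gg> (\<lambda>x\<in>S. x) u = u" if "u \<in> carrier U" for u
    by (intro uea_ext[OF hom(2) linear_map_id _ that]) (simp add: UEA_map_word[OF assms id])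
  then show ?thesis
    by (intro extensionalityI[OF hom(1) restrict_extensional]) simp
qed

lemma post_lie_hom_compose:
  assumes "vspace \<gg>" and \<phi>: "\<phi> \<in> post_lie_hom \<gg> \<hh>" and \<psi>: "\<psi> \<in> post_lie_hom \<hh> \<kk>"
    and closed: "\<And>x y. \<lbrakk>x \<in> carrier \<gg>; y \<in> carrier \<gg>\<rbrakk> \<Longrightarrow> bracket \<gg> x y \<in> carrier \<gg> \<and> x \<triangleright>\<^bsub>\<gg>\<^esub> y \<in> carrier \<gg>"
  shows "compose (carrier \<gg>) \<psi> \<phi> \<in> post_lie_hom \<gg> \<kk>"
proof -
  note \<phi>D = post_lie_homD[OF \<phi>] and \<psi>D = post_lie_homD[OF \<psi>]
  have "linear_map \<gg> \<kk> (compose (carrier \<gg>) \<psi> \<phi>)"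
    by (rule linear_map_cong[OF assms(1) linear_map_compose[OF \<phi>D(2) \<psi>D(2)]]) (simp add: compose_def)
  moreover have "\<phi> x \<in> carrier \<hh>" if "x \<in> carrier \<gg>" for x using linear_mapD(1)[OF \<phi>D(2) that] .
  ultimately show ?thesis
    using closed by (simp add: post_lie_hom_def) (simp add: compose_def \<phi>D \<psi>D)
qed

lemma UEA_map_compose:
  assumes g: "post_lie_algebra \<gg>" and h: "post_lie_algebra \<hh>" and k: "post_lie_algebra \<kk>"
    and \<phi>: "\<phi> \<in> post_lie_hom \<gg> \<hh>" and \<psi>: "\<psi> \<in> post_lie_hom \<hh> \<kk>"
  shows "UEA_map \<gg> \<kk> (compose (carrier \<gg>) \<psi> \<phi>) =
    compose (carrier (UEA \<gg>)) (UEA_map \<hh> \<kk> \<psi>) (UEA_map \<gg> \<hh> \<phi>)"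
proof -
  interpret g: post_lie_algebra \<gg> by fact
  have c: "compose (carrier \<gg>) \<psi> \<phi> \<in> post_lie_hom \<gg> \<kk>"
    by (rule post_lie_hom_compose[OF g.g.vspace_axioms \<phi> \<psi>]) simp
  have words: "map (compose (carrier \<gg>) \<psi> \<phi>) w = map \<psi> (map \<phi> w) \<and> map \<phi> w \<in> lists (carrier \<hh>)"
    if "w \<in> lists (carrier \<gg>)" for w
    using that linear_mapD(1)[OF post_lie_homD(2)[OF \<phi>]]
    by (induction w rule: list.induct) (simp_all add: compose_def)
  note lin = D_bialgebra_homD(2)[OF g.UEA_map_hom[OF k c]]
    linear_map_compose[OF D_bialgebra_homD(2)[OF g.UEA_map_hom[OF h \<phi>]]
      D_bialgebra_homD(2)[OF post_lie_algebra.UEA_map_hom[OF h k \<psi>]]]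
  have "UEA_map \<gg> \<kk> (compose (carrier \<gg>) \<psi> \<phi>) u = UEA_map \<hh> \<kk> \<psi> (UEA_map \<gg> \<hh> \<phi> u)"
    if "u \<in> carrier (UEA \<gg>)" for u
    using words
    by (intro g.uea_ext[OF lin _ that])
      (simp add: g.UEA_map_word[OF k c] g.UEA_map_word[OF h \<phi>] post_lie_algebra.UEA_map_word[OF h k \<psi>]
        del: map_map)
  then show ?thesis
    by (intro extensionalityI[OF D_bialgebra_homD(1)[OF g.UEA_map_hom[OF k c]] compose_extensional])
      (simp add: compose_def)
qed

text \<open>Naturality in the post-Lie algebra: both sides send x to the value of f at the letter
  \<open>\<phi> x\<close>.\<close>

lemma transpose_hom_UEA_map:
  assumes g: "post_lie_algebra \<gg>" and h: "post_lie_algebra \<hh>" and \<phi>: "\<phi> \<in> post_lie_hom \<gg> \<hh>"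
  shows "transpose_hom \<gg> (compose (carrier (UEA \<gg>)) f (UEA_map \<gg> \<hh> \<phi>)) =
    compose (carrier \<gg>) (transpose_hom \<hh> f) \<phi>"
proof (rule extensionalityI[OF post_lie_algebra.transpose_hom_extensional[OF g] compose_extensional])
  interpret g: post_lie_algebra \<gg> by fact
  fix x assume x: "x \<in> carrier \<gg>"
  then have "\<phi> x \<in> carrier \<hh>" using linear_mapD(1)[OF post_lie_homD(2)[OF \<phi>]] by blast
  then show "transpose_hom \<gg> (compose (carrier (UEA \<gg>)) f (UEA_map \<gg> \<hh> \<phi>)) x =
      compose (carrier \<gg>) (transpose_hom \<hh> f) \<phi> x"
    using x by (simp add: g.transpose_hom_apply compose_def g.UEA_map_word[OF h \<phi>]
        post_lie_algebra.transpose_hom_apply[OF h])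
qed

text \<open>Naturality in the D-bialgebra. That f is a morphism enters because
  \<open>Prim_map D h\<close> is \<open>undefined\<close> off the primitive elements, so f has to
  send letters to primitive elements.\<close>

lemma transpose_hom_compose:
  assumes g: "post_lie_algebra \<gg>" and D: "D_bialgebra D" and f: "f \<in> D_bialgebra_hom (UEA \<gg>) D"
  shows "transpose_hom \<gg> (compose (carrier (UEA \<gg>)) h f) =
    compose (carrier \<gg>) (Prim_map D h) (transpose_hom \<gg> f)"
proof (rule extensionalityI[OF post_lie_algebra.transpose_hom_extensional[OF g] compose_extensional])
  interpret g: post_lie_algebra \<gg> by fact
  fix x assume x: "x \<in> carrier \<gg>"
  then have "f (uea_word \<gg> [x]) \<in> primitives D"
    by (intro D_bialgebra.Prim_map_hom(2)[OF g.D_bialgebra_UEA D f]) simp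
  then show "transpose_hom \<gg> (compose (carrier (UEA \<gg>)) h f) x =
      compose (carrier \<gg>) (Prim_map D h) (transpose_hom \<gg> f) x"
    using x by (simp add: g.transpose_hom_apply compose_def Prim_map_def)
qed

text \<open>Carriers live in type variables, so the adjunction is spelled out for arbitrary objects:
  both assignments are functors, with three objects on each side for the composition laws, and the
  transposition is a bijection natural in both arguments.\<close>

theorem proposition22:
  fixes g\<^sub>1 :: "('k::field_char_0, 'g1) post_lie"
    and g\<^sub>2 :: "('k, 'g2) post_lie"
    and g\<^sub>3 :: "('k, 'g3) post_lie"
    and D\<^sub>1 :: "('k, 'd1) D_bialg"
    and D\<^sub>2 :: "('k, 'd2) D_bialg"
    and D\<^sub>3 :: "('k, 'd3) D_bialg"
  assumes "post_lie_algebra g\<^sub>1" and "post_lie_algebra g\<^sub>2" and "post_lie_algebra g\<^sub>3"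
    and "D_bialgebra D\<^sub>1" and "D_bialgebra D\<^sub>2" and "D_bialgebra D\<^sub>3"
  shows
    "(D_bialgebra (UEA g\<^sub>1) \<and>
      (\<forall>\<phi>\<in>post_lie_hom g\<^sub>1 g\<^sub>2. UEA_map g\<^sub>1 g\<^sub>2 \<phi> \<in> D_bialgebra_hom (UEA g\<^sub>1) (UEA g\<^sub>2)) \<and>
      UEA_map g\<^sub>1 g\<^sub>1 (\<lambda>x\<in>carrier g\<^sub>1. x) = (\<lambda>x\<in>carrier (UEA g\<^sub>1). x) \<and>
      (\<forall>\<phi>\<in>post_lie_hom g\<^sub>1 g\<^sub>2. \<forall>\<psi>\<in>post_lie_hom g\<^sub>2 g\<^sub>3.
        UEA_map g\<^sub>1 g\<^sub>3 (compose (carrier g\<^sub>1) \<psi> \<phi>) =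
        compose (carrier (UEA g\<^sub>1)) (UEA_map g\<^sub>2 g\<^sub>3 \<psi>) (UEA_map g\<^sub>1 g\<^sub>2 \<phi>)))
     \<and>
     (post_lie_algebra (Prim D\<^sub>1) \<and>
      (\<forall>f\<in>D_bialgebra_hom D\<^sub>1 D\<^sub>2. Prim_map D\<^sub>1 f \<in> post_lie_hom (Prim D\<^sub>1) (Prim D\<^sub>2)) \<and>
      Prim_map D\<^sub>1 (\<lambda>x\<in>carrier D\<^sub>1. x) = (\<lambda>x\<in>carrier (Prim D\<^sub>1). x) \<and>
      (\<forall>f\<in>D_bialgebra_hom D\<^sub>1 D\<^sub>2. \<forall>h\<in>D_bialgebra_hom D\<^sub>2 D\<^sub>3.
        Prim_map D\<^sub>1 (compose (carrier D\<^sub>1) h f) =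
        compose (carrier (Prim D\<^sub>1)) (Prim_map D\<^sub>2 h) (Prim_map D\<^sub>1 f)))
     \<and>
     bij_betw (transpose_hom g\<^sub>1) (D_bialgebra_hom (UEA g\<^sub>1) D\<^sub>1) (post_lie_hom g\<^sub>1 (Prim D\<^sub>1))
     \<and>
     (\<forall>\<phi>\<in>post_lie_hom g\<^sub>1 g\<^sub>2. \<forall>f\<in>D_bialgebra_hom (UEA g\<^sub>2) D\<^sub>1.
        transpose_hom g\<^sub>1 (compose (carrier (UEA g\<^sub>1)) f (UEA_map g\<^sub>1 g\<^sub>2 \<phi>)) =
        compose (carrier g\<^sub>1) (transpose_hom g\<^sub>2 f) \<phi>)
     \<and>
     (\<forall>f\<in>D_bialgebra_hom (UEA g\<^sub>1) D\<^sub>1. \<forall>h\<in>D_bialgebra_hom D\<^sub>1 D\<^sub>2.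
        transpose_hom g\<^sub>1 (compose (carrier (UEA g\<^sub>1)) h f) =
        compose (carrier g\<^sub>1) (Prim_map D\<^sub>1 h) (transpose_hom g\<^sub>1 f))"
  using assms
  by (intro conjI ballI post_lie_algebra.D_bialgebra_UEA post_lie_algebra.UEA_map_hom UEA_map_id
      UEA_map_compose D_bialgebra.post_lie_algebra_Prim D_bialgebra.Prim_map_hom(1)
      D_bialgebra.Prim_map_id D_bialgebra.Prim_map_compose post_lie_algebra.transpose_hom_bij
      transpose_hom_UEA_map transpose_hom_compose)

end
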